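(* Let $\overline{N}:=N+2\gamma$ and assume $\overline{N}\neq 2$. Then for all $u\in C_{0}^{\infty}(\mathbb{R}^{N})$, $$\int_{\mathbb{R}^{N}}|x|^{2}|\Delta_{k}u|^{2}\,d\mu_{k}\ \geq\ \frac{(\overline{N}-2)^{2}}{4}\int_{\mathbb{R}^{N}}|\nabla_{k}u|^{2}\,d\mu_{k},$$ and the constant $\frac{(\overline{N}-2)^{2}}{4}$ is sharp, i.e. it cannot be replaced by any larger constant for which the inequality holds for all such $u$.
   Context: Dunkl setting. $R\subset\mathbb{R}^{N}\setminus\{0\}$ is a root system: a finite set with $R\cap\mathbb{R}\alpha=\{-\alpha,\alpha\}$ and $\sigma_{\alpha}(R)=R$ for all $\alpha\in R$, where $\sigma_{\alpha}x=x-2\frac{\langle\alpha,x\rangle}{\langle\alpha,\alpha\rangle}\alpha$; it is normalized so that $|\alpha|^{2}=2$ for all $\alpha\in R$. $G$ is the finite group generated by the reflections $\sigma_{\alpha}$, $\alpha\in R$. $R_{+}$ is a fixed positive subsystem, so $R=R_{+}\cup(-R_{+})$ (disjoint union). $k:R\to[0,\infty)$, $\alpha\mapsto k_{\alpha}$, is a $G$-invariant function, and $\gamma:=\sum_{\alpha\in R_{+}}k_{\alpha}$. The Dunkl operators are $$T_{i}u(x)=\partial_{i}u(x)+\sum_{\alpha\in R_{+}}k_{\alpha}\alpha_{i}\frac{u(x)-u(\sigma_{\alpha}x)}{\langle\alpha,x\rangle},\qquad i=1,\dots,N,$$ $\nabla_{k}=(T_{1},\dots,T_{N})$ and $\Delta_{k}=\sum_{i=1}^{N}T_{i}^{2}$.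 The weighted measure is $d\mu_{k}=\omega_{k}(x)\,dx$ with $\omega_{k}(x)=\prod_{\alpha\in R_{+}}|\langle\alpha,x\rangle|^{2k_{\alpha}}$. Functions $u$ are real-valued. *)

theory Defs
  imports "HOL-Analysis.Analysis" "HOL-Algebra.Bij" "HOL-Algebra.Generated_Groups"
begin

section \<open>Root systems and reflection groups\<close>

definition reflection :: "real ^ 'n \<Rightarrow> real ^ 'n \<Rightarrow> real ^ 'n" where
  "reflection \<alpha> x = x - (2 * (\<alpha> \<bullet> x) / (\<alpha> \<bullet> \<alpha>)) *\<^sub>R \<alpha>"

definition root_system :: "(real ^ 'n) set \<Rightarrow> bool" where
  "root_system R \<longleftrightarrow>
     finite R \<and> 0 \<notin> R \<and>
     (\<forall>\<alpha>\<in>R. R \<inter> range (\<lambda>c. c *\<^sub>R \<alpha>) = {- \<alpha>, \<alpha>}) \<and>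
     (\<forall>\<alpha>\<in>R. reflection \<alpha> ` R = R)"

definition normalized_root_system :: "(real ^ 'n) set \<Rightarrow> bool" where
  "normalized_root_system R \<longleftrightarrow> root_system R \<and> (\<forall>\<alpha>\<in>R. (norm \<alpha>)\<^sup>2 = 2)"

text \<open>A positive subsystem is cut out by a hyperplane containing no root; for a root system
  this gives the disjoint decomposition of \<open>R\<close> into \<open>R\<^sub>+\<close> and \<open>-R\<^sub>+\<close>.\<close>

definition positive_subsystem :: "(real ^ 'n) set \<Rightarrow> (real ^ 'n) set \<Rightarrow> bool" where
  "positive_subsystem R Rp \<longleftrightarrow>
     (\<exists>\<beta>. (\<forall>\<alpha>\<in>R. \<alpha> \<bullet> \<beta> \<noteq> 0) \<and> Rp = {\<alpha>\<in>R. \<alpha> \<bullet> \<beta> > 0})"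

definition reflection_group :: "(real ^ 'n) set \<Rightarrow> (real ^ 'n \<Rightarrow> real ^ 'n) set" where
  "reflection_group R = generate (BijGroup UNIV) (reflection ` R)"

definition multiplicity_function :: "(real ^ 'n) set \<Rightarrow> (real ^ 'n \<Rightarrow> real) \<Rightarrow> bool" where
  "multiplicity_function R k \<longleftrightarrow>
     (\<forall>\<alpha>\<in>R. 0 \<le> k \<alpha>) \<and>
     (\<forall>g\<in>reflection_group R. \<forall>\<alpha>\<in>R. k (g \<alpha>) = k \<alpha>)"

definition homogeneous_dim :: "(real ^ 'n) set \<Rightarrow> (real ^ 'n \<Rightarrow> real) \<Rightarrow> real" where
  "homogeneous_dim Rp k = real CARD('n) + 2 * (\<Sum>\<alpha>\<in>Rp. k \<alpha>)"

section \<open>Smooth functions with compact support\<close>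

definition partial_deriv :: "'n \<Rightarrow> (real ^ 'n \<Rightarrow> real) \<Rightarrow> real ^ 'n \<Rightarrow> real" where
  "partial_deriv i u x = frechet_derivative u (at x) (axis i 1)"

primrec C_k :: "nat \<Rightarrow> (real ^ 'n \<Rightarrow> real) \<Rightarrow> bool" where
  "C_k 0 u \<longleftrightarrow> continuous_on UNIV u"
| "C_k (Suc m) u \<longleftrightarrow> (\<forall>x. u differentiable (at x)) \<and> (\<forall>i. C_k m (partial_deriv i u))"

definition test_function :: "(real ^ 'n \<Rightarrow> real) \<Rightarrow> bool" where
  "test_function u \<longleftrightarrow> (\<forall>m. C_k m u) \<and> compact (closure {x. u x \<noteq> 0})"

section \<open>Dunkl operators and the weighted measure\<close>

text \<open>The quotient \<open>(u x - u (\<sigma>\<^sub>\<alpha> x)) / \<langle>\<alpha>, x\<rangle>\<close> is read with its continuous extension to the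
  hyperplane \<open>\<langle>\<alpha>, x\<rangle> = 0\<close>. As \<open>\<sigma>\<^sub>\<alpha> y = y - (2 \<langle>\<alpha>, y\<rangle> / \<bar>\<alpha>\<bar>\<^sup>2) \<alpha>\<close>, the limit there, for
  continuously differentiable \<open>u\<close>, is \<open>2 / \<bar>\<alpha>\<bar>\<^sup>2\<close> times the derivative of \<open>u\<close> in direction \<open>\<alpha>\<close>.
  This keeps Dunkl operators inside the smooth functions, so that they can be iterated.\<close>

definition dunkl_quotient :: "real ^ 'n \<Rightarrow> (real ^ 'n \<Rightarrow> real) \<Rightarrow> real ^ 'n \<Rightarrow> real" where
  "dunkl_quotient \<alpha> u x =
     (if \<alpha> \<bullet> x = 0 then 2 / (\<alpha> \<bullet> \<alpha>) * frechet_derivative u (at x) \<alpha>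
      else (u x - u (reflection \<alpha> x)) / (\<alpha> \<bullet> x))"

definition dunkl_op ::
  "(real ^ 'n) set \<Rightarrow> (real ^ 'n \<Rightarrow> real) \<Rightarrow> 'n \<Rightarrow> (real ^ 'n \<Rightarrow> real) \<Rightarrow> real ^ 'n \<Rightarrow> real" where
  "dunkl_op Rp k i u x =
     partial_deriv i u x + (\<Sum>\<alpha>\<in>Rp. k \<alpha> * \<alpha> $ i * dunkl_quotient \<alpha> u x)"

definition dunkl_gradient ::
  "(real ^ 'n) set \<Rightarrow> (real ^ 'n \<Rightarrow> real) \<Rightarrow> (real ^ 'n \<Rightarrow> real) \<Rightarrow> real ^ 'n \<Rightarrow> real ^ 'n" where
  "dunkl_gradient Rp k u x = (\<chi> i. dunkl_op Rp k i u x)"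

definition dunkl_laplacian ::
  "(real ^ 'n) set \<Rightarrow> (real ^ 'n \<Rightarrow> real) \<Rightarrow> (real ^ 'n \<Rightarrow> real) \<Rightarrow> real ^ 'n \<Rightarrow> real" where
  "dunkl_laplacian Rp k u x = (\<Sum>i\<in>UNIV. dunkl_op Rp k i (dunkl_op Rp k i u) x)"

text \<open>Since \<open>0 powr 0 = 0\<close>, a factor with \<open>k \<alpha> = 0\<close> vanishes on the hyperplane orthogonal to
  \<open>\<alpha>\<close> instead of being \<open>1\<close>; this is a null set, so the measure is unaffected.\<close>

definition dunkl_weight :: "(real ^ 'n) set \<Rightarrow> (real ^ 'n \<Rightarrow> real) \<Rightarrow> real ^ 'n \<Rightarrow> real" where
  "dunkl_weight Rp k x = (\<Prod>\<alpha>\<in>Rp. \<bar>\<alpha> \<bullet> x\<bar> powr (2 * k \<alpha>))"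

definition dunkl_measure :: "(real ^ 'n) set \<Rightarrow> (real ^ 'n \<Rightarrow> real) \<Rightarrow> (real ^ 'n) measure" where
  "dunkl_measure Rp k = density lborel (\<lambda>x. ennreal (dunkl_weight Rp k x))"

end

theory Submission
  imports Defs
begin

text \<open>
  Write \<open>T\<^sub>i\<close> for the Dunkl operators, \<open>\<mu>\<close> for the weighted measure, \<open>N\<close> for the homogeneous
  dimension and \<open>E = x \<bullet> \<nabla>\<close> for the ordinary Euler field. The inequality rests on two integral
  identities for a test function \<open>u\<close>.

  The first is the infinitesimal scaling law of the energy \<open>\<integral> |\<nabla>\<^sub>k u|\<^sup>2 d\<mu>\<close>, which is homogeneous of
  degree \<open>2 - N\<close> under dilations: \<open>\<integral> E u \<Delta>\<^sub>k u d\<mu> = (N - 2)/2 \<integral> |\<nabla>\<^sub>k u|\<^sup>2 d\<mu>\<close>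
  (\<open>integral_euler_mult_dunkl_laplacian\<close>). For the ordinary Euler
  field, as opposed to \<open>\<Sum> x\<^sub>i T\<^sub>i\<close>, it follows from \<open>T\<^sub>i E = E T\<^sub>i + T\<^sub>i\<close> and the antisymmetry of
  \<open>T\<^sub>i\<close>. The second is the energy identity
  \<open>\<integral> |\<nabla>\<^sub>k u|\<^sup>2 d\<mu> = \<integral> |\<nabla>u|\<^sup>2 d\<mu> + \<Sum> k\<^sub>\<alpha> \<integral> ((u - u \<circ> \<sigma>\<^sub>\<alpha>)/\<langle>\<alpha>,x\<rangle>)\<^sup>2 d\<mu>\<close>, of which the bound
  \<open>\<integral> |\<nabla>u|\<^sup>2 d\<mu> \<le> \<integral> |\<nabla>\<^sub>k u|\<^sup>2 d\<mu>\<close> is needed (\<open>integral_grad_le\<close>). Since \<open>|E u| \<le> |x| |\<nabla>u|\<close>, the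
  pointwise inequality \<open>0 \<le> |x|\<^sup>2 |\<Delta>\<^sub>k u|\<^sup>2 - 2 b E u \<Delta>\<^sub>k u + b\<^sup>2 |\<nabla>u|\<^sup>2\<close> with \<open>b = (N - 2)/2\<close>
  integrates to the claim (\<open>dunkl_rellich_inequality\<close>).

  Everything about integration comes from the single fact \<open>\<integral> T\<^sub>i h d\<mu> = 0\<close> for compactly supported \<open>C\<^sup>1\<close>
  functions \<open>h\<close> (\<open>integral_dunkl_op\<close>), proved by replacing the weight by a smooth invariant one. The
  energy identity follows from it by integrating \<open>\<Delta>\<^sub>k (u\<^sup>2)\<close>, once \<open>\<Delta>\<^sub>k\<close> is known in closed form
  (\<open>dunkl_laplacian_formula\<close>); the mixed terms in \<open>\<Delta>\<^sub>k\<close> cancel because, for pairs of roots with a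
  given product of reflections, they telescope (\<open>sum_rotations_eq_0\<close>).

  For sharpness one takes \<open>u\<close> radial, with \<open>|\<nabla>u|\<close> close to the borderline power \<open>|x|\<^sup>-\<^sup>N\<^sup>/\<^sup>2\<close>, cut off
  smoothly in the variable \<open>\<epsilon> ln |x|\<^sup>2\<close>. The measure
  \<open>|x|\<^sup>-\<^sup>N d\<mu>\<close> is invariant under dilations, so derivatives of profiles in that variable integrate to
  \<open>0\<close> (\<open>integral_log_profile_derivative\<close>), and this alone gives the quotient of the two integrals as
  \<open>(N - 2)\<^sup>2/4 + O(\<epsilon>\<^sup>2)\<close> (\<open>near_extremals\<close>).
\<close>

section \<open>Lebesgue measure and linear isometries\<close>

text \<open>By Vitali's covering theorem an open set is, up to a null set, a disjoint countable union of balls.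
  A linear isometry maps each of them to a ball of the same radius, hence of the same measure.\<close>

lemma isometry_emeasure_open_le:
  fixes T :: "'a::euclidean_space \<Rightarrow> 'a"
  assumes T: "orthogonal_transformation T" and U: "open U"
  shows "emeasure lborel U \<le> emeasure lborel (T ` U)"
proof -
  let ?K = "{p. 0 < snd p \<and> ball (fst p) (snd p) \<subseteq> U}"
  obtain C where C: "countable C" "C \<subseteq> ?K"
     "pairwise (\<lambda>i j. disjnt (ball (fst i) (snd i)) (ball (fst j) (snd j))) C"
     "negligible (U - (\<Union>i\<in>C. ball (fst i) (snd i :: real)))"
  proof (rule Vitali_covering_theorem_balls [of U ?K fst snd])
    fix x and d :: real assume x: "x \<in> U" "0 < d"
    then obtain e where e: "e > 0" "ball x e \<subseteq> U" using U by (meson openE)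
    have "(x, min e (d/2)) \<in> ?K" using e x by auto
    then show "\<exists>i. i \<in> ?K \<and> x \<in> ball (fst i) (snd i) \<and> snd i < d"
      using x e by (intro exI[of _ "(x, min e (d/2))"]) auto
  qed
  let ?B = "\<lambda>i. ball (fst i) (snd i :: real) :: 'a set"
  have linj: "linear T" "inj T" 
    using T orthogonal_transformation_linear orthogonal_transformation_inj by auto
  have TB: "T ` ?B i = ball (T (fst i)) (snd i)" for i
    by (rule image_orthogonal_transformation_ball[OF T])
  have opn: "open (T ` U)"
    using linj U by (meson T open_surjective_linear_image orthogonal_transformation_surj)
  have pd: "disjoint_family_on ?B C"
    using C(3) by (auto simp: pairwise_def disjoint_family_on_def disjnt_def)
  have pdT: "disjoint_family_on (\<lambda>i. T ` ?B i) C"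
    unfolding disjoint_family_on_def
  proof (intro ballI impI)
    fix i j assume "i \<in> C" "j \<in> C" "i \<noteq> j"
    then have "?B i \<inter> ?B j = {}" using pd by (auto simp: disjoint_family_on_def)
    then show "T ` ?B i \<inter> T ` ?B j = {}" using linj(2)
      by (metis image_Int image_empty)
  qed
  have null: "emeasure lborel (U - (\<Union>i\<in>C. ?B i)) = 0"
  proof -
    have "U - (\<Union>i\<in>C. ?B i) \<in> null_sets lebesgue"
      using C(4) by (simp add: negligible_iff_null_sets)
    moreover have "U - (\<Union>i\<in>C. ?B i) \<in> sets borel"
      using U by (intro sets.Diff borel_open open_UN) auto
    ultimately show ?thesis
      by (auto simp: null_sets_completion_iff)
  qed
  have "emeasure lborel U = emeasure lborel (\<Union>i\<in>C. ?B i)"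
  proof -
    have "U = (\<Union>i\<in>C. ?B i) \<union> (U - (\<Union>i\<in>C. ?B i))" using C(2) by auto
    then have "emeasure lborel U \<le> emeasure lborel (\<Union>i\<in>C. ?B i) + emeasure lborel (U - (\<Union>i\<in>C. ?B i))"
      using U emeasure_subadditive[of "\<Union>i\<in>C. ?B i" lborel "U - (\<Union>i\<in>C. ?B i)"]
      by (simp add: borel_open open_UN sets.Diff)
    moreover have "emeasure lborel (\<Union>i\<in>C. ?B i) \<le> emeasure lborel U"
      using C(2) U by (intro emeasure_mono) auto
    ultimately show ?thesis using null by simp
  qed
  also have "\<dots> = (\<integral>\<^sup>+i. emeasure lborel (?B i) \<partial>count_space C)"
    using C(1) pd by (intro emeasure_UN_countable) auto
  also have "\<dots> = (\<integral>\<^sup>+i. emeasure lborel (T ` ?B i) \<partial>count_space C)"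
    using C(2) by (intro nn_integral_cong) (auto simp: TB emeasure_ball less_imp_le)
  also have "\<dots> = emeasure lborel (\<Union>i\<in>C. T ` ?B i)"
    using C(1) pdT by (intro emeasure_UN_countable[symmetric]) (auto simp: TB)
  also have "\<dots> \<le> emeasure lborel (T ` U)"
    using C(2) opn by (intro emeasure_mono) auto
  finally show ?thesis .
qed

text \<open>Lebesgue measure is determined by its values on boxes, and a box and its image are both open; so the
  inequality above, used for the isometry and for its inverse, is enough.\<close>

lemma lborel_distr_orthogonal_transformation:
  fixes T :: "'a::euclidean_space \<Rightarrow> 'a"
  assumes T: "orthogonal_transformation T"
  shows "distr lborel borel T = lborel"
proof -
  have "continuous_on UNIV T"
    using T orthogonal_transformation_linear linear_continuous_on linear_conv_bounded_linear by blast
  then have meas: "T \<in> borel_measurable borel" by (rule borel_measurable_continuous_onI)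
  obtain S where S: "orthogonal_transformation S" "\<And>x. S (T x) = x" "\<And>x. T (S x) = x"
    by (metis T bij_inv_eq_iff orthogonal_transformation_bij orthogonal_transformation_inv)
  have "lborel = distr lborel borel T"
  proof (rule lborel_eqI)
    fix l u :: 'a assume lu: "\<And>b. b \<in> Basis \<Longrightarrow> l \<bullet> b \<le> u \<bullet> b"
    have vim: "T -` box l u = S ` box l u" using S by (auto simp: image_iff) metis
    have op: "open (S ` box l u)"
      using S by (meson open_box open_surjective_linear_image orthogonal_transformation_surj orthogonal_transformation_linear)
    have TS: "T ` S ` box l u = box l u" using S by (auto simp: image_image)
    have "emeasure (distr lborel borel T) (box l u) = emeasure lborel (S ` box l u)"
      using meas vim by (simp add: emeasure_distr)
    also have "\<dots> = emeasure lborel (box l u)"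
      using isometry_emeasure_open_le[OF S(1), of "box l u"] isometry_emeasure_open_le[OF T op] TS
      by (auto intro: antisym)
    finally show "emeasure (distr lborel borel T) (box l u) = (\<Prod>b\<in>Basis. (u - l) \<bullet> b)"
      using lu by simp
  qed simp
  then show ?thesis by simp
qed

section \<open>Functions of class \<open>C_k\<close>\<close>

definition grad :: "(real ^ 'n \<Rightarrow> real) \<Rightarrow> real ^ 'n \<Rightarrow> real ^ 'n" where
  "grad u x = (\<chi> i. partial_deriv i u x)"

lemma grad_nth: "grad u x $ i = partial_deriv i u x"
  by (simp add: grad_def)

lemma inner_vec_real: "(v :: real ^ 'n) \<bullet> w = (\<Sum>i\<in>UNIV. v $ i * w $ i)"
  by (simp add: inner_vec_def)

lemma frechet_derivative_eq_grad:
  fixes u :: "real ^ 'n \<Rightarrow> real"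
  assumes "u differentiable (at x)"
  shows "frechet_derivative u (at x) = (\<lambda>v. grad u x \<bullet> v)"
proof
  fix v :: "real ^ 'n"
  let ?D = "frechet_derivative u (at x)"
  have lin: "linear ?D" using assms by (rule linear_frechet_derivative)
  have "?D v = ?D (\<Sum>i\<in>UNIV. v $ i *\<^sub>R axis i 1)"
    using basis_expansion[of v] by (simp add: scalar_mult_eq_scaleR)
  also have "\<dots> = (\<Sum>i\<in>UNIV. v $ i * ?D (axis i 1))"
    by (simp add: linear_sum[OF lin] linear_cmul[OF lin])
  also have "\<dots> = grad u x \<bullet> v"
    by (simp add: inner_vec_real grad_def partial_deriv_def mult.commute)
  finally show "?D v = grad u x \<bullet> v" .
qed

lemma has_derivative_grad:
  "u differentiable (at x) \<Longrightarrow> (u has_derivative (\<lambda>v. grad u x \<bullet> v)) (at x)"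
  by (simp add: frechet_derivative_works frechet_derivative_eq_grad[symmetric])

lemma partial_deriv_unique:
  "(u has_derivative D) (at x) \<Longrightarrow> partial_deriv i u x = D (axis i 1)"
  unfolding partial_deriv_def by (metis frechet_derivative_at)

lemma grad_unique:
  assumes "(u has_derivative (\<lambda>v. g \<bullet> v)) (at x)" shows "grad u x = g"
  by (simp add: vec_eq_iff grad_nth partial_deriv_unique[OF assms] inner_axis)

lemma C_k_differentiable: "C_k (Suc m) u \<Longrightarrow> u differentiable (at x)"
  by simp

lemma C_k_partial_deriv: "C_k (Suc m) u \<Longrightarrow> C_k m (partial_deriv i u)"
  by simp

lemma C_k_mono_Suc: "C_k (Suc m) u \<Longrightarrow> C_k m u"
proof (induction m arbitrary: u)
  case 0
  then show ?case by (auto intro!: differentiable_imp_continuous_on simp: differentiable_on_def)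
next
  case (Suc m)
  then have "C_k m (partial_deriv i u)" for i by (metis C_k.simps(2))
  then show ?case using Suc.prems by simp
qed

lemma C_k_continuous: "C_k m u \<Longrightarrow> continuous_on UNIV u"
  by (induction m) (use C_k_mono_Suc in auto)

lemma C_k_grad_continuous: "C_k (Suc m) u \<Longrightarrow> continuous_on UNIV (grad u)"
  unfolding grad_def by (intro continuous_on_vec_lambda) (auto intro: C_k_continuous)

lemma C_k_has_derivative:
  "C_k (Suc m) u \<Longrightarrow> (u has_derivative (\<lambda>v. grad u x \<bullet> v)) (at x)"
  by (rule has_derivative_grad[OF C_k_differentiable])

text \<open>Differentiation under the integral sign produces the derivative as an integral of bounded linear
  maps; this criterion takes it in that form.\<close>

lemma C_k_oneI:
  fixes D :: "real ^ 'n \<Rightarrow> ((real ^ 'n) \<Rightarrow>\<^sub>L real)"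
  assumes "\<And>x. (u has_derivative blinfun_apply (D x)) (at x)" "continuous_on UNIV D"
  shows "C_k (Suc 0) u"
proof -
  have "partial_deriv i u = (\<lambda>x. D x (axis i 1))" for i
    using partial_deriv_unique[OF assms(1)] by auto
  moreover have "continuous_on UNIV (\<lambda>x. D x (axis i 1))" for i
    using assms(2) by (intro continuous_intros)
  ultimately show ?thesis using assms(1) by (auto simp: differentiable_def)
qed

lemma C_k_one_gradI:
  fixes u :: "real ^ 'n \<Rightarrow> real"
  assumes "\<And>x. (u has_derivative (\<lambda>v. g x \<bullet> v)) (at x)" "continuous_on UNIV g"
  shows "C_k (Suc 0) u"
proof (rule C_k_oneI)
  show "(u has_derivative blinfun_apply (blinfun_inner_right (g x))) (at x)" for x
    using assms(1) by simp
  show "continuous_on UNIV (\<lambda>x. blinfun_inner_right (g x))"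
    using assms(2) by (intro continuous_intros)
qed

lemma partial_deriv_const: "partial_deriv i (\<lambda>x. c) = (\<lambda>x. 0)"
  by (rule ext) (subst partial_deriv_unique, auto intro!: derivative_eq_intros)

lemma partial_deriv_nth: "partial_deriv i (\<lambda>x. x $ j) = (\<lambda>x. if i = j then 1 else 0)"
  by (rule ext, subst partial_deriv_unique[OF bounded_linear_imp_has_derivative[OF bounded_linear_vec_nth]])
    (auto simp: axis_def)

lemma partial_deriv_add:
  "\<lbrakk>u differentiable (at x); v differentiable (at x)\<rbrakk>
   \<Longrightarrow> partial_deriv i (\<lambda>x. u x + v x) x = partial_deriv i u x + partial_deriv i v x"
  by (subst partial_deriv_unique[OF has_derivative_add[OF has_derivative_grad has_derivative_grad]])
    (auto simp: inner_axis grad_nth)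

lemma partial_deriv_mult:
  "\<lbrakk>u differentiable (at x); v differentiable (at x)\<rbrakk>
   \<Longrightarrow> partial_deriv i (\<lambda>x. u x * v x) x = u x * partial_deriv i v x + partial_deriv i u x * v x"
  by (subst partial_deriv_unique[OF has_derivative_mult[OF has_derivative_grad has_derivative_grad]])
    (auto simp: inner_axis grad_nth)

lemma C_k_const: "C_k m (\<lambda>x. c)"
  by (induction m arbitrary: c) (auto simp: partial_deriv_const)

lemma C_k_nth: "C_k m (\<lambda>x :: real ^ 'n. x $ i)"
proof (cases m)
  case 0
  then show ?thesis by (auto intro!: continuous_intros)
next
  case (Suc n)
  have "(\<lambda>x :: real ^ 'n. x $ i) differentiable at x" for x
    using bounded_linear_imp_differentiable[OF bounded_linear_vec_nth] by blast
  then show ?thesis using Suc by (auto simp: partial_deriv_nth C_k_const)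
qed

lemma C_k_add: "C_k m u \<Longrightarrow> C_k m v \<Longrightarrow> C_k m (\<lambda>x. u x + v x)"
proof (induction m arbitrary: u v)
  case 0
  then show ?case by (auto intro!: continuous_intros)
next
  case (Suc m)
  have "partial_deriv i (\<lambda>x. u x + v x) = (\<lambda>x. partial_deriv i u x + partial_deriv i v x)" for i
    using Suc.prems by (auto simp: partial_deriv_add)
  then show ?case using Suc by (auto intro!: differentiable_add)
qed

lemma C_k_mult: "C_k m u \<Longrightarrow> C_k m v \<Longrightarrow> C_k m (\<lambda>x. u x * v x)"
proof (induction m arbitrary: u v)
  case 0
  then show ?case by (auto intro!: continuous_intros)
next
  case (Suc m)
  have "partial_deriv i (\<lambda>x. u x * v x) = (\<lambda>x. u x * partial_deriv i v x + partial_deriv i u x * v x)" for i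
    using Suc.prems by (auto simp: partial_deriv_mult)
  then show ?case using Suc C_k_mono_Suc[of m u] C_k_mono_Suc[of m v]
    by (auto intro!: differentiable_mult C_k_add)
qed

lemma C_k_sum: "(\<And>a. a \<in> A \<Longrightarrow> C_k m (u a)) \<Longrightarrow> C_k m (\<lambda>x. \<Sum>a\<in>A. u a x)"
  by (induction A rule: infinite_finite_induct) (auto simp: C_k_const C_k_add)

lemma C_k_inner_grad: "C_k (Suc m) u \<Longrightarrow> C_k m (\<lambda>x. grad u x \<bullet> v)"
  unfolding inner_vec_real grad_nth
  by (intro C_k_sum C_k_mult C_k_const) auto

lemma grad_mult:
  "\<lbrakk>u differentiable (at x); v differentiable (at x)\<rbrakk>
   \<Longrightarrow> grad (\<lambda>x. u x * v x) x = u x *\<^sub>R grad v x + v x *\<^sub>R grad u x"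
  by (simp add: vec_eq_iff grad_nth partial_deriv_mult)

lemma C_k_line_derivative:
  assumes "C_k (Suc m) u"
  shows "((\<lambda>t. u (x + t *\<^sub>R v)) has_real_derivative (grad u (x + t *\<^sub>R v) \<bullet> v)) (at t)"
proof -
  have "((\<lambda>t. x + t *\<^sub>R v) has_derivative (\<lambda>h. h *\<^sub>R v)) (at t)"
    by (auto intro!: derivative_eq_intros)
  from has_derivative_compose[OF this C_k_has_derivative[OF assms]]
  show ?thesis by (simp add: has_field_derivative_def mult.commute[of _ "grad _ _ \<bullet> v"])
qed

lemma grad_inner_axis: "grad u x \<bullet> axis i 1 = partial_deriv i u x"
  by (simp add: inner_axis grad_nth)

text \<open>The second difference is a first difference, in direction \<open>i\<close>, of a first difference in direction
  \<open>j\<close>; the mean value theorem applies to each in turn.\<close>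

lemma second_difference_mean_value:
  fixes u :: "real ^ 'n \<Rightarrow> real"
  assumes u: "C_k (Suc (Suc 0)) u" and h: "h > 0"
  defines "e \<equiv> (\<lambda>i. axis i 1 :: real ^ 'n)"
  shows "\<exists>\<xi> \<eta>. 0 < \<xi> \<and> \<xi> < h \<and> 0 < \<eta> \<and> \<eta> < h \<and>
    u (x + h *\<^sub>R e i + h *\<^sub>R e j) - u (x + h *\<^sub>R e i) - u (x + h *\<^sub>R e j) + u x
      = h * (h * partial_deriv j (partial_deriv i u) (x + \<xi> *\<^sub>R e i + \<eta> *\<^sub>R e j))"
proof -
  have ui: "C_k (Suc 0) (partial_deriv i u)" using u by simp
  let ?g = "\<lambda>s. u (x + h *\<^sub>R e j + s *\<^sub>R e i) - u (x + s *\<^sub>R e i)"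
  let ?g' = "\<lambda>s. partial_deriv i u (x + h *\<^sub>R e j + s *\<^sub>R e i) - partial_deriv i u (x + s *\<^sub>R e i)"
  have "(?g has_real_derivative ?g' s) (at s)" for s
    using DERIV_diff[OF C_k_line_derivative[OF u, of "x + h *\<^sub>R e j" "e i" s] C_k_line_derivative[OF u, of x "e i" s]]
    by (simp add: e_def grad_inner_axis)
  from MVT2[OF h this] obtain \<xi> where \<xi>: "0 < \<xi>" "\<xi> < h" "?g h - ?g 0 = h * ?g' \<xi>" by auto
  let ?k = "\<lambda>s. partial_deriv i u (x + \<xi> *\<^sub>R e i + s *\<^sub>R e j)"
  have "(?k has_real_derivative partial_deriv j (partial_deriv i u) (x + \<xi> *\<^sub>R e i + s *\<^sub>R e j)) (at s)" for s
    using C_k_line_derivative[OF ui, of "x + \<xi> *\<^sub>R e i" "e j" s] by (simp add: e_def grad_inner_axis)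
  from MVT2[OF h this] obtain \<eta> where \<eta>: "0 < \<eta>" "\<eta> < h"
    "?k h - ?k 0 = h * partial_deriv j (partial_deriv i u) (x + \<xi> *\<^sub>R e i + \<eta> *\<^sub>R e j)" by auto
  have "?g' \<xi> = ?k h - ?k 0" by (simp add: algebra_simps)
  with \<xi>(3) \<eta>(3) have "?g h - ?g 0 = h * (h * partial_deriv j (partial_deriv i u) (x + \<xi> *\<^sub>R e i + \<eta> *\<^sub>R e j))"
    by simp
  moreover have "?g h - ?g 0 = u (x + h *\<^sub>R e i + h *\<^sub>R e j) - u (x + h *\<^sub>R e i) - u (x + h *\<^sub>R e j) + u x"
    by (simp add: algebra_simps)
  ultimately show ?thesis using \<xi> \<eta> by metis
qed

text \<open>The second difference is symmetric in \<open>i\<close> and \<open>j\<close>. Divided by \<open>h\<^sup>2\<close> it is a value near \<open>x\<close> of either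
  mixed derivative, and both are continuous.\<close>

lemma partial_deriv_commute:
  fixes u :: "real ^ 'n \<Rightarrow> real"
  assumes u: "C_k (Suc (Suc 0)) u"
  shows "partial_deriv i (partial_deriv j u) x = partial_deriv j (partial_deriv i u) x"
proof -
  let ?e = "\<lambda>i. axis i 1 :: real ^ 'n"
  let ?h = "\<lambda>n. 1 / real (Suc n)"
  have lim: "(\<lambda>n. partial_deriv j (partial_deriv i u) (x + \<xi> n *\<^sub>R ?e i + \<eta> n *\<^sub>R ?e j))
      \<longlonglongrightarrow> partial_deriv j (partial_deriv i u) x"
    if "\<And>n. 0 < \<xi> n \<and> \<xi> n < ?h n \<and> 0 < \<eta> n \<and> \<eta> n < ?h n" for \<xi> \<eta> :: "nat \<Rightarrow> real" and i j
  proof -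
    have lim0: "?h \<longlonglongrightarrow> 0"
      using LIMSEQ_inverse_real_of_nat by (simp add: inverse_eq_divide)
    have "\<xi> \<longlonglongrightarrow> 0" "\<eta> \<longlonglongrightarrow> 0"
      using that by (auto intro!: tendsto_sandwich[OF _ _ tendsto_const lim0] simp: less_imp_le)
    then have l: "(\<lambda>n. x + \<xi> n *\<^sub>R ?e i + \<eta> n *\<^sub>R ?e j) \<longlonglongrightarrow> x + 0 *\<^sub>R ?e i + 0 *\<^sub>R ?e j"
      by (intro tendsto_intros)
    have "isCont (partial_deriv j (partial_deriv i u)) x"
      using u by (simp add: continuous_on_eq_continuous_at)
    then show ?thesis by (rule isCont_tendsto_compose) (use l in simp)
  qed
  have "\<forall>n. \<exists>\<xi> \<eta> \<xi>' \<eta>'. (0 < \<xi> \<and> \<xi> < ?h n \<and> 0 < \<eta> \<and> \<eta> < ?h n) \<and>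
     (0 < \<xi>' \<and> \<xi>' < ?h n \<and> 0 < \<eta>' \<and> \<eta>' < ?h n) \<and>
     partial_deriv j (partial_deriv i u) (x + \<xi> *\<^sub>R ?e i + \<eta> *\<^sub>R ?e j) =
     partial_deriv i (partial_deriv j u) (x + \<xi>' *\<^sub>R ?e j + \<eta>' *\<^sub>R ?e i)"
  proof
    fix n
    have h: "?h n > 0" by simp
    obtain \<xi> \<eta> where a: "0 < \<xi> \<and> \<xi> < ?h n \<and> 0 < \<eta> \<and> \<eta> < ?h n"
      "u (x + ?h n *\<^sub>R ?e i + ?h n *\<^sub>R ?e j) - u (x + ?h n *\<^sub>R ?e i)
        - u (x + ?h n *\<^sub>R ?e j) + u x
      = ?h n * (?h n * partial_deriv j (partial_deriv i u) (x + \<xi> *\<^sub>R ?e i + \<eta> *\<^sub>R ?e j))"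
      using second_difference_mean_value[OF u h] by metis
    obtain \<xi>' \<eta>' where b: "0 < \<xi>' \<and> \<xi>' < ?h n \<and> 0 < \<eta>' \<and> \<eta>' < ?h n"
      "u (x + ?h n *\<^sub>R ?e j + ?h n *\<^sub>R ?e i) - u (x + ?h n *\<^sub>R ?e j)
        - u (x + ?h n *\<^sub>R ?e i) + u x
      = ?h n * (?h n * partial_deriv i (partial_deriv j u) (x + \<xi>' *\<^sub>R ?e j + \<eta>' *\<^sub>R ?e i))"
      using second_difference_mean_value[OF u h] by metis
    have "u (x + ?h n *\<^sub>R ?e j + ?h n *\<^sub>R ?e i) = u (x + ?h n *\<^sub>R ?e i + ?h n *\<^sub>R ?e j)"
      by (simp add: add_ac)
    then have "?h n * (?h n * partial_deriv j (partial_deriv i u) (x + \<xi> *\<^sub>R ?e i + \<eta> *\<^sub>R ?e j))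
      = ?h n * (?h n * partial_deriv i (partial_deriv j u) (x + \<xi>' *\<^sub>R ?e j + \<eta>' *\<^sub>R ?e i))"
      using a(2) b(2) by linarith
    then have "partial_deriv j (partial_deriv i u) (x + \<xi> *\<^sub>R ?e i + \<eta> *\<^sub>R ?e j) =
     partial_deriv i (partial_deriv j u) (x + \<xi>' *\<^sub>R ?e j + \<eta>' *\<^sub>R ?e i)" using h by simp
    with a(1) b(1) show "\<exists>\<xi> \<eta> \<xi>' \<eta>'. (0 < \<xi> \<and> \<xi> < ?h n \<and> 0 < \<eta> \<and> \<eta> < ?h n) \<and>
     (0 < \<xi>' \<and> \<xi>' < ?h n \<and> 0 < \<eta>' \<and> \<eta>' < ?h n) \<and>
     partial_deriv j (partial_deriv i u) (x + \<xi> *\<^sub>R ?e i + \<eta> *\<^sub>R ?e j) =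
     partial_deriv i (partial_deriv j u) (x + \<xi>' *\<^sub>R ?e j + \<eta>' *\<^sub>R ?e i)" by blast
  qed
  then obtain \<xi> \<eta> \<xi>' \<eta>' where s:
    "\<And>n. 0 < \<xi> n \<and> \<xi> n < ?h n \<and> 0 < \<eta> n \<and> \<eta> n < ?h n"
    "\<And>n. 0 < \<xi>' n \<and> \<xi>' n < ?h n \<and> 0 < \<eta>' n \<and> \<eta>' n < ?h n"
    "\<And>n. partial_deriv j (partial_deriv i u) (x + \<xi> n *\<^sub>R ?e i + \<eta> n *\<^sub>R ?e j) =
     partial_deriv i (partial_deriv j u) (x + \<xi>' n *\<^sub>R ?e j + \<eta>' n *\<^sub>R ?e i)"
    by metis
  show ?thesis
    using lim[OF s(1), of j i] lim[OF s(2), of i j] unfolding s(3)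
    by (rule LIMSEQ_unique[symmetric])
qed

section \<open>Compact support\<close>

text \<open>Balls around the origin are invariant under reflections, which makes this form of compact support
  stable under Dunkl operators.\<close>

definition compactly_supported :: "(real ^ 'n \<Rightarrow> real) \<Rightarrow> bool" where
  "compactly_supported u \<longleftrightarrow> (\<exists>r. \<forall>x. r < norm x \<longrightarrow> u x = 0)"

lemma compactly_supportedE:
  assumes "compactly_supported u"
  obtains r where "r > 0" "\<And>x. r < norm x \<Longrightarrow> u x = 0"
proof -
  obtain r where "\<forall>x. r < norm x \<longrightarrow> u x = 0" using assms by (auto simp: compactly_supported_def)
  then show ?thesis by (intro that[of "max r 1"]) auto
qed

lemma test_function_compactly_supported:
  assumes "test_function u" shows "compactly_supported u"
proof -
  have "bounded (closure {x. u x \<noteq> 0})" using assms by (simp add: test_function_def compact_imp_bounded)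
  then obtain r where "\<forall>x\<in>closure {x. u x \<noteq> 0}. norm x \<le> r" by (auto simp: bounded_iff)
  moreover have "{x. u x \<noteq> 0} \<subseteq> closure {x. u x \<noteq> 0}" by (rule closure_subset)
  ultimately show ?thesis unfolding compactly_supported_def
    by (intro exI[of _ r]) force
qed

lemma compact_closure_support:
  assumes "compactly_supported u" shows "compact (closure {x. u x \<noteq> 0})"
proof -
  obtain r where "\<And>x. r < norm x \<Longrightarrow> u x = 0" using assms by (rule compactly_supportedE) blast
  then have "bounded {x. u x \<noteq> 0}" by (auto simp: bounded_iff intro!: exI[of _ r] leI)
  then show ?thesis by (simp add: compact_closure)
qed

lemma compactly_supported_mult_left:
  "compactly_supported u \<Longrightarrow> compactly_supported (\<lambda>x. u x * v x)"
  unfolding compactly_supported_def by auto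

lemma compactly_supported_mult_right:
  "compactly_supported v \<Longrightarrow> compactly_supported (\<lambda>x. u x * v x)"
  unfolding compactly_supported_def by auto

lemma compactly_supported_add:
  assumes "compactly_supported u" "compactly_supported v"
  shows "compactly_supported (\<lambda>x. u x + v x)"
proof -
  obtain r s where "\<And>x. r < norm x \<Longrightarrow> u x = 0" "\<And>x. s < norm x \<Longrightarrow> v x = 0"
    using assms by (auto simp: compactly_supported_def)
  then show ?thesis unfolding compactly_supported_def by (intro exI[of _ "max r s"]) auto
qed

lemma compactly_supported_sum:
  "(\<And>a. a \<in> A \<Longrightarrow> compactly_supported (u a)) \<Longrightarrow> compactly_supported (\<lambda>x. \<Sum>a\<in>A. u a x)"
  by (induction A rule: infinite_finite_induct)
    (auto intro: compactly_supported_add, auto simp: compactly_supported_def)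

lemma grad_eq_0_outside_support:
  assumes "\<And>x. r < norm x \<Longrightarrow> u x = 0" "r < norm x"
  shows "grad u x = 0"
proof -
  have "open {y :: real ^ 'n. r < norm y}" by (intro open_Collect_less continuous_intros)
  then have ev: "\<forall>\<^sub>F y in nhds x. u y = 0"
    using assms by (auto simp: eventually_nhds)
  have "((\<lambda>x. 0) has_derivative (\<lambda>v. 0)) (at x)" by simp
  then have "(u has_derivative (\<lambda>v. 0)) (at x)"
    by (rule has_derivative_transform_eventually)
      (use ev eventually_nhds_x_imp_x in \<open>auto simp: eventually_at_filter elim: eventually_mono\<close>)
  then show ?thesis using grad_unique[of u 0 x] by simp
qed

lemma compactly_supported_partial_deriv:
  "compactly_supported u \<Longrightarrow> compactly_supported (partial_deriv i u)"
  unfolding compactly_supported_def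
  by (metis grad_eq_0_outside_support grad_nth zero_index)

lemma continuous_compactly_supported_bounded:
  assumes "continuous_on UNIV u" "compactly_supported u"
  obtains B where "B > 0" "\<And>x. \<bar>u x\<bar> \<le> B"
proof -
  obtain r where r: "r > 0" "\<And>x. r < norm x \<Longrightarrow> u x = 0"
    using assms(2) by (rule compactly_supportedE) blast
  have "bounded (u ` cball 0 r)"
    using assms(1) by (intro compact_imp_bounded compact_continuous_image) (auto intro: continuous_on_subset)
  then obtain B where B: "B > 0" "\<And>x. x \<in> cball 0 r \<Longrightarrow> \<bar>u x\<bar> \<le> B"
    by (auto simp: bounded_pos)
  have "\<bar>u x\<bar> \<le> B" for x
    using B r(2)[of x] by (cases "norm x \<le> r") auto
  with B(1) show ?thesis by (rule that)
qed

lemma integrable_lborel_compactly_supported: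
  fixes u :: "real ^ 'n \<Rightarrow> real"
  assumes "continuous_on UNIV u" "compactly_supported u"
  shows "integrable lborel u"
proof -
  obtain r where r: "\<And>x. r < norm x \<Longrightarrow> u x = 0" using assms(2) by (rule compactly_supportedE) blast
  have "integrable lborel (\<lambda>x. indicator (cball 0 r) x *\<^sub>R u x)"
    using borel_integrable_compact[of "cball 0 r" u] assms(1) by (auto intro: continuous_on_subset)
  moreover have "(\<lambda>x. indicator (cball 0 r) x *\<^sub>R u x) = u"
    using r by (auto simp: fun_eq_iff indicator_def)
  ultimately show ?thesis by simp
qed

text \<open>By translation invariance the difference quotients of \<open>u\<close> have integral \<open>0\<close>; they are bounded by
  the supremum of the derivative, so dominated convergence applies.\<close>

lemma integral_partial_deriv_eq_0:
  fixes u :: "real ^ 'n \<Rightarrow> real"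
  assumes u: "C_k (Suc 0) u" "compactly_supported u"
  shows "(\<integral>x. partial_deriv i u x \<partial>lborel) = 0"
proof -
  let ?e = "axis i 1 :: real ^ 'n"
  define f where "f n x = (u (x + (1 / real (Suc n)) *\<^sub>R ?e) - u x) * real (Suc n)" for n x
  have contu: "continuous_on UNIV u" using u(1) by (rule C_k_continuous)
  obtain r where r: "r > 0" "\<And>x. r < norm x \<Longrightarrow> u x = 0"
    using u(2) by (rule compactly_supportedE) blast
  obtain B where B: "B > 0" "\<And>x. \<bar>partial_deriv i u x\<bar> \<le> B"
    using continuous_compactly_supported_bounded[of "partial_deriv i u"] u compactly_supported_partial_deriv by auto
  have intu: "integrable lborel u"
    by (rule integrable_lborel_compactly_supported[OF contu u(2)])
  have shift: "integrable lborel (\<lambda>x. u (x + c))" "(\<integral>x. u (x + c) \<partial>lborel) = (\<integral>x. u x \<partial>lborel)" for c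
  proof -
    have d: "distr lborel borel ((+) c) = lborel" by (rule lborel_distr_plus)
    have "integrable (distr lborel borel ((+) c)) u" using intu d by simp
    then show "integrable lborel (\<lambda>x. u (x + c))"
      by (subst (asm) integrable_distr_eq) (use contu in \<open>auto simp: add.commute intro: borel_measurable_continuous_onI\<close>)
    have "(\<integral>x. u x \<partial>distr lborel borel ((+) c)) = (\<integral>x. u (c + x) \<partial>lborel)"
      by (rule integral_distr) (use contu in \<open>auto intro: borel_measurable_continuous_onI\<close>)
    then show "(\<integral>x. u (x + c) \<partial>lborel) = (\<integral>x. u x \<partial>lborel)"
      using d by (simp add: add.commute)
  qed
  have int0: "(\<integral>x. f n x \<partial>lborel) = 0" for n
    unfolding f_def using shift intu by (subst integral_mult_left_zero) (subst Bochner_Integration.integral_diff, auto)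
  have lim: "(\<lambda>n. f n x) \<longlonglongrightarrow> partial_deriv i u x" for x
  proof -
    have "((\<lambda>t. u (x + t *\<^sub>R ?e)) has_real_derivative partial_deriv i u x) (at 0)"
      using C_k_line_derivative[OF u(1), of x ?e 0] by (simp add: grad_inner_axis)
    then have "((\<lambda>h. (u (x + h *\<^sub>R ?e) - u x) / h) \<longlongrightarrow> partial_deriv i u x) (at 0)"
      by (simp add: DERIV_def)
    moreover have "filterlim (\<lambda>n. 1 / real (Suc n)) (at 0) sequentially"
      unfolding filterlim_at using LIMSEQ_inverse_real_of_nat by (auto simp: inverse_eq_divide)
    ultimately have "(\<lambda>n. (u (x + (1 / real (Suc n)) *\<^sub>R ?e) - u x) / (1 / real (Suc n)))
        \<longlonglongrightarrow> partial_deriv i u x"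
      by (rule filterlim_compose)
    then show ?thesis by (simp add: f_def)
  qed
  \<comment> \<open>The step is at most 1, so all difference quotients vanish outside the ball of radius \<open>r + 1\<close>.\<close>
  have bound: "norm (f n x) \<le> indicator (cball 0 (r + 1)) x *\<^sub>R B" for n x
  proof (cases "norm x \<le> r + 1")
    case True
    have "\<exists>z>0. z < 1 / real (Suc n) \<and> u (x + (1 / real (Suc n)) *\<^sub>R ?e) - u (x + 0 *\<^sub>R ?e)
       = (1 / real (Suc n) - 0) * partial_deriv i u (x + z *\<^sub>R ?e)"
      by (rule MVT2) (use C_k_line_derivative[OF u(1), of x ?e] in \<open>auto simp: grad_inner_axis\<close>)
    then obtain z where "u (x + (1 / real (Suc n)) *\<^sub>R ?e) - u x = 1 / real (Suc n) * partial_deriv i u (x + z *\<^sub>R ?e)"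
      by auto
    then have "f n x = partial_deriv i u (x + z *\<^sub>R ?e)" by (simp add: f_def)
    then show ?thesis using B True by simp
  next
    case False
    define d where "d = (1 / real (Suc n)) *\<^sub>R ?e"
    have "norm d \<le> 1" by (simp add: d_def field_simps)
    then have "norm (x + d) > r"
      using False norm_triangle_ineq4[of "x + d" d] by simp
    then have "norm (x + (1 / real (Suc n)) *\<^sub>R ?e) > r" by (simp only: d_def)
    then show ?thesis using False r by (simp add: f_def)
  qed
  have "(\<lambda>n. \<integral>x. f n x \<partial>lborel) \<longlonglongrightarrow> (\<integral>x. partial_deriv i u x \<partial>lborel)"
  proof (rule integral_dominated_convergence[where w = "\<lambda>x. indicator (cball 0 (r + 1)) x *\<^sub>R B"])
    show "partial_deriv i u \<in> borel_measurable lborel"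
      using u(1) by (auto intro: borel_measurable_continuous_onI)
    show "f n \<in> borel_measurable lborel" for n
      unfolding f_def using contu
      by (auto intro!: borel_measurable_continuous_onI continuous_intros continuous_on_compose2[OF contu])
    show "integrable lborel (\<lambda>x :: real ^ 'n. indicator (cball 0 (r + 1)) x *\<^sub>R B)"
      by (rule borel_integrable_compact) auto
  qed (use lim bound in auto)
  then have "(\<lambda>n. 0 :: real) \<longlonglongrightarrow> (\<integral>x. partial_deriv i u x \<partial>lborel)" by (simp add: int0)
  then show ?thesis using LIMSEQ_unique tendsto_const by blast
qed

section \<open>Reflections\<close>

lemma reflection_alt: "\<alpha> \<bullet> \<alpha> = 2 \<Longrightarrow> reflection \<alpha> x = x - (\<alpha> \<bullet> x) *\<^sub>R \<alpha>"
  by (simp add: reflection_def)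

lemma reflection_uminus: "reflection (- \<alpha>) = reflection \<alpha>"
  by (simp add: reflection_def fun_eq_iff)

lemma reflection_self: "\<alpha> \<bullet> \<alpha> = 2 \<Longrightarrow> reflection \<alpha> \<alpha> = - \<alpha>"
  by (simp add: reflection_alt scaleR_2)

lemma inner_reflection_self: "\<alpha> \<bullet> \<alpha> = 2 \<Longrightarrow> \<alpha> \<bullet> reflection \<alpha> x = - (\<alpha> \<bullet> x)"
  by (simp add: reflection_alt inner_diff_right)

lemma reflection_involution: "\<alpha> \<bullet> \<alpha> = 2 \<Longrightarrow> reflection \<alpha> (reflection \<alpha> x) = x"
  by (simp add: reflection_alt inner_diff_right)

lemma inner_reflection_left: "\<alpha> \<bullet> \<alpha> = 2 \<Longrightarrow> reflection \<alpha> x \<bullet> y = x \<bullet> reflection \<alpha> y"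
  by (simp add: reflection_alt inner_diff_right inner_diff_left inner_commute)

lemma inner_reflection_reflection:
  "\<alpha> \<bullet> \<alpha> = 2 \<Longrightarrow> reflection \<alpha> x \<bullet> reflection \<alpha> y = x \<bullet> y"
  by (simp add: inner_reflection_left reflection_involution)

lemma norm_reflection: "\<alpha> \<bullet> \<alpha> = 2 \<Longrightarrow> norm (reflection \<alpha> x) = norm x"
  by (simp add: norm_eq_sqrt_inner inner_reflection_reflection)

lemma linear_reflection: "linear (reflection \<alpha>)"
  by (rule linearI) (simp_all add: reflection_def inner_add_right algebra_simps add_divide_distrib)

lemma orthogonal_transformation_reflection:
  "\<alpha> \<bullet> \<alpha> = 2 \<Longrightarrow> orthogonal_transformation (reflection \<alpha>)"
  by (simp add: orthogonal_transformation_def linear_reflection inner_reflection_reflection)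

lemma continuous_on_reflection [continuous_intros]:
  "continuous_on S f \<Longrightarrow> continuous_on S (\<lambda>x. reflection \<alpha> (f x))"
  unfolding reflection_def by (cases "\<alpha> \<bullet> \<alpha> = 0") (auto intro!: continuous_intros)

lemma reflection_fixed: "\<alpha> \<bullet> x = 0 \<Longrightarrow> reflection \<alpha> x = x"
  by (simp add: reflection_def)

lemma reflection_conjugate:
  assumes "\<alpha> \<bullet> \<alpha> = 2" "\<beta> \<bullet> \<beta> = 2"
  shows "reflection (reflection \<beta> \<alpha>) x = reflection \<beta> (reflection \<alpha> (reflection \<beta> x))"
  using assms
  by (simp add: reflection_alt inner_reflection_reflection inner_diff_left inner_diff_right inner_commute
      algebra_simps)

section \<open>Difference quotients along a reflection\<close>

text \<open>On the hyperplane both sides vanish, so this division-free form of the definition holds everywhere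
  and can be differentiated everywhere.\<close>

lemma dunkl_quotient_mult:
  "(\<alpha> \<bullet> x) * dunkl_quotient \<alpha> u x = u x - u (reflection \<alpha> x)"
  by (simp add: dunkl_quotient_def reflection_fixed)

lemma dunkl_quotient_off:
  "\<alpha> \<bullet> x \<noteq> 0 \<Longrightarrow> dunkl_quotient \<alpha> u x = (u x - u (reflection \<alpha> x)) / (\<alpha> \<bullet> x)"
  by (simp add: dunkl_quotient_def)

text \<open>The difference \<open>u x - u (\<sigma>\<^sub>\<alpha> x)\<close> is the integral of the derivative of \<open>u\<close> along the segment between
  the two points, which is proportional to \<open>\<langle>\<alpha>, x\<rangle>\<close>. The integral makes sense on the hyperplane too;
  this is why the difference quotient loses only one order of differentiability.\<close>

lemma dunkl_quotient_eq_integral: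
  assumes \<alpha>: "\<alpha> \<bullet> \<alpha> = 2" and u: "C_k (Suc 0) u"
  shows "dunkl_quotient \<alpha> u x = integral (cbox 0 1) (\<lambda>t. grad u (x - (t * (\<alpha> \<bullet> x)) *\<^sub>R \<alpha>) \<bullet> \<alpha>)"
proof (cases "\<alpha> \<bullet> x = 0")
  case True
  then show ?thesis
    using frechet_derivative_eq_grad[OF C_k_differentiable[OF u]] \<alpha> by (simp add: dunkl_quotient_def)
next
  case False
  let ?s = "\<alpha> \<bullet> x"
  have "((\<lambda>t. - ?s * (grad u (x - (t * ?s) *\<^sub>R \<alpha>) \<bullet> \<alpha>)) has_integral
     u (x + 1 *\<^sub>R (- ?s *\<^sub>R \<alpha>)) - u (x + 0 *\<^sub>R (- ?s *\<^sub>R \<alpha>))) {0..1}"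
  proof (rule fundamental_theorem_of_calculus)
    show "((\<lambda>t. u (x + t *\<^sub>R (- ?s *\<^sub>R \<alpha>))) has_vector_derivative
      - ?s * (grad u (x - (t * ?s) *\<^sub>R \<alpha>) \<bullet> \<alpha>)) (at t within {0..1})" for t
      using C_k_line_derivative[OF u, of x "- ?s *\<^sub>R \<alpha>" t]
      by (auto simp: has_real_derivative_iff_has_vector_derivative intro: has_vector_derivative_at_within)
  qed simp
  from has_integral_mult_right[OF this, of "- 1 / ?s"]
  have "((\<lambda>t. grad u (x - (t * ?s) *\<^sub>R \<alpha>) \<bullet> \<alpha>) has_integral (u x - u (reflection \<alpha> x)) / ?s) {0..1}"
    using False \<alpha> minus_divide_left[of "u (x - ?s *\<^sub>R \<alpha>) - u x" ?s] by (simp add: reflection_alt)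
  then show ?thesis
    using False by (simp add: dunkl_quotient_def integral_unique)
qed

lemma continuous_dunkl_quotient:
  assumes \<alpha>: "\<alpha> \<bullet> \<alpha> = 2" and u: "C_k (Suc 0) u"
  shows "continuous_on UNIV (dunkl_quotient \<alpha> u)"
proof -
  have "continuous_on UNIV (\<lambda>x. integral (cbox 0 1) (\<lambda>t. grad u (x - (t * (\<alpha> \<bullet> x)) *\<^sub>R \<alpha>) \<bullet> \<alpha>))"
    by (rule integral_continuous_on_param)
      (auto simp: split_beta intro!: continuous_intros continuous_on_compose2[OF C_k_grad_continuous[OF u]])
  then show ?thesis by (simp add: dunkl_quotient_eq_integral[OF \<alpha> u, abs_def])
qed

lemma C_k_dunkl_quotient:
  assumes \<alpha>: "\<alpha> \<bullet> \<alpha> = 2" and u: "C_k (Suc (Suc 0)) u"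
  shows "C_k (Suc 0) (dunkl_quotient \<alpha> u)"
proof (rule C_k_oneI)
  let ?f = "\<lambda>x. grad u x \<bullet> \<alpha>"
  let ?P = "\<lambda>t x. x - (t * (\<alpha> \<bullet> x)) *\<^sub>R \<alpha>"
  have f: "C_k (Suc 0) ?f" using u by (rule C_k_inner_grad)
  have u1: "C_k (Suc 0) u" using u by (rule C_k_mono_Suc)
  let ?D = "\<lambda>x t. blinfun_inner_right (?P t (grad ?f (?P t x)))"
  have contD: "continuous_on (UNIV \<times> cbox 0 1) (\<lambda>(x, t). ?D x t)"
    by (auto simp: split_beta intro!: continuous_intros continuous_on_compose2[OF C_k_grad_continuous[OF f]])
  show "(dunkl_quotient \<alpha> u has_derivative blinfun_apply (integral (cbox 0 1) (?D x))) (at x)" for x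
  proof -
    have "((\<lambda>x. integral (cbox 0 1) (\<lambda>t. ?f (?P t x))) has_derivative
        blinfun_apply (integral (cbox 0 1) (?D x))) (at x within UNIV)"
    proof (rule leibniz_rule)
      fix y and t :: real
      have "(?P t has_derivative ?P t) (at y within UNIV)"
        by (auto intro!: derivative_eq_intros)
      from has_derivative_compose[OF this C_k_has_derivative[OF f]]
      have "((\<lambda>x. ?f (?P t x)) has_derivative (\<lambda>v. grad ?f (?P t y) \<bullet> ?P t v)) (at y within UNIV)" .
      moreover have "(\<lambda>v. grad ?f (?P t y) \<bullet> ?P t v) = blinfun_apply (?D y t)"
        by (auto simp: fun_eq_iff inner_diff_left inner_diff_right inner_commute)
      ultimately show "((\<lambda>x. ?f (?P t x)) has_derivative blinfun_apply (?D y t)) (at y within UNIV)"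
        by simp
    next
      fix y
      show "(\<lambda>t. ?f (?P t y)) integrable_on cbox 0 1"
        by (rule integrable_continuous)
          (auto intro!: continuous_intros continuous_on_compose2[OF C_k_grad_continuous[OF u1]])
    qed (use contD in auto)
    then show ?thesis by (simp add: dunkl_quotient_eq_integral[OF \<alpha> u1, abs_def])
  qed
  show "continuous_on UNIV (\<lambda>x. integral (cbox 0 1) (?D x))"
    by (rule integral_continuous_on_param[OF contD])
qed

lemma compactly_supported_dunkl_quotient:
  assumes \<alpha>: "\<alpha> \<bullet> \<alpha> = 2" and u: "C_k (Suc 0) u" "compactly_supported u"
  shows "compactly_supported (dunkl_quotient \<alpha> u)"
proof -
  obtain r where r: "\<And>x. r < norm x \<Longrightarrow> u x = 0" using u(2) by (rule compactly_supportedE) blast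
  have "dunkl_quotient \<alpha> u x = 0" if "r < norm x" for x
    using that r norm_reflection[OF \<alpha>, of x] grad_eq_0_outside_support[OF r that]
      frechet_derivative_eq_grad[OF C_k_differentiable[OF u(1)]]
    by (simp add: dunkl_quotient_def)
  then show ?thesis by (auto simp: compactly_supported_def)
qed

section \<open>The Dunkl setting\<close>

locale dunkl =
  fixes R Rp :: "(real ^ 'n) set" and k :: "real ^ 'n \<Rightarrow> real"
  assumes root: "normalized_root_system R"
    and positive: "positive_subsystem R Rp"
    and multiplicity: "multiplicity_function R k"
begin

lemma finite_R: "finite R" and reflection_R: "\<alpha> \<in> R \<Longrightarrow> reflection \<alpha> ` R = R"
  and root_inner: "\<alpha> \<in> R \<Longrightarrow> \<alpha> \<bullet> \<alpha> = 2"
  using root by (auto simp: normalized_root_system_def root_system_def power2_norm_eq_inner)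

lemma reflection_in_R: "\<alpha> \<in> R \<Longrightarrow> \<beta> \<in> R \<Longrightarrow> reflection \<alpha> \<beta> \<in> R"
  using reflection_R by blast

lemma minus_in_R: "\<alpha> \<in> R \<Longrightarrow> - \<alpha> \<in> R"
  using reflection_in_R[of \<alpha> \<alpha>] reflection_self[OF root_inner] by simp

lemma Rp_subset: "Rp \<subseteq> R"
  using positive by (auto simp: positive_subsystem_def)

lemma finite_Rp: "finite Rp"
  using finite_R Rp_subset finite_subset by blast

lemma Rp_inner: "\<alpha> \<in> Rp \<Longrightarrow> \<alpha> \<bullet> \<alpha> = 2"
  using Rp_subset root_inner by blast

lemma R_decomposition: "R = Rp \<union> uminus ` Rp" "Rp \<inter> uminus ` Rp = {}"
proof -
  obtain \<beta> where \<beta>: "\<forall>\<alpha>\<in>R. \<alpha> \<bullet> \<beta> \<noteq> 0" "Rp = {\<alpha>\<in>R. \<alpha> \<bullet> \<beta> > 0}"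
    using positive by (auto simp: positive_subsystem_def)
  show "Rp \<inter> uminus ` Rp = {}" using \<beta> by auto
  have "\<alpha> \<in> Rp \<union> uminus ` Rp" if "\<alpha> \<in> R" for \<alpha>
  proof (cases "\<alpha> \<bullet> \<beta> > 0")
    case False
    then have "- \<alpha> \<in> Rp" using \<beta> that minus_in_R[OF that] by force
    then show ?thesis by (metis UnI2 add.inverse_inverse imageI)
  qed (use that \<beta> in auto)
  then show "R = Rp \<union> uminus ` Rp" using Rp_subset minus_in_R by auto
qed

lemma multiplicity_nonneg: "\<alpha> \<in> R \<Longrightarrow> 0 \<le> k \<alpha>"
  using multiplicity by (simp add: multiplicity_function_def)

lemma Rp_multiplicity_nonneg: "\<alpha> \<in> Rp \<Longrightarrow> 0 \<le> k \<alpha>"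
  using multiplicity_nonneg Rp_subset by blast

lemma multiplicity_reflection: "\<alpha> \<in> R \<Longrightarrow> \<beta> \<in> R \<Longrightarrow> k (reflection \<beta> \<alpha>) = k \<alpha>"
proof -
  assume "\<alpha> \<in> R" "\<beta> \<in> R"
  moreover have "reflection \<beta> \<in> reflection_group R"
    unfolding reflection_group_def using \<open>\<beta> \<in> R\<close> by (intro generate.incl) simp
  ultimately show ?thesis using multiplicity by (simp add: multiplicity_function_def)
qed

lemma multiplicity_minus: "\<alpha> \<in> R \<Longrightarrow> k (- \<alpha>) = k \<alpha>"
  using multiplicity_reflection[of \<alpha> \<alpha>] reflection_self[OF root_inner] by simp

lemma sum_R:
  fixes f :: "real ^ 'n \<Rightarrow> real"
  assumes "\<And>\<alpha>. \<alpha> \<in> R \<Longrightarrow> f (- \<alpha>) = f \<alpha>"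
  shows "(\<Sum>\<alpha>\<in>R. f \<alpha>) = 2 * (\<Sum>\<alpha>\<in>Rp. f \<alpha>)"
proof -
  have "(\<Sum>\<alpha>\<in>R. f \<alpha>) = (\<Sum>\<alpha>\<in>Rp. f \<alpha>) + (\<Sum>\<alpha>\<in>uminus ` Rp. f \<alpha>)"
    by (subst R_decomposition(1), rule sum.union_disjoint) (use finite_Rp R_decomposition(2) in auto)
  also have "(\<Sum>\<alpha>\<in>uminus ` Rp. f \<alpha>) = (\<Sum>\<alpha>\<in>Rp. f \<alpha>)"
    using assms Rp_subset by (subst sum.reindex) (auto intro!: sum.cong)
  finally show ?thesis by simp
qed

lemma prod_R:
  fixes f :: "real ^ 'n \<Rightarrow> real"
  assumes "\<And>\<alpha>. \<alpha> \<in> R \<Longrightarrow> f (- \<alpha>) = f \<alpha>"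
  shows "(\<Prod>\<alpha>\<in>R. f \<alpha>) = (\<Prod>\<alpha>\<in>Rp. f \<alpha>)\<^sup>2"
proof -
  have "(\<Prod>\<alpha>\<in>R. f \<alpha>) = (\<Prod>\<alpha>\<in>Rp. f \<alpha>) * (\<Prod>\<alpha>\<in>uminus ` Rp. f \<alpha>)"
    by (subst R_decomposition(1), rule prod.union_disjoint) (use finite_Rp R_decomposition(2) in auto)
  also have "(\<Prod>\<alpha>\<in>uminus ` Rp. f \<alpha>) = (\<Prod>\<alpha>\<in>Rp. f \<alpha>)"
    using assms Rp_subset by (subst prod.reindex) (auto intro!: prod.cong)
  finally show ?thesis by (simp add: power2_eq_square)
qed

lemma bij_reflection_R: "\<beta> \<in> R \<Longrightarrow> bij_betw (reflection \<beta>) R R"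
  by (rule bij_betw_imageI) (metis inj_on_def reflection_involution root_inner, rule reflection_R)

text \<open>A reflection permutes \<open>R\<close> but does not preserve the positive roots. The square of the product over
  \<open>Rp\<close> is the product over \<open>R\<close>, and nonnegative numbers are determined by their squares.\<close>

lemma prod_Rp_reflection:
  fixes f :: "real ^ 'n \<Rightarrow> real"
  assumes \<beta>: "\<beta> \<in> R" and even: "\<And>\<alpha>. \<alpha> \<in> R \<Longrightarrow> f (- \<alpha>) = f \<alpha>" and nonneg: "\<And>\<alpha>. \<alpha> \<in> R \<Longrightarrow> 0 \<le> f \<alpha>"
  shows "(\<Prod>\<alpha>\<in>Rp. f (reflection \<beta> \<alpha>)) = (\<Prod>\<alpha>\<in>Rp. f \<alpha>)"
proof -
  have "(\<Prod>\<alpha>\<in>Rp. f (reflection \<beta> \<alpha>))\<^sup>2 = (\<Prod>\<alpha>\<in>R. f (reflection \<beta> \<alpha>))"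
    using even reflection_in_R[OF \<beta>] linear_neg[OF linear_reflection, of \<beta>] by (subst prod_R) auto
  also have "\<dots> = (\<Prod>\<alpha>\<in>R. f \<alpha>)"
    by (rule prod.reindex_bij_betw[OF bij_reflection_R[OF \<beta>]])
  also have "\<dots> = (\<Prod>\<alpha>\<in>Rp. f \<alpha>)\<^sup>2" by (rule prod_R) (rule even)
  finally show ?thesis
    using nonneg reflection_in_R[OF \<beta>] Rp_subset by (auto intro!: power2_eq_imp_eq prod_nonneg)
qed

abbreviation T where "T i u \<equiv> dunkl_op Rp k i u"
abbreviation q where "q \<equiv> dunkl_quotient"
abbreviation \<mu> where "\<mu> \<equiv> dunkl_measure Rp k"
abbreviation w where "w \<equiv> dunkl_weight Rp k"

lemma continuous_dunkl_op: "C_k (Suc 0) u \<Longrightarrow> continuous_on UNIV (T i u)"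
  unfolding dunkl_op_def
  by (intro continuous_intros continuous_dunkl_quotient Rp_inner C_k_continuous[of 0] C_k_partial_deriv) auto

lemma C_k_dunkl_op: "C_k (Suc (Suc 0)) u \<Longrightarrow> C_k (Suc 0) (T i u)"
  unfolding dunkl_op_def
  by (intro C_k_add C_k_sum C_k_mult C_k_const C_k_dunkl_quotient Rp_inner C_k_partial_deriv) auto

lemma compactly_supported_dunkl_op:
  "C_k (Suc 0) u \<Longrightarrow> compactly_supported u \<Longrightarrow> compactly_supported (T i u)"
  unfolding dunkl_op_def
  by (intro compactly_supported_add compactly_supported_sum compactly_supported_mult_right
      compactly_supported_dunkl_quotient compactly_supported_partial_deriv Rp_inner) auto

end

section \<open>The weighted measure and its smooth regularization\<close>

lemma integral_add_sum:
  fixes f :: "'a \<Rightarrow> real"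
  assumes "integrable M f" "\<And>a. a \<in> A \<Longrightarrow> integrable M (g a)"
  shows "(\<integral>x. f x + (\<Sum>a\<in>A. c a * g a x) \<partial>M) = (\<integral>x. f x \<partial>M) + (\<Sum>a\<in>A. c a * (\<integral>x. g a x \<partial>M))"
  using assms by (subst Bochner_Integration.integral_add) auto

lemma AE_lborel_inner_neq_0:
  fixes \<alpha> :: "'a::euclidean_space"
  assumes "\<alpha> \<noteq> 0" shows "AE x in lborel. \<alpha> \<bullet> x \<noteq> 0"
proof -
  have "{x. \<alpha> \<bullet> x = 0} \<in> null_sets lebesgue"
    using negligible_hyperplane[of \<alpha> 0] assms by (simp add: negligible_iff_null_sets)
  moreover have "{x. \<alpha> \<bullet> x = 0} \<in> sets lborel" by simp
  ultimately have "{x. \<alpha> \<bullet> x = 0} \<in> null_sets lborel" by (simp add: null_sets_completion_iff)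
  then show ?thesis by (rule AE_I') auto
qed

context dunkl
begin

lemma AE_lborel_regular: "AE x in lborel. \<forall>\<alpha>\<in>R. \<alpha> \<bullet> x \<noteq> 0"
  using finite_R root_inner by (intro AE_finite_allI AE_lborel_inner_neq_0) force+

lemma weight_nonneg: "0 \<le> w x"
  by (simp add: dunkl_weight_def prod_nonneg)

lemma weight_measurable [measurable]: "w \<in> borel_measurable borel"
  unfolding dunkl_weight_def by measurable

lemma AE_regular: "AE x in \<mu>. \<forall>\<alpha>\<in>R. \<alpha> \<bullet> x \<noteq> 0"
  unfolding dunkl_measure_def using AE_lborel_regular
  by (subst AE_density) auto

lemma sets_dunkl_measure [measurable_cong, simp]: "sets \<mu> = sets borel"
  by (simp add: dunkl_measure_def)

lemma space_dunkl_measure [simp]: "space \<mu> = UNIV"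
  by (simp add: dunkl_measure_def)

lemma integral_dunkl_measure:
  fixes h :: "real ^ 'n \<Rightarrow> real"
  shows "h \<in> borel_measurable borel \<Longrightarrow> (\<integral>x. h x \<partial>\<mu>) = (\<integral>x. w x * h x \<partial>lborel)"
  unfolding dunkl_measure_def using weight_nonneg by (subst integral_density) auto

lemma integrable_dunkl_measure:
  fixes h :: "real ^ 'n \<Rightarrow> real"
  shows "h \<in> borel_measurable borel \<Longrightarrow> integrable \<mu> h \<longleftrightarrow> integrable lborel (\<lambda>x. w x * h x)"
  unfolding dunkl_measure_def using weight_nonneg by (subst integrable_density) auto

text \<open>For \<open>0 < k \<alpha> \<le> 1/2\<close> the weight is not differentiable on the hyperplane of \<open>\<alpha>\<close>. This family is
  differentiable for \<open>e > 0\<close>, decreases to the weight as \<open>e\<close> tends to \<open>0\<close>, and is still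
  invariant under the reflections.\<close>

definition weight_reg :: "real \<Rightarrow> real ^ 'n \<Rightarrow> real" where
  "weight_reg e x = (\<Prod>\<alpha>\<in>Rp. ((\<alpha> \<bullet> x)\<^sup>2 + e) powr k \<alpha>)"

lemma weight_reg_nonneg: "0 \<le> weight_reg e x"
  by (simp add: weight_reg_def prod_nonneg)

lemma weight_reg_mono: "0 \<le> e \<Longrightarrow> e \<le> e' \<Longrightarrow> weight_reg e x \<le> weight_reg e' x"
  unfolding weight_reg_def
  by (intro prod_mono conjI powr_mono2 Rp_multiplicity_nonneg) auto

lemma weight_eq_weight_reg: "w x = weight_reg 0 x"
proof -
  have "\<bar>a\<bar> powr (2 * c) = (a\<^sup>2 + 0) powr c" for a c :: real
  proof (cases "a = 0")
    case False
    then have "\<bar>a\<bar> powr (2 * c) = (\<bar>a\<bar> powr 2) powr c" by (simp only: powr_powr)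
    also have "\<bar>a\<bar> powr 2 = a\<^sup>2" using False by (simp add: powr_numeral)
    finally show ?thesis by simp
  qed simp
  then show ?thesis by (simp add: dunkl_weight_def weight_reg_def)
qed

lemma weight_reg_reflection:
  assumes \<beta>: "\<beta> \<in> R" and e: "0 \<le> e"
  shows "weight_reg e (reflection \<beta> x) = weight_reg e x"
proof -
  have "weight_reg e (reflection \<beta> x)
      = (\<Prod>\<alpha>\<in>Rp. ((reflection \<beta> \<alpha> \<bullet> x)\<^sup>2 + e) powr k (reflection \<beta> \<alpha>))"
    unfolding weight_reg_def using \<beta> Rp_subset root_inner multiplicity_reflection
    by (intro prod.cong refl) (auto simp: inner_reflection_left)
  also have "\<dots> = weight_reg e x"
    unfolding weight_reg_def
    by (rule prod_Rp_reflection[OF \<beta>, where f = "\<lambda>\<alpha>. ((\<alpha> \<bullet> x)\<^sup>2 + e) powr k \<alpha>"])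
      (auto simp: multiplicity_minus)
  finally show ?thesis .
qed

lemma weight_reflection: "\<beta> \<in> R \<Longrightarrow> w (reflection \<beta> x) = w x"
  by (simp add: weight_eq_weight_reg weight_reg_reflection)

text \<open>Logarithmic differentiation of the product.\<close>

lemma has_derivative_weight_reg:
  assumes e: "0 < e"
  shows "(weight_reg e has_derivative
    (\<lambda>v. (weight_reg e x *\<^sub>R (\<Sum>\<alpha>\<in>Rp. (2 * k \<alpha> * ((\<alpha> \<bullet> x) / ((\<alpha> \<bullet> x)\<^sup>2 + e))) *\<^sub>R \<alpha>)) \<bullet> v)) (at x)"
proof -
  have "((\<lambda>x. \<Prod>\<alpha>\<in>A. ((\<alpha> \<bullet> x)\<^sup>2 + e) powr k \<alpha>) has_derivative
    (\<lambda>v. (\<Prod>\<alpha>\<in>A. ((\<alpha> \<bullet> x)\<^sup>2 + e) powr k \<alpha>) *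
       (\<Sum>\<alpha>\<in>A. 2 * k \<alpha> * ((\<alpha> \<bullet> x) / ((\<alpha> \<bullet> x)\<^sup>2 + e)) * (\<alpha> \<bullet> v)))) (at x)"
    if "finite A" for A
    using that
  proof induction
    case (insert \<alpha> A)
    have pos: "0 < (\<alpha> \<bullet> x)\<^sup>2 + e" using e by (simp add: add_nonneg_pos)
    have "((\<lambda>x. (\<alpha> \<bullet> x)\<^sup>2 + e) has_derivative (\<lambda>v. 2 * (\<alpha> \<bullet> x) * (\<alpha> \<bullet> v))) (at x)"
      by (auto intro!: derivative_eq_intros simp: algebra_simps)
    moreover have "((\<lambda>y. y powr k \<alpha>) has_derivative (\<lambda>v. (k \<alpha> * ((\<alpha> \<bullet> x)\<^sup>2 + e) powr (k \<alpha> - 1)) * v)) (at ((\<alpha> \<bullet> x)\<^sup>2 + e))"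
      using has_real_derivative_powr[OF pos, of "k \<alpha>"] by (simp add: has_field_derivative_def)
    ultimately have "((\<lambda>x. ((\<alpha> \<bullet> x)\<^sup>2 + e) powr k \<alpha>) has_derivative
        (\<lambda>v. (k \<alpha> * ((\<alpha> \<bullet> x)\<^sup>2 + e) powr (k \<alpha> - 1)) * (2 * (\<alpha> \<bullet> x) * (\<alpha> \<bullet> v)))) (at x)"
      by (rule has_derivative_compose)
    moreover have "((\<alpha> \<bullet> x)\<^sup>2 + e) powr (k \<alpha> - 1) = ((\<alpha> \<bullet> x)\<^sup>2 + e) powr k \<alpha> / ((\<alpha> \<bullet> x)\<^sup>2 + e)"
      using pos by (simp add: powr_diff)
    ultimately have *: "((\<lambda>x. ((\<alpha> \<bullet> x)\<^sup>2 + e) powr k \<alpha>) has_derivative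
        (\<lambda>v. ((\<alpha> \<bullet> x)\<^sup>2 + e) powr k \<alpha> * (2 * k \<alpha> * ((\<alpha> \<bullet> x) / ((\<alpha> \<bullet> x)\<^sup>2 + e)) * (\<alpha> \<bullet> v)))) (at x)"
      by (simp add: algebra_simps)
    show ?case
      using has_derivative_mult[OF * insert.IH] insert.hyps by (simp add: algebra_simps)
  qed simp
  from this[OF finite_Rp] show ?thesis
    unfolding weight_reg_def by (simp add: inner_sum_left algebra_simps)
qed

lemma continuous_weight_reg: "0 < e \<Longrightarrow> continuous_on UNIV (weight_reg e)"
  by (meson continuous_at_imp_continuous_on has_derivative_continuous has_derivative_weight_reg)

lemma C_k_weight_reg:
  assumes e: "0 < e" shows "C_k (Suc 0) (weight_reg e)"
proof (rule C_k_one_gradI[OF has_derivative_weight_reg[OF e]])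
  have "(\<alpha> \<bullet> x)\<^sup>2 + e \<noteq> 0" for \<alpha> x :: "real ^ 'n" using e by (smt (verit) zero_le_power2)
  then show "continuous_on UNIV (\<lambda>x. weight_reg e x *\<^sub>R (\<Sum>\<alpha>\<in>Rp. (2 * k \<alpha> * ((\<alpha> \<bullet> x) / ((\<alpha> \<bullet> x)\<^sup>2 + e))) *\<^sub>R \<alpha>))"
    by (intro continuous_intros continuous_weight_reg e) auto
qed

lemma partial_deriv_weight_reg:
  assumes "0 < e"
  shows "partial_deriv i (weight_reg e) x
    = weight_reg e x * (\<Sum>\<alpha>\<in>Rp. 2 * k \<alpha> * ((\<alpha> \<bullet> x) / ((\<alpha> \<bullet> x)\<^sup>2 + e)) * \<alpha> $ i)"
  using grad_unique[OF has_derivative_weight_reg[OF assms], of x] by (simp flip: grad_nth)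

lemma weight_le_weight_reg_1: "w x \<le> weight_reg 1 x"
  by (simp add: weight_eq_weight_reg weight_reg_mono)

lemma integrable_compactly_supported:
  assumes "continuous_on UNIV h" "compactly_supported h"
  shows "integrable \<mu> h"
proof -
  have hm: "h \<in> borel_measurable borel" using assms(1) by (rule borel_measurable_continuous_onI)
  have "integrable lborel (\<lambda>x. weight_reg 1 x * h x)"
    using assms by (intro integrable_lborel_compactly_supported continuous_intros continuous_weight_reg
        compactly_supported_mult_right) auto
  then have "integrable lborel (\<lambda>x. w x * h x)"
    by (rule Bochner_Integration.integrable_bound)
      (use hm weight_nonneg weight_reg_nonneg weight_le_weight_reg_1 in
        \<open>auto simp: abs_mult intro!: mult_right_mono\<close>)
  then show ?thesis using integrable_dunkl_measure[OF hm] by simp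
qed

lemma integral_reflection_lborel:
  fixes h :: "real ^ 'n \<Rightarrow> real"
  assumes "\<beta> \<in> R" "h \<in> borel_measurable borel"
  shows "(\<integral>x. h (reflection \<beta> x) \<partial>lborel) = (\<integral>x. h x \<partial>lborel)"
proof -
  have "reflection \<beta> \<in> borel_measurable borel"
    by (intro borel_measurable_continuous_onI continuous_intros)
  then have "(\<integral>x. h x \<partial>distr lborel borel (reflection \<beta>)) = (\<integral>x. h (reflection \<beta> x) \<partial>lborel)"
    using assms(2) by (intro integral_distr) auto
  then show ?thesis
    by (simp add: lborel_distr_orthogonal_transformation[OF orthogonal_transformation_reflection[OF root_inner[OF assms(1)]]])
qed

lemma integral_reflection:
  fixes h :: "real ^ 'n \<Rightarrow> real"
  assumes "\<beta> \<in> R" "h \<in> borel_measurable borel"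
  shows "(\<integral>x. h (reflection \<beta> x) \<partial>\<mu>) = (\<integral>x. h x \<partial>\<mu>)"
proof -
  have "reflection \<beta> \<in> borel_measurable borel"
    by (intro borel_measurable_continuous_onI continuous_intros)
  then have "(\<lambda>x. h (reflection \<beta> x)) \<in> borel_measurable borel"
    using assms(2) by simp
  then show ?thesis
    using integral_reflection_lborel[OF assms(1), of "\<lambda>x. w x * h x"] assms
    by (simp add: integral_dunkl_measure weight_reflection)
qed

text \<open>The factor \<open>s / (s\<^sup>2 + e)\<close> with \<open>s = \<langle>\<alpha>, x\<rangle>\<close> is odd under \<open>\<sigma>\<^sub>\<alpha>\<close>, so \<open>h\<close> may be replaced by half of
  \<open>h - h \<circ> \<sigma>\<^sub>\<alpha>\<close>, which is \<open>s\<close> times the difference quotient. The gain of one factor \<open>s\<close> leaves an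
  integrand that is bounded uniformly in \<open>e\<close>.\<close>

lemma integral_singular_weight_reg:
  assumes e: "0 < e" and \<alpha>: "\<alpha> \<in> R" and h: "C_k (Suc 0) h" "compactly_supported h"
  shows "(\<integral>x. weight_reg e x * (2 * ((\<alpha> \<bullet> x) / ((\<alpha> \<bullet> x)\<^sup>2 + e))) * h x \<partial>lborel)
    = (\<integral>x. weight_reg e x * ((\<alpha> \<bullet> x)\<^sup>2 / ((\<alpha> \<bullet> x)\<^sup>2 + e)) * q \<alpha> h x \<partial>lborel)"
proof -
  let ?s = "\<lambda>x. (\<alpha> \<bullet> x) / ((\<alpha> \<bullet> x)\<^sup>2 + e)"
  let ?f = "\<lambda>x. weight_reg e x * ?s x * h x"
  let ?\<sigma> = "reflection \<alpha>"
  have ch: "continuous_on UNIV h" using h(1) by (rule C_k_continuous)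
  have ne: "(\<alpha> \<bullet> x)\<^sup>2 + e \<noteq> 0" for x using e by (smt (verit) zero_le_power2)
  have cf: "continuous_on UNIV ?f"
    using ne ch by (intro continuous_intros continuous_weight_reg e) auto
  have f_int: "integrable lborel ?f"
    by (intro integrable_lborel_compactly_supported cf compactly_supported_mult_right h)
  have csf: "compactly_supported (\<lambda>x. ?f (?\<sigma> x))"
  proof -
    obtain r where "\<And>x. r < norm x \<Longrightarrow> h x = 0" using h(2) by (rule compactly_supportedE) blast
    then show ?thesis
      using norm_reflection[OF root_inner[OF \<alpha>]] unfolding compactly_supported_def
      by (intro exI[of _ r]) auto
  qed
  have fs_int: "integrable lborel (\<lambda>x. ?f (?\<sigma> x))"
    by (intro integrable_lborel_compactly_supported csf continuous_on_compose2[OF cf] continuous_intros) auto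
  have "(\<integral>x. weight_reg e x * (2 * ?s x) * h x \<partial>lborel) = (\<integral>x. ?f x \<partial>lborel) + (\<integral>x. ?f x \<partial>lborel)"
    using f_int by (subst Bochner_Integration.integral_add[symmetric]) (auto simp: algebra_simps)
  also have "\<dots> = (\<integral>x. ?f x \<partial>lborel) + (\<integral>x. ?f (?\<sigma> x) \<partial>lborel)"
    using integral_reflection_lborel[OF \<alpha>, of ?f] cf by (simp add: borel_measurable_continuous_onI)
  also have "\<dots> = (\<integral>x. ?f x + ?f (?\<sigma> x) \<partial>lborel)"
    using f_int fs_int by simp
  also have "\<dots> = (\<integral>x. weight_reg e x * ((\<alpha> \<bullet> x)\<^sup>2 / ((\<alpha> \<bullet> x)\<^sup>2 + e)) * q \<alpha> h x \<partial>lborel)"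
  proof (rule Bochner_Integration.integral_cong[OF refl])
    fix x
    have "?f x + ?f (?\<sigma> x) = weight_reg e x * ?s x * (h x - h (?\<sigma> x))"
      using weight_reg_reflection[OF \<alpha>, of e x] e inner_reflection_self[OF root_inner[OF \<alpha>]]
      by (simp add: algebra_simps diff_divide_distrib)
    also have "\<dots> = weight_reg e x * ?s x * ((\<alpha> \<bullet> x) * q \<alpha> h x)"
      by (simp add: dunkl_quotient_mult)
    finally show "?f x + ?f (?\<sigma> x) = weight_reg e x * ((\<alpha> \<bullet> x)\<^sup>2 / ((\<alpha> \<bullet> x)\<^sup>2 + e)) * q \<alpha> h x"
      by (simp add: power2_eq_square)
  qed
  finally show ?thesis .
qed

text \<open>Ordinary integration by parts against the smooth weight: its logarithmic derivative turns into the
  difference part of the Dunkl operator.\<close>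

lemma integral_dunkl_op_weight_reg:
  assumes e: "0 < e" and h: "C_k (Suc 0) h" "compactly_supported h"
  shows "(\<integral>x. weight_reg e x * (partial_deriv i h x
     + (\<Sum>\<alpha>\<in>Rp. k \<alpha> * \<alpha> $ i * (((\<alpha> \<bullet> x)\<^sup>2 / ((\<alpha> \<bullet> x)\<^sup>2 + e)) * q \<alpha> h x))) \<partial>lborel) = 0"
    (is "(\<integral>x. ?W x * (?dh x + (\<Sum>\<alpha>\<in>Rp. ?c \<alpha> * (?t \<alpha> x * q \<alpha> h x))) \<partial>lborel) = 0")
proof -
  let ?s = "\<lambda>\<alpha> x. (\<alpha> \<bullet> x) / ((\<alpha> \<bullet> x)\<^sup>2 + e)"
  have ne: "(\<alpha> \<bullet> x)\<^sup>2 + e \<noteq> 0" for \<alpha> x :: "real ^ 'n" using e by (smt (verit) zero_le_power2)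
  have ch: "continuous_on UNIV h" using h(1) by (rule C_k_continuous)
  have cdh: "continuous_on UNIV ?dh" using h(1) by simp
  have sdh: "compactly_supported ?dh" by (rule compactly_supported_partial_deriv[OF h(2)])
  have i1: "integrable lborel (\<lambda>x. ?W x * ?dh x)"
    by (intro integrable_lborel_compactly_supported continuous_intros continuous_weight_reg e cdh
        compactly_supported_mult_right sdh)
  have i2: "integrable lborel (\<lambda>x. ?W x * (2 * ?s \<alpha> x) * h x)" for \<alpha>
    using ne ch by (intro integrable_lborel_compactly_supported continuous_intros continuous_weight_reg e
        compactly_supported_mult_right h) auto
  have i3: "integrable lborel (\<lambda>x. ?W x * ?t \<alpha> x * q \<alpha> h x)" if "\<alpha> \<in> Rp" for \<alpha>
    using ne continuous_dunkl_quotient[OF Rp_inner[OF that] h(1)]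
    by (intro integrable_lborel_compactly_supported continuous_intros continuous_weight_reg e
        compactly_supported_mult_right compactly_supported_dunkl_quotient[OF Rp_inner[OF that] h]) auto
  have "0 = (\<integral>x. partial_deriv i (\<lambda>x. ?W x * h x) x \<partial>lborel)"
    by (rule integral_partial_deriv_eq_0[symmetric])
      (intro C_k_mult C_k_weight_reg e h compactly_supported_mult_right)+
  also have "\<dots> = (\<integral>x. ?W x * ?dh x + (\<Sum>\<alpha>\<in>Rp. ?c \<alpha> * (?W x * (2 * ?s \<alpha> x) * h x)) \<partial>lborel)"
  proof (rule Bochner_Integration.integral_cong[OF refl])
    fix x
    show "partial_deriv i (\<lambda>x. ?W x * h x) x = ?W x * ?dh x + (\<Sum>\<alpha>\<in>Rp. ?c \<alpha> * (?W x * (2 * ?s \<alpha> x) * h x))"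
      using C_k_weight_reg[OF e] h(1)
      by (subst partial_deriv_mult)
        (auto simp: partial_deriv_weight_reg[OF e] sum_distrib_left sum_distrib_right mult_ac intro!: sum.cong)
  qed
  also have "\<dots> = (\<integral>x. ?W x * ?dh x \<partial>lborel) + (\<Sum>\<alpha>\<in>Rp. ?c \<alpha> * (\<integral>x. ?W x * (2 * ?s \<alpha> x) * h x \<partial>lborel))"
    using i1 i2 by (rule integral_add_sum)
  also have "\<dots> = (\<integral>x. ?W x * ?dh x \<partial>lborel) + (\<Sum>\<alpha>\<in>Rp. ?c \<alpha> * (\<integral>x. ?W x * ?t \<alpha> x * q \<alpha> h x \<partial>lborel))"
    using Rp_subset integral_singular_weight_reg[OF e _ h] by (auto intro!: sum.cong)
  also have "\<dots> = (\<integral>x. ?W x * ?dh x + (\<Sum>\<alpha>\<in>Rp. ?c \<alpha> * (?W x * ?t \<alpha> x * q \<alpha> h x)) \<partial>lborel)"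
    using i1 i3 by (rule integral_add_sum[symmetric])
  also have "\<dots> = (\<integral>x. ?W x * (?dh x + (\<Sum>\<alpha>\<in>Rp. ?c \<alpha> * (?t \<alpha> x * q \<alpha> h x))) \<partial>lborel)"
    by (rule Bochner_Integration.integral_cong[OF refl]) (simp add: distrib_left sum_distrib_left mult_ac)
  finally show ?thesis by simp
qed

text \<open>Let \<open>e\<close> tend to \<open>0\<close> in the regularized identity. The factors \<open>s\<^sup>2 / (s\<^sup>2 + e)\<close> tend to \<open>1\<close> off the
  reflection hyperplanes, which form a null set.\<close>

lemma integral_dunkl_op:
  assumes h: "C_k (Suc 0) h" "compactly_supported h"
  shows "(\<integral>x. T i h x \<partial>\<mu>) = 0"
proof -
  let ?t = "\<lambda>n \<alpha> x. (\<alpha> \<bullet> x)\<^sup>2 / ((\<alpha> \<bullet> x)\<^sup>2 + 1 / real (Suc n))"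
  let ?f = "\<lambda>n x. weight_reg (1 / real (Suc n)) x * (partial_deriv i h x
     + (\<Sum>\<alpha>\<in>Rp. k \<alpha> * \<alpha> $ i * (?t n \<alpha> x * q \<alpha> h x)))"
  let ?b = "\<lambda>x. weight_reg 1 x * (\<bar>partial_deriv i h x\<bar> + (\<Sum>\<alpha>\<in>Rp. \<bar>k \<alpha> * \<alpha> $ i\<bar> * \<bar>q \<alpha> h x\<bar>))"
  have cT: "continuous_on UNIV (T i h)" using h(1) by (rule continuous_dunkl_op)
  have pos: "0 < 1 / real (Suc n)" for n by simp
  have ne: "(\<alpha> \<bullet> x)\<^sup>2 + 1 / real (Suc n) \<noteq> 0" for \<alpha> x :: "real ^ 'n" and n
    using pos[of n] by (smt (verit) zero_le_power2)
  have cq: "continuous_on UNIV (q \<alpha> h)" if "\<alpha> \<in> Rp" for \<alpha>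
    using continuous_dunkl_quotient[OF Rp_inner[OF that] h(1)] .
  have cdh: "continuous_on UNIV (partial_deriv i h)" using h(1) by simp
  have csabs: "compactly_supported (\<lambda>x. \<bar>f x\<bar>)" if "compactly_supported f" for f :: "real ^ 'n \<Rightarrow> real"
    using that by (simp add: compactly_supported_def)
  have "(\<lambda>n. \<integral>x. ?f n x \<partial>lborel) \<longlonglongrightarrow> (\<integral>x. w x * T i h x \<partial>lborel)"
  proof (rule integral_dominated_convergence[where w = ?b])
    show "(\<lambda>x. w x * T i h x) \<in> borel_measurable lborel"
      using borel_measurable_continuous_onI[OF cT] by simp
    show "?f n \<in> borel_measurable lborel" for n
      unfolding measurable_lborel2 using ne cq cdh
      by (intro borel_measurable_continuous_onI continuous_intros continuous_weight_reg pos) auto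
    show "integrable lborel ?b"
      using cq cdh h(2)
      by (intro integrable_lborel_compactly_supported continuous_intros continuous_weight_reg
          compactly_supported_mult_right compactly_supported_add compactly_supported_sum csabs
          compactly_supported_partial_deriv compactly_supported_dunkl_quotient Rp_inner h) auto
    have lim0: "(\<lambda>n. 1 / real (Suc n)) \<longlonglongrightarrow> 0"
      using LIMSEQ_inverse_real_of_nat by (simp add: inverse_eq_divide)
    show "AE x in lborel. (\<lambda>n. ?f n x) \<longlonglongrightarrow> w x * T i h x"
      using AE_lborel_regular
    proof eventually_elim
      case (elim x)
      have ne0: "(\<alpha> \<bullet> x)\<^sup>2 \<noteq> 0" if "\<alpha> \<in> Rp" for \<alpha> using elim that Rp_subset by auto
      have "(\<lambda>n. ?f n x) \<longlonglongrightarrow> weight_reg 0 x * (partial_deriv i h x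
         + (\<Sum>\<alpha>\<in>Rp. k \<alpha> * \<alpha> $ i * (((\<alpha> \<bullet> x)\<^sup>2 / ((\<alpha> \<bullet> x)\<^sup>2 + 0)) * q \<alpha> h x)))"
        unfolding weight_reg_def using ne0 by (intro tendsto_intros lim0) auto
      then show ?case
        using ne0 by (simp add: weight_eq_weight_reg dunkl_op_def)
    qed
    show "AE x in lborel. norm (?f n x) \<le> ?b x" for n
    proof (rule AE_I2)
      fix x :: "real ^ 'n"
      have "\<bar>?t n \<alpha> x\<bar> \<le> 1" for \<alpha> by (simp add: divide_le_eq_1 add_nonneg_pos)
      then have "\<bar>k \<alpha> * \<alpha> $ i * (?t n \<alpha> x * q \<alpha> h x)\<bar> \<le> \<bar>k \<alpha> * \<alpha> $ i\<bar> * (1 * \<bar>q \<alpha> h x\<bar>)" for \<alpha>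
        unfolding abs_mult[of "k \<alpha> * \<alpha> $ i"] abs_mult[of _ "q \<alpha> h x"]
        by (intro mult_left_mono mult_right_mono) auto
      then have "\<bar>\<Sum>\<alpha>\<in>Rp. k \<alpha> * \<alpha> $ i * (?t n \<alpha> x * q \<alpha> h x)\<bar> \<le> (\<Sum>\<alpha>\<in>Rp. \<bar>k \<alpha> * \<alpha> $ i\<bar> * \<bar>q \<alpha> h x\<bar>)"
        by (intro order_trans[OF sum_abs] sum_mono) simp
      moreover have "weight_reg (1 / real (Suc n)) x \<le> weight_reg 1 x" by (intro weight_reg_mono) auto
      ultimately show "norm (?f n x) \<le> ?b x"
        unfolding real_norm_def abs_mult using weight_reg_nonneg
        by (intro mult_mono) (auto intro!: order_trans[OF abs_triangle_ineq])
    qed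
  qed
  then have "(\<lambda>n. 0 :: real) \<longlonglongrightarrow> (\<integral>x. w x * T i h x \<partial>lborel)"
    by (simp only: integral_dunkl_op_weight_reg[OF pos h])
  then have "(\<integral>x. w x * T i h x \<partial>lborel) = 0" using LIMSEQ_unique tendsto_const by blast
  then show ?thesis using integral_dunkl_measure[OF borel_measurable_continuous_onI[OF cT]] by simp
qed

end

section \<open>Product rule for difference quotients\<close>

lemma dunkl_quotient_even:
  "\<alpha> \<bullet> \<alpha> = 2 \<Longrightarrow> dunkl_quotient \<alpha> u (reflection \<alpha> x) = dunkl_quotient \<alpha> u x"
  by (cases "\<alpha> \<bullet> x = 0")
    (simp add: reflection_fixed,
     simp add: dunkl_quotient_off inner_reflection_self reflection_involution field_simps)

lemma dunkl_quotient_product: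
  assumes "u differentiable (at x)" "v differentiable (at x)"
  shows "dunkl_quotient \<alpha> (\<lambda>x. u x * v x) x
    = u x * dunkl_quotient \<alpha> v x + v x * dunkl_quotient \<alpha> u x
      - (\<alpha> \<bullet> x) * dunkl_quotient \<alpha> u x * dunkl_quotient \<alpha> v x"
proof (cases "\<alpha> \<bullet> x = 0")
  case True
  have "(\<lambda>x. u x * v x) differentiable (at x)" using assms by (rule differentiable_mult)
  then show ?thesis
    using True assms by (simp add: dunkl_quotient_def frechet_derivative_eq_grad grad_mult
      inner_add_left add_divide_distrib algebra_simps)
next
  case False
  then show ?thesis by (simp add: dunkl_quotient_off field_simps)
qed

lemma dunkl_quotient_nth:
  assumes "\<alpha> \<bullet> \<alpha> = 2" shows "dunkl_quotient \<alpha> (\<lambda>x. x $ i) (x :: real ^ 'n) = \<alpha> $ i"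
proof (cases "\<alpha> \<bullet> x = 0")
  case True
  have "((\<lambda>x :: real ^ 'n. x $ i) has_derivative (\<lambda>v. v $ i)) (at x)"
    by (rule bounded_linear_imp_has_derivative[OF bounded_linear_vec_nth])
  from fun_cong[OF frechet_derivative_at[OF this], of \<alpha>] show ?thesis
    using True assms by (simp add: dunkl_quotient_def)
next
  case False
  then show ?thesis using assms by (simp add: dunkl_quotient_off reflection_alt)
qed

section \<open>The Euler field\<close>

definition euler :: "(real ^ 'n \<Rightarrow> real) \<Rightarrow> real ^ 'n \<Rightarrow> real" where
  "euler u x = grad u x \<bullet> x"

lemma C_k_euler: "C_k (Suc m) u \<Longrightarrow> C_k m (euler u)"
  unfolding euler_def[abs_def] inner_vec_real grad_nth
  by (intro C_k_sum C_k_mult C_k_nth C_k_partial_deriv)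

lemma compactly_supported_euler: "compactly_supported u \<Longrightarrow> compactly_supported (euler u)"
  unfolding euler_def[abs_def] inner_vec_real grad_nth
  by (intro compactly_supported_sum compactly_supported_mult_left compactly_supported_partial_deriv)

lemma euler_unique: "(u has_derivative D) (at x) \<Longrightarrow> euler u x = D x"
  unfolding euler_def
  by (metis differentiableI frechet_derivative_at frechet_derivative_eq_grad)

lemma euler_mult:
  "\<lbrakk>u differentiable (at x); v differentiable (at x)\<rbrakk>
   \<Longrightarrow> euler (\<lambda>x. u x * v x) x = u x * euler v x + v x * euler u x"
  by (simp add: euler_def grad_mult inner_add_left)

lemma euler_add:
  "\<lbrakk>u differentiable (at x); v differentiable (at x)\<rbrakk>
   \<Longrightarrow> euler (\<lambda>x. u x + v x) x = euler u x + euler v x"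
  by (subst euler_unique[OF has_derivative_add[OF has_derivative_grad has_derivative_grad]])
    (auto simp: euler_def)

lemma euler_sum_const:
  assumes "\<And>a. a \<in> A \<Longrightarrow> u a differentiable (at x)"
  shows "euler (\<lambda>x. \<Sum>a\<in>A. c a * u a x) x = (\<Sum>a\<in>A. c a * euler (u a) x)"
  by (subst euler_unique[OF has_derivative_sum[OF has_derivative_mult_right[OF has_derivative_grad]]])
    (use assms in \<open>auto simp: euler_def\<close>)

lemma partial_deriv_euler:
  assumes u: "C_k (Suc (Suc 0)) u"
  shows "partial_deriv i (euler u) (x :: real ^ 'n) = partial_deriv i u x + euler (partial_deriv i u) x"
proof -
  have d: "partial_deriv j u differentiable (at x)" for j using u by simp
  have dn: "(\<lambda>x :: real ^ 'n. x $ j) differentiable (at x)" for j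
    using C_k_nth[of "Suc 0" j] by simp
  have "(euler u has_derivative (\<lambda>v. \<Sum>j\<in>UNIV. partial_deriv j u x * v $ j
       + (grad (partial_deriv j u) x \<bullet> v) * x $ j)) (at x)"
    unfolding euler_def[abs_def] inner_vec_real[of "grad u _"] grad_nth
    by (intro has_derivative_sum has_derivative_mult has_derivative_grad d
      bounded_linear_imp_has_derivative[OF bounded_linear_vec_nth])
  from partial_deriv_unique[OF this, of i]
  have "partial_deriv i (euler u) x = (\<Sum>j\<in>UNIV. partial_deriv j u x * axis i 1 $ j
       + partial_deriv i (partial_deriv j u) x * x $ j)"
    by (simp add: grad_inner_axis)
  also have "\<dots> = grad u x \<bullet> axis i 1 + (\<Sum>j\<in>UNIV. partial_deriv j (partial_deriv i u) x * x $ j)"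
    by (simp add: sum.distrib inner_vec_real grad_nth partial_deriv_commute[OF u, of i])
  finally show ?thesis by (simp add: grad_inner_axis euler_def inner_vec_real[of _ x] grad_nth)
qed

lemma has_derivative_compose_reflection:
  assumes "C_k (Suc m) u"
  shows "((\<lambda>x. u (reflection \<alpha> x)) has_derivative (\<lambda>v. grad u (reflection \<alpha> x) \<bullet> reflection \<alpha> v)) (at x)"
proof -
  have "(reflection \<alpha> has_derivative reflection \<alpha>) (at x)"
    using linear_reflection linear_conv_bounded_linear bounded_linear_imp_has_derivative by blast
  from has_derivative_compose[OF this C_k_has_derivative[OF assms]] show ?thesis .
qed

text \<open>Obtained by differentiating \<open>\<langle>\<alpha>, x\<rangle> q = u - u \<circ> \<sigma>\<^sub>\<alpha>\<close>, where \<open>q\<close> is the difference quotient, in direction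
  \<open>v\<close>. The directions \<open>v = x\<close> and \<open>v = \<alpha>\<close> are the ones of interest.\<close>

lemma has_derivative_inner_times_dunkl_quotient:
  assumes \<alpha>: "\<alpha> \<bullet> \<alpha> = 2" and u: "C_k (Suc (Suc 0)) u"
  shows "(\<alpha> \<bullet> x) * (grad (dunkl_quotient \<alpha> u) x \<bullet> v) + (\<alpha> \<bullet> v) * dunkl_quotient \<alpha> u x
    = grad u x \<bullet> v - grad u (reflection \<alpha> x) \<bullet> reflection \<alpha> v"
proof -
  have q: "C_k (Suc 0) (dunkl_quotient \<alpha> u)" by (rule C_k_dunkl_quotient[OF \<alpha> u])
  have "((\<lambda>x. \<alpha> \<bullet> x) has_derivative (\<lambda>v. \<alpha> \<bullet> v)) (at x)"
    by (auto intro!: derivative_eq_intros)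
  from has_derivative_mult[OF this C_k_has_derivative[OF q]]
  have 1: "((\<lambda>x. (\<alpha> \<bullet> x) * dunkl_quotient \<alpha> u x) has_derivative
      (\<lambda>v. (\<alpha> \<bullet> x) * (grad (dunkl_quotient \<alpha> u) x \<bullet> v) + (\<alpha> \<bullet> v) * dunkl_quotient \<alpha> u x)) (at x)" .
  have 2: "((\<lambda>x. (\<alpha> \<bullet> x) * dunkl_quotient \<alpha> u x) has_derivative
      (\<lambda>v. grad u x \<bullet> v - grad u (reflection \<alpha> x) \<bullet> reflection \<alpha> v)) (at x)"
    unfolding dunkl_quotient_mult
    by (intro has_derivative_diff C_k_has_derivative[OF u] has_derivative_compose_reflection[OF u])
  show ?thesis using fun_cong[OF has_derivative_unique[OF 1 2], of v] .
qed

text \<open>The difference quotient is homogeneous of degree \<open>-1\<close> in the sense of operators.\<close>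

lemma euler_dunkl_quotient:
  assumes \<alpha>: "\<alpha> \<bullet> \<alpha> = 2" and u: "C_k (Suc (Suc 0)) u" and x: "\<alpha> \<bullet> x \<noteq> 0"
  shows "euler (dunkl_quotient \<alpha> u) x + dunkl_quotient \<alpha> u x = dunkl_quotient \<alpha> (euler u) x"
proof -
  have "(\<alpha> \<bullet> x) * (euler (dunkl_quotient \<alpha> u) x + dunkl_quotient \<alpha> u x)
      = (\<alpha> \<bullet> x) * dunkl_quotient \<alpha> (euler u) x"
    using has_derivative_inner_times_dunkl_quotient[OF \<alpha> u, of x x]
    by (simp add: euler_def distrib_left dunkl_quotient_mult)
  then show ?thesis using x by simp
qed

context dunkl
begin

abbreviation N where "N \<equiv> homogeneous_dim Rp k"

section \<open>Integration by parts\<close>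

lemma dunkl_op_product:
  assumes "C_k (Suc 0) f" "C_k (Suc 0) g"
  shows "T i (\<lambda>x. f x * g x) x = f x * T i g x + g x * T i f x
     - (\<Sum>\<alpha>\<in>Rp. k \<alpha> * \<alpha> $ i * ((\<alpha> \<bullet> x) * q \<alpha> f x * q \<alpha> g x))"
  using assms
  by (simp add: dunkl_op_def partial_deriv_mult dunkl_quotient_product algebra_simps
      sum.distrib sum_subtractf sum_distrib_left)

lemma integral_odd_eq_0:
  fixes h :: "real ^ 'n \<Rightarrow> real"
  assumes "\<alpha> \<in> R" "h \<in> borel_measurable borel" "\<And>x. h (reflection \<alpha> x) = - h x"
  shows "(\<integral>x. h x \<partial>\<mu>) = 0"
  using integral_reflection[OF assms(1,2)] by (simp add: assms(3))

text \<open>Integrate \<open>T\<^sub>i (f g)\<close>. The terms by which it differs from \<open>f T\<^sub>i g + g T\<^sub>i f\<close> are odd under the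
  respective reflections, because the difference quotients are even.\<close>

lemma dunkl_op_antisymmetric:
  assumes f: "C_k (Suc 0) f" "compactly_supported f" and g: "C_k (Suc 0) g"
  shows "(\<integral>x. T i f x * g x \<partial>\<mu>) = - (\<integral>x. f x * T i g x \<partial>\<mu>)"
proof -
  have cf: "continuous_on UNIV f" and cg: "continuous_on UNIV g"
    using f g C_k_continuous by blast+
  have cq: "continuous_on UNIV (q \<alpha> f)" "continuous_on UNIV (q \<alpha> g)" if "\<alpha> \<in> Rp" for \<alpha>
    using continuous_dunkl_quotient[OF Rp_inner[OF that]] f g by auto
  have i1: "integrable \<mu> (\<lambda>x. T i f x * g x)"
    by (intro integrable_compactly_supported continuous_intros continuous_dunkl_op f cg
        compactly_supported_mult_left compactly_supported_dunkl_op)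
  have i2: "integrable \<mu> (\<lambda>x. f x * T i g x)"
    by (intro integrable_compactly_supported continuous_intros continuous_dunkl_op f g cf
        compactly_supported_mult_left)
  have i3: "integrable \<mu> (\<lambda>x. (\<alpha> \<bullet> x) * q \<alpha> f x * q \<alpha> g x)" if "\<alpha> \<in> Rp" for \<alpha>
    by (intro integrable_compactly_supported continuous_intros cq that f compactly_supported_mult_left
        compactly_supported_mult_right compactly_supported_dunkl_quotient Rp_inner)
  have z: "(\<integral>x. (\<alpha> \<bullet> x) * q \<alpha> f x * q \<alpha> g x \<partial>\<mu>) = 0" if "\<alpha> \<in> Rp" for \<alpha>
  proof (rule integral_odd_eq_0)
    show "\<alpha> \<in> R" using that Rp_subset by auto
    show "(\<lambda>x. (\<alpha> \<bullet> x) * q \<alpha> f x * q \<alpha> g x) \<in> borel_measurable borel"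
      by (intro borel_measurable_continuous_onI continuous_intros cq that)
    show "(\<alpha> \<bullet> reflection \<alpha> x) * q \<alpha> f (reflection \<alpha> x) * q \<alpha> g (reflection \<alpha> x)
      = - ((\<alpha> \<bullet> x) * q \<alpha> f x * q \<alpha> g x)" for x
      by (simp add: dunkl_quotient_even inner_reflection_self Rp_inner[OF that])
  qed
  have "0 = (\<integral>x. T i (\<lambda>x. f x * g x) x \<partial>\<mu>)"
    by (intro integral_dunkl_op[symmetric] C_k_mult f g compactly_supported_mult_left)
  also have "\<dots> = (\<integral>x. (f x * T i g x + T i f x * g x)
      + (\<Sum>\<alpha>\<in>Rp. - (k \<alpha> * \<alpha> $ i) * ((\<alpha> \<bullet> x) * q \<alpha> f x * q \<alpha> g x)) \<partial>\<mu>)"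
    by (rule Bochner_Integration.integral_cong[OF refl])
      (simp add: dunkl_op_product[OF f(1) g] sum_negf)
  also have "\<dots> = (\<integral>x. f x * T i g x \<partial>\<mu>) + (\<integral>x. T i f x * g x \<partial>\<mu>)"
    using i1 i2 i3 z by (subst integral_add_sum) auto
  finally show ?thesis by simp
qed

text \<open>The divergence of the field \<open>h x\<close> with respect to the Dunkl operators: the multiplication by
  coordinates produces the dimension \<open>CARD('n)\<close> from the derivatives and \<open>2 \<Sum> k \<alpha>\<close> from the differences.\<close>

lemma sum_dunkl_op_nth_mult:
  assumes h: "C_k (Suc 0) h"
  shows "(\<Sum>i\<in>UNIV. T i (\<lambda>x. x $ i * h x) x)
     = (euler h x + N * h x) + (\<Sum>\<alpha>\<in>Rp. - k \<alpha> * (h x - h (reflection \<alpha> x)))"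
proof -
  have "T i (\<lambda>x. x $ i * h x) x = partial_deriv i h x * x $ i + h x
     + (\<Sum>\<alpha>\<in>Rp. k \<alpha> * ((\<alpha> $ i * x $ i) * q \<alpha> h x + (\<alpha> $ i * \<alpha> $ i) * (h x - (\<alpha> \<bullet> x) * q \<alpha> h x)))" for i
    unfolding dunkl_op_product[OF C_k_nth h]
    by (simp add: dunkl_op_def partial_deriv_nth dunkl_quotient_nth Rp_inner algebra_simps
      sum.distrib sum_subtractf sum_distrib_left)
  then have "(\<Sum>i\<in>UNIV. T i (\<lambda>x. x $ i * h x) x) = euler h x + real CARD('n) * h x
     + (\<Sum>i\<in>UNIV. \<Sum>\<alpha>\<in>Rp. k \<alpha> * ((\<alpha> $ i * x $ i) * q \<alpha> h x + (\<alpha> $ i * \<alpha> $ i) * (h x - (\<alpha> \<bullet> x) * q \<alpha> h x)))"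
    by (simp add: sum.distrib euler_def inner_vec_real[of _ x] grad_nth)
  also have "(\<Sum>i\<in>UNIV. \<Sum>\<alpha>\<in>Rp. k \<alpha> * ((\<alpha> $ i * x $ i) * q \<alpha> h x + (\<alpha> $ i * \<alpha> $ i) * (h x - (\<alpha> \<bullet> x) * q \<alpha> h x)))
     = (\<Sum>\<alpha>\<in>Rp. k \<alpha> * ((\<Sum>i\<in>UNIV. \<alpha> $ i * x $ i) * q \<alpha> h x + (\<Sum>i\<in>UNIV. \<alpha> $ i * \<alpha> $ i) * (h x - (\<alpha> \<bullet> x) * q \<alpha> h x)))"
    by (subst sum.swap) (simp only: sum_distrib_left[symmetric] sum.distrib sum_distrib_right[symmetric])
  also have "\<dots> = (\<Sum>\<alpha>\<in>Rp. 2 * k \<alpha> * h x - k \<alpha> * ((\<alpha> \<bullet> x) * q \<alpha> h x))"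
    by (intro sum.cong refl) (simp add: inner_vec_real[symmetric] Rp_inner algebra_simps)
  also have "\<dots> = 2 * (\<Sum>\<alpha>\<in>Rp. k \<alpha>) * h x + (\<Sum>\<alpha>\<in>Rp. - k \<alpha> * (h x - h (reflection \<alpha> x)))"
    unfolding dunkl_quotient_mult by (simp add: sum_subtractf sum_negf sum_distrib_left sum_distrib_right)
  finally show ?thesis by (simp add: homogeneous_dim_def algebra_simps)
qed

text \<open>This is the homogeneity of \<open>\<mu>\<close> of degree \<open>N\<close> under dilations in infinitesimal form. The differences
  \<open>h - h \<circ> \<sigma>\<^sub>\<alpha>\<close> in the divergence integrate to \<open>0\<close>.\<close>

lemma integral_euler:
  assumes h: "C_k (Suc 0) h" "compactly_supported h"
  shows "(\<integral>x. euler h x \<partial>\<mu>) = - N * (\<integral>x. h x \<partial>\<mu>)"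
proof -
  have ch: "continuous_on UNIV h" using h(1) by (rule C_k_continuous)
  have ih: "integrable \<mu> h" by (rule integrable_compactly_supported[OF ch h(2)])
  have ie: "integrable \<mu> (euler h)"
    using C_k_euler[OF h(1)] compactly_supported_euler[OF h(2)]
    by (intro integrable_compactly_supported) auto
  have id: "integrable \<mu> (\<lambda>x. h x - h (reflection \<alpha> x))"
    and zd: "(\<integral>x. h x - h (reflection \<alpha> x) \<partial>\<mu>) = 0" if "\<alpha> \<in> Rp" for \<alpha>
  proof -
    have e: "(\<lambda>x. h x - h (reflection \<alpha> x)) = (\<lambda>x. (\<alpha> \<bullet> x) * q \<alpha> h x)"
      by (simp add: dunkl_quotient_mult)
    have c: "continuous_on UNIV (\<lambda>x. (\<alpha> \<bullet> x) * q \<alpha> h x)"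
      by (intro continuous_intros continuous_dunkl_quotient Rp_inner that h)
    then show "integrable \<mu> (\<lambda>x. h x - h (reflection \<alpha> x))"
      unfolding e by (rule integrable_compactly_supported)
        (intro compactly_supported_mult_right compactly_supported_dunkl_quotient Rp_inner that h)
    show "(\<integral>x. h x - h (reflection \<alpha> x) \<partial>\<mu>) = 0"
    proof (rule integral_odd_eq_0)
      show "(\<lambda>x. h x - h (reflection \<alpha> x)) \<in> borel_measurable borel"
        unfolding e by (rule borel_measurable_continuous_onI[OF c])
    qed (use that Rp_subset Rp_inner[OF that] in \<open>auto simp: reflection_involution\<close>)
  qed
  have C: "C_k (Suc 0) (\<lambda>x. x $ i * h x)" and s: "compactly_supported (\<lambda>x. x $ i * h x)" for i
    by (intro C_k_mult C_k_nth compactly_supported_mult_right h)+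
  have "0 = (\<Sum>i\<in>UNIV. \<integral>x. T i (\<lambda>x. x $ i * h x) x \<partial>\<mu>)"
    using integral_dunkl_op[OF C s] by simp
  also have "\<dots> = (\<integral>x. (\<Sum>i\<in>UNIV. T i (\<lambda>x. x $ i * h x) x) \<partial>\<mu>)"
    by (intro Bochner_Integration.integral_sum[symmetric] integrable_compactly_supported
      continuous_dunkl_op compactly_supported_dunkl_op C s)
  also have "\<dots> = (\<integral>x. euler h x + N * h x \<partial>\<mu>)"
    unfolding sum_dunkl_op_nth_mult[OF h(1)]
    using ie ih id zd by (subst integral_add_sum) auto
  also have "\<dots> = (\<integral>x. euler h x \<partial>\<mu>) + N * (\<integral>x. h x \<partial>\<mu>)"
    using ie ih by simp
  finally show ?thesis by simp
qed

text \<open>The Dunkl operators are homogeneous of degree \<open>-1\<close>.\<close>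

lemma dunkl_op_euler:
  assumes u: "C_k (Suc (Suc 0)) u" and x: "\<forall>\<alpha>\<in>R. \<alpha> \<bullet> x \<noteq> 0"
  shows "T i (euler u) x = euler (T i u) x + T i u x"
proof -
  have dq: "q \<alpha> u differentiable (at x)" if "\<alpha> \<in> Rp" for \<alpha>
    using C_k_dunkl_quotient[OF Rp_inner[OF that] u] by simp
  have dp: "partial_deriv i u differentiable (at x)" using u by simp
  have ds: "(\<lambda>x. \<Sum>\<alpha>\<in>Rp. k \<alpha> * \<alpha> $ i * q \<alpha> u x) differentiable (at x)"
    using finite_Rp dq by (intro differentiable_sum differentiable_mult) auto
  have "euler (T i u) x = euler (partial_deriv i u) x + (\<Sum>\<alpha>\<in>Rp. k \<alpha> * \<alpha> $ i * euler (q \<alpha> u) x)"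
    unfolding dunkl_op_def using dp ds dq by (simp add: euler_add euler_sum_const)
  moreover have "(\<Sum>\<alpha>\<in>Rp. k \<alpha> * \<alpha> $ i * q \<alpha> (euler u) x)
      = (\<Sum>\<alpha>\<in>Rp. k \<alpha> * \<alpha> $ i * (euler (q \<alpha> u) x + q \<alpha> u x))"
    using x Rp_subset by (intro sum.cong refl) (auto simp: euler_dunkl_quotient[OF Rp_inner u])
  ultimately show ?thesis
    by (simp add: dunkl_op_def partial_deriv_euler[OF u] distrib_left sum.distrib)
qed

abbreviation L where "L u \<equiv> dunkl_laplacian Rp k u"

lemma continuous_dunkl_laplacian:
  "C_k (Suc (Suc 0)) u \<Longrightarrow> continuous_on UNIV (L u)"
  unfolding dunkl_laplacian_def[abs_def]
  by (intro continuous_intros continuous_dunkl_op C_k_dunkl_op)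

lemma compactly_supported_dunkl_laplacian:
  "C_k (Suc (Suc 0)) u \<Longrightarrow> compactly_supported u \<Longrightarrow> compactly_supported (L u)"
  unfolding dunkl_laplacian_def[abs_def]
  by (intro compactly_supported_sum compactly_supported_dunkl_op C_k_dunkl_op C_k_mono_Suc[of "Suc 0"]) auto

lemma norm_dunkl_gradient_sq: "(norm (dunkl_gradient Rp k u x))\<^sup>2 = (\<Sum>i\<in>UNIV. (T i u x)\<^sup>2)"
  unfolding power2_norm_eq_inner by (simp add: inner_vec_real dunkl_gradient_def power2_eq_square)

lemma integral_dunkl_gradient:
  assumes u: "C_k (Suc 0) u" "compactly_supported u"
  shows "(\<integral>x. (norm (dunkl_gradient Rp k u x))\<^sup>2 \<partial>\<mu>) = (\<Sum>i\<in>UNIV. \<integral>x. (T i u x)\<^sup>2 \<partial>\<mu>)"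
  unfolding norm_dunkl_gradient_sq unfolding power2_eq_square
  by (intro Bochner_Integration.integral_sum integrable_compactly_supported continuous_intros
    continuous_dunkl_op compactly_supported_mult_left compactly_supported_dunkl_op u)

lemma integral_mult_dunkl_laplacian:
  assumes u: "C_k (Suc (Suc 0)) u" "compactly_supported u" and f: "C_k (Suc 0) f" "compactly_supported f"
  shows "(\<integral>x. f x * L u x \<partial>\<mu>) = - (\<Sum>i\<in>UNIV. \<integral>x. T i f x * T i u x \<partial>\<mu>)"
proof -
  have "(\<integral>x. f x * L u x \<partial>\<mu>) = (\<Sum>i\<in>UNIV. \<integral>x. f x * T i (T i u) x \<partial>\<mu>)"
    unfolding dunkl_laplacian_def sum_distrib_left
    by (intro Bochner_Integration.integral_sum integrable_compactly_supported continuous_intros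
      continuous_dunkl_op C_k_dunkl_op u C_k_continuous[OF f(1)] compactly_supported_mult_left f)
  also have "\<dots> = (\<Sum>i\<in>UNIV. - (\<integral>x. T i f x * T i u x \<partial>\<mu>))"
    using dunkl_op_antisymmetric[OF f C_k_dunkl_op[OF u(1)]] by (intro sum.cong refl) simp
  finally show ?thesis by (simp add: sum_negf)
qed

text \<open>Moving one \<open>T\<^sub>i\<close> to \<open>E u\<close> and using its commutation with the Euler field \<open>E\<close> gives
  \<open>\<integral> T\<^sub>i (E u) T\<^sub>i u = \<integral> E ((T\<^sub>i u)\<^sup>2) / 2 + \<integral> (T\<^sub>i u)\<^sup>2\<close>, and the first summand is \<open>- N/2\<close> times the second.\<close>

lemma integral_euler_mult_dunkl_laplacian:
  assumes u: "C_k (Suc (Suc 0)) u" "compactly_supported u"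
  shows "(\<integral>x. euler u x * L u x \<partial>\<mu>) = (N - 2) / 2 * (\<integral>x. (norm (dunkl_gradient Rp k u x))\<^sup>2 \<partial>\<mu>)"
proof -
  have u1: "C_k (Suc 0) u" by (rule C_k_mono_Suc[OF u(1)])
  have T1: "C_k (Suc 0) (T i u)" "compactly_supported (T i u)" for i
    using C_k_dunkl_op u compactly_supported_dunkl_op u1 by auto
  have "(\<integral>x. T i (euler u) x * T i u x \<partial>\<mu>) = (1 - N / 2) * (\<integral>x. (T i u x)\<^sup>2 \<partial>\<mu>)" for i
  proof -
    let ?v = "T i u"
    have C2: "C_k (Suc 0) (\<lambda>x. ?v x * ?v x)" "compactly_supported (\<lambda>x. ?v x * ?v x)"
      by (intro C_k_mult compactly_supported_mult_left T1)+
    have ie: "integrable \<mu> (euler (\<lambda>x. ?v x * ?v x))"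
      using C_k_euler[OF C2(1)] compactly_supported_euler[OF C2(2)] by (intro integrable_compactly_supported) auto
    have i2: "integrable \<mu> (\<lambda>x. ?v x * ?v x)"
      by (intro integrable_compactly_supported C_k_continuous[OF C2(1)] C2)
    have m: "T i (euler u) \<in> borel_measurable borel" "?v \<in> borel_measurable borel"
       "euler (\<lambda>x. ?v x * ?v x) \<in> borel_measurable borel"
      using continuous_dunkl_op[OF C_k_euler[OF u(1)], of i] C_k_continuous[OF T1(1)[of i]] C_k_euler[OF C2(1)]
      by (auto intro: borel_measurable_continuous_onI)
    have "(\<integral>x. T i (euler u) x * ?v x \<partial>\<mu>)
        = (\<integral>x. 1 / 2 * euler (\<lambda>x. ?v x * ?v x) x + ?v x * ?v x \<partial>\<mu>)"
    proof (rule integral_cong_AE)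
      show "AE x in \<mu>. T i (euler u) x * ?v x = 1 / 2 * euler (\<lambda>x. ?v x * ?v x) x + ?v x * ?v x"
        using AE_regular
      proof eventually_elim
        case (elim x)
        then show ?case using T1(1)[of i]
          by (simp add: dunkl_op_euler[OF u(1)] euler_mult algebra_simps)
      qed
    qed (use m in measurable)
    also have "\<dots> = 1 / 2 * (\<integral>x. euler (\<lambda>x. ?v x * ?v x) x \<partial>\<mu>) + (\<integral>x. ?v x * ?v x \<partial>\<mu>)"
      using ie i2 by simp
    also have "\<dots> = (1 - N / 2) * (\<integral>x. (?v x)\<^sup>2 \<partial>\<mu>)"
      by (simp add: integral_euler[OF C2] power2_eq_square algebra_simps)
    finally show ?thesis .
  qed
  then have "(\<integral>x. euler u x * L u x \<partial>\<mu>) = - (\<Sum>i\<in>UNIV. (1 - N / 2) * (\<integral>x. (T i u x)\<^sup>2 \<partial>\<mu>))"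
    using integral_mult_dunkl_laplacian[OF u C_k_euler[OF u(1)] compactly_supported_euler[OF u(2)]] by simp
  also have "\<dots> = - ((1 - N / 2) * (\<integral>x. (norm (dunkl_gradient Rp k u x))\<^sup>2 \<partial>\<mu>))"
    by (simp only: integral_dunkl_gradient[OF u1 u(2)] sum_distrib_left)
  finally show ?thesis by (simp add: field_simps)
qed

end

section \<open>The Dunkl Laplacian\<close>

text \<open>For \<open>w = \<sigma>\<^sub>\<alpha> \<sigma>\<^sub>\<beta>\<close> the factor \<open>|x - w x|\<^sup>2\<close> depends on the roots only through the rotation \<open>w\<close>, and the right-hand side is
  the difference of one function of a root, again determined by \<open>w\<close>, at \<open>\<beta>\<close> and at \<open>\<alpha>\<close>. In the plane of
  \<open>\<alpha>\<close> and \<open>\<beta>\<close> it is the formula \<open>sin (a - b) / (cos a cos b) = tan a - tan b\<close>.\<close>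

lemma rotation_identity:
  fixes \<alpha> \<beta> x :: "real ^ 'n"
  assumes \<alpha>: "\<alpha> \<bullet> \<alpha> = 2" and \<beta>: "\<beta> \<bullet> \<beta> = 2" and x: "\<alpha> \<bullet> x \<noteq> 0" "\<beta> \<bullet> x \<noteq> 0"
  defines "w \<equiv> \<lambda>y. reflection \<alpha> (reflection \<beta> y)"
  shows "(\<alpha> \<bullet> \<beta>) / ((\<alpha> \<bullet> x) * (\<beta> \<bullet> x)) * (norm (x - w x))\<^sup>2
    = 2 * ((w \<beta> \<bullet> x) / (\<beta> \<bullet> x) - (w \<alpha> \<bullet> x) / (\<alpha> \<bullet> x))"
proof -
  define a b c where "a = \<alpha> \<bullet> x" and "b = \<beta> \<bullet> x" and "c = \<alpha> \<bullet> \<beta>"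
  have ne: "a \<noteq> 0" "b \<noteq> 0" using x by (auto simp: a_def b_def)
  have "x - w x = b *\<^sub>R \<beta> + (a - b * c) *\<^sub>R \<alpha>"
    by (simp add: w_def reflection_alt \<alpha> \<beta> inner_diff_right a_def b_def c_def)
  then have n: "(norm (x - w x))\<^sup>2 = 2 * (a\<^sup>2 + b\<^sup>2 - a * b * c)"
    unfolding power2_norm_eq_inner
    by (simp add: inner_add_left inner_add_right \<alpha> \<beta> inner_commute[of \<beta> \<alpha>] c_def[symmetric])
      (simp add: algebra_simps power2_eq_square)
  have wb: "w \<beta> \<bullet> x = c * a - b"
    by (simp add: w_def reflection_alt \<alpha> \<beta> inner_diff_right inner_diff_left inner_add_left a_def b_def c_def)
  have wa: "w \<alpha> \<bullet> x = (c\<^sup>2 - 1) * a - c * b"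
    by (simp add: w_def reflection_alt \<alpha> \<beta> inner_diff_right inner_diff_left inner_add_left a_def b_def c_def
        inner_commute[of \<beta> \<alpha>] algebra_simps power2_eq_square)
  show ?thesis
    unfolding a_def[symmetric] b_def[symmetric] c_def[symmetric] n wb wa
    using ne by (simp add: field_simps power2_eq_square)
qed

context dunkl
begin

lemma sum_reindex_reflection:
  fixes f :: "real ^ 'n \<Rightarrow> real"
  shows "\<beta> \<in> R \<Longrightarrow> (\<Sum>\<alpha>\<in>R. f (reflection \<beta> \<alpha>)) = (\<Sum>\<alpha>\<in>R. f \<alpha>)"
  by (rule sum.reindex_bij_betw[OF bij_reflection_R])

lemma regular_reflection:
  "\<forall>\<alpha>\<in>R. \<alpha> \<bullet> x \<noteq> 0 \<Longrightarrow> \<beta> \<in> R \<Longrightarrow> \<forall>\<alpha>\<in>R. \<alpha> \<bullet> reflection \<beta> x \<noteq> 0"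
  using reflection_in_R inner_reflection_left root_inner by metis

text \<open>By the preceding identity every summand is a difference of a quantity attached to the second and to
  the first root of the pair. The map from \<open>(\<alpha>, \<beta>)\<close> to \<open>(\<beta>, \<sigma>\<^sub>\<beta> \<alpha>)\<close> is a permutation of the pairs
  that preserves the rotation \<open>\<sigma>\<^sub>\<alpha> \<sigma>\<^sub>\<beta>\<close> and the product of multiplicities, and it makes the second root
  the first one. So the sum telescopes.\<close>

lemma sum_rotations_eq_0:
  fixes u :: "real ^ 'n \<Rightarrow> real"
  assumes x: "\<forall>\<alpha>\<in>R. \<alpha> \<bullet> x \<noteq> 0"
  shows "(\<Sum>\<alpha>\<in>R. \<Sum>\<beta>\<in>R. k \<alpha> * k \<beta> * (\<alpha> \<bullet> \<beta>) / ((\<alpha> \<bullet> x) * (\<beta> \<bullet> x)) *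
     (u x - u (reflection \<alpha> (reflection \<beta> x)))) = 0"
proof -
  \<comment> \<open>At a fixed point \<open>y = x\<close> of the rotation the quotient is \<open>0 / 0 = 0\<close>, in accordance with \<open>u x - u y = 0\<close>.\<close>
  define H where "H y = 2 * ((u x - u y) / (norm (x - y))\<^sup>2)" for y
  define J where "J \<alpha> \<beta> \<gamma> = k \<alpha> * k \<beta> * H (reflection \<alpha> (reflection \<beta> x)) *
    ((reflection \<alpha> (reflection \<beta> \<gamma>) \<bullet> x) / (\<gamma> \<bullet> x))" for \<alpha> \<beta> \<gamma>
  have summand: "k \<alpha> * k \<beta> * (\<alpha> \<bullet> \<beta>) / ((\<alpha> \<bullet> x) * (\<beta> \<bullet> x)) * (u x - u (reflection \<alpha> (reflection \<beta> x)))
     = J \<alpha> \<beta> \<beta> - J \<alpha> \<beta> \<alpha>" if "\<alpha> \<in> R" "\<beta> \<in> R" for \<alpha> \<beta>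
  proof -
    let ?y = "reflection \<alpha> (reflection \<beta> x)"
    have u: "u x - u ?y = H ?y * (norm (x - ?y))\<^sup>2 / 2"
      by (cases "x = ?y") (auto simp: H_def)
    have "k \<alpha> * k \<beta> * (\<alpha> \<bullet> \<beta>) / ((\<alpha> \<bullet> x) * (\<beta> \<bullet> x)) * (u x - u ?y)
      = k \<alpha> * k \<beta> * H ?y / 2 * ((\<alpha> \<bullet> \<beta>) / ((\<alpha> \<bullet> x) * (\<beta> \<bullet> x)) * (norm (x - ?y))\<^sup>2)"
      unfolding u by (simp add: mult_ac)
    also have "\<dots> = J \<alpha> \<beta> \<beta> - J \<alpha> \<beta> \<alpha>"
      unfolding rotation_identity[OF root_inner[OF that(1)] root_inner[OF that(2)] bspec[OF x that(1)] bspec[OF x that(2)]]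
      by (simp add: J_def algebra_simps)
    finally show ?thesis .
  qed
  have "(\<Sum>\<alpha>\<in>R. \<Sum>\<beta>\<in>R. J \<alpha> \<beta> \<alpha>) = (\<Sum>\<beta>\<in>R. \<Sum>\<alpha>\<in>R. J \<beta> (reflection \<beta> \<alpha>) \<beta>)"
    by (rule sum.cong[OF refl], rule sum_reindex_reflection[symmetric])
  also have "\<dots> = (\<Sum>\<beta>\<in>R. \<Sum>\<alpha>\<in>R. J \<alpha> \<beta> \<beta>)"
  proof (intro sum.cong refl)
    fix \<alpha> \<beta> assume ab: "\<alpha> \<in> R" "\<beta> \<in> R"
    have "reflection \<beta> (reflection (reflection \<beta> \<alpha>) y) = reflection \<alpha> (reflection \<beta> y)" for y
      using ab root_inner by (simp add: reflection_conjugate reflection_involution)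
    then show "J \<beta> (reflection \<beta> \<alpha>) \<beta> = J \<alpha> \<beta> \<beta>"
      using ab by (simp add: J_def multiplicity_reflection)
  qed
  also have "\<dots> = (\<Sum>\<alpha>\<in>R. \<Sum>\<beta>\<in>R. J \<alpha> \<beta> \<beta>)" by (rule sum.swap)
  finally have "(\<Sum>\<alpha>\<in>R. \<Sum>\<beta>\<in>R. J \<alpha> \<beta> \<beta> - J \<alpha> \<beta> \<alpha>) = 0" by (simp add: sum_subtractf)
  then show ?thesis using summand by (simp cong: sum.cong)
qed

text \<open>Expanding the iterated quotient gives \<open>u x - u (\<sigma>\<^sub>\<alpha> x) + u (\<sigma>\<^sub>\<beta> x) - u (\<sigma>\<^sub>\<beta> \<sigma>\<^sub>\<alpha> x)\<close>, after the
  substitution of \<open>\<sigma>\<^sub>\<beta> \<alpha>\<close> for \<open>\<alpha>\<close> in the part evaluated at \<open>\<sigma>\<^sub>\<beta> x\<close>. The coefficients are symmetric in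
  \<open>\<alpha>\<close> and \<open>\<beta>\<close>, so the two middle terms cancel and the sum over rotations remains.\<close>

lemma sum_iterated_quotients_R:
  fixes u :: "real ^ 'n \<Rightarrow> real"
  assumes x: "\<forall>\<alpha>\<in>R. \<alpha> \<bullet> x \<noteq> 0"
  shows "(\<Sum>\<alpha>\<in>R. \<Sum>\<beta>\<in>R. k \<alpha> * k \<beta> * (\<alpha> \<bullet> \<beta>) * ((q \<alpha> u x - q \<alpha> u (reflection \<beta> x)) / (\<beta> \<bullet> x))) = 0"
proof -
  let ?c = "\<lambda>\<alpha> \<beta>. k \<alpha> * k \<beta> * (\<alpha> \<bullet> \<beta>) / ((\<alpha> \<bullet> x) * (\<beta> \<bullet> x))"
  let ?\<sigma> = reflection
  define A where "A \<alpha> \<beta> = k \<alpha> * k \<beta> * (\<alpha> \<bullet> \<beta>) * (q \<alpha> u (?\<sigma> \<beta> x) / (\<beta> \<bullet> x))" for \<alpha> \<beta>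
  have A: "A (?\<sigma> \<beta> \<alpha>) \<beta> = - (?c \<alpha> \<beta> * (u (?\<sigma> \<beta> x) - u (?\<sigma> \<beta> (?\<sigma> \<alpha> x))))"
    if "\<alpha> \<in> R" "\<beta> \<in> R" for \<alpha> \<beta>
  proof -
    have i: "?\<sigma> \<beta> \<alpha> \<bullet> ?\<sigma> \<beta> x = \<alpha> \<bullet> x" "?\<sigma> \<beta> \<alpha> \<bullet> \<beta> = - (\<alpha> \<bullet> \<beta>)"
      using that root_inner inner_reflection_reflection[of \<beta> \<alpha> x] inner_reflection_self[of \<beta> \<alpha>]
      by (auto simp: inner_commute)
    then have q: "q (?\<sigma> \<beta> \<alpha>) u (?\<sigma> \<beta> x) = (u (?\<sigma> \<beta> x) - u (?\<sigma> \<beta> (?\<sigma> \<alpha> x))) / (\<alpha> \<bullet> x)"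
      using that x root_inner
      by (simp add: dunkl_quotient_off reflection_conjugate reflection_involution)
    show ?thesis
      unfolding A_def i(2) q using that
      by (simp add: multiplicity_reflection algebra_simps diff_divide_distrib)
  qed
  have "(\<Sum>\<alpha>\<in>R. \<Sum>\<beta>\<in>R. A \<alpha> \<beta>) = (\<Sum>\<beta>\<in>R. \<Sum>\<alpha>\<in>R. A \<alpha> \<beta>)" by (rule sum.swap)
  also have "\<dots> = (\<Sum>\<beta>\<in>R. \<Sum>\<alpha>\<in>R. A (?\<sigma> \<beta> \<alpha>) \<beta>)"
    by (rule sum.cong[OF refl], rule sum_reindex_reflection[symmetric])
  also have "\<dots> = (\<Sum>\<beta>\<in>R. \<Sum>\<alpha>\<in>R. - (?c \<beta> \<alpha> * (u (?\<sigma> \<beta> x) - u (?\<sigma> \<beta> (?\<sigma> \<alpha> x)))))"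
    by (intro sum.cong refl) (simp add: A inner_commute mult.commute)
  finally have sA: "(\<Sum>\<alpha>\<in>R. \<Sum>\<beta>\<in>R. A \<alpha> \<beta>) = (\<Sum>\<alpha>\<in>R. \<Sum>\<beta>\<in>R. - (?c \<alpha> \<beta> * (u (?\<sigma> \<alpha> x) - u (?\<sigma> \<alpha> (?\<sigma> \<beta> x)))))" .
  have "(\<Sum>\<alpha>\<in>R. \<Sum>\<beta>\<in>R. k \<alpha> * k \<beta> * (\<alpha> \<bullet> \<beta>) * ((q \<alpha> u x - q \<alpha> u (?\<sigma> \<beta> x)) / (\<beta> \<bullet> x)))
     = (\<Sum>\<alpha>\<in>R. \<Sum>\<beta>\<in>R. ?c \<alpha> \<beta> * (u x - u (?\<sigma> \<alpha> x)) - A \<alpha> \<beta>)"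
    by (intro sum.cong refl) (use x in \<open>simp add: A_def dunkl_quotient_off field_simps\<close>)
  also have "\<dots> = (\<Sum>\<alpha>\<in>R. \<Sum>\<beta>\<in>R. ?c \<alpha> \<beta> * (u x - u (?\<sigma> \<alpha> x))) - (\<Sum>\<alpha>\<in>R. \<Sum>\<beta>\<in>R. A \<alpha> \<beta>)"
    by (simp only: sum_subtractf)
  also have "\<dots> = (\<Sum>\<alpha>\<in>R. \<Sum>\<beta>\<in>R. ?c \<alpha> \<beta> * (u x - u (?\<sigma> \<alpha> (?\<sigma> \<beta> x))))"
    unfolding sA by (simp only: sum_subtractf[symmetric]) (simp add: algebra_simps diff_divide_distrib)
  also have "\<dots> = 0" by (rule sum_rotations_eq_0[OF x])
  finally show ?thesis .
qed

lemma sum_iterated_quotients: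
  fixes u :: "real ^ 'n \<Rightarrow> real"
  assumes x: "\<forall>\<alpha>\<in>R. \<alpha> \<bullet> x \<noteq> 0"
  shows "(\<Sum>\<alpha>\<in>Rp. \<Sum>\<beta>\<in>Rp. k \<alpha> * k \<beta> * (\<alpha> \<bullet> \<beta>) * ((q \<alpha> u x - q \<alpha> u (reflection \<beta> x)) / (\<beta> \<bullet> x))) = 0"
proof -
  let ?A = "\<lambda>\<alpha> \<beta>. k \<alpha> * k \<beta> * (\<alpha> \<bullet> \<beta>) * ((q \<alpha> u x - q \<alpha> u (reflection \<beta> x)) / (\<beta> \<bullet> x))"
  have qm: "q (- \<alpha>) u y = - q \<alpha> u y" if "\<alpha> \<in> R" "\<forall>\<alpha>\<in>R. \<alpha> \<bullet> y \<noteq> 0" for \<alpha> y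
    using that by (simp add: dunkl_quotient_off reflection_uminus)
  have e1: "?A \<alpha> (- \<beta>) = ?A \<alpha> \<beta>" if "\<beta> \<in> R" for \<alpha> \<beta>
    using that by (simp add: multiplicity_minus reflection_uminus)
  have e2: "?A (- \<alpha>) \<beta> = ?A \<alpha> \<beta>" if "\<alpha> \<in> R" "\<beta> \<in> R" for \<alpha> \<beta>
    using that qm[OF that(1) x] qm[OF that(1) regular_reflection[OF x that(2)]] x
    by (simp add: multiplicity_minus field_simps)
  have "0 = (\<Sum>\<alpha>\<in>R. \<Sum>\<beta>\<in>R. ?A \<alpha> \<beta>)" by (rule sum_iterated_quotients_R[OF x, symmetric])
  also have "\<dots> = 2 * (\<Sum>\<alpha>\<in>Rp. \<Sum>\<beta>\<in>R. ?A \<alpha> \<beta>)"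
    by (rule sum_R) (intro sum.cong refl e2)
  also have "\<dots> = 2 * (\<Sum>\<alpha>\<in>Rp. 2 * (\<Sum>\<beta>\<in>Rp. ?A \<alpha> \<beta>))"
    by (intro arg_cong[where f = "\<lambda>s. 2 * s"] sum.cong refl sum_R e1)
  finally show ?thesis by (simp add: sum_distrib_left[symmetric])
qed

text \<open>The iterated differences cancel by \<open>sum_iterated_quotients\<close>; the two terms that mix a derivative with
  a difference are evaluated by differentiating the quotient in the direction of its root.\<close>

lemma dunkl_laplacian_formula:
  assumes u: "C_k (Suc (Suc 0)) u" and x: "\<forall>\<alpha>\<in>R. \<alpha> \<bullet> x \<noteq> 0"
  shows "L u x = (\<Sum>i\<in>UNIV. partial_deriv i (partial_deriv i u) x)
     + 2 * (\<Sum>\<alpha>\<in>Rp. k \<alpha> * ((grad u x \<bullet> \<alpha> - q \<alpha> u x) / (\<alpha> \<bullet> x)))"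
proof -
  let ?\<sigma> = reflection
  let ?D = "\<lambda>i. partial_deriv i u"
  have x': "\<alpha> \<bullet> x \<noteq> 0" if "\<alpha> \<in> Rp" for \<alpha> using x that Rp_subset by auto
  have dq: "q \<alpha> u differentiable (at x)" if "\<alpha> \<in> Rp" for \<alpha>
    using C_k_dunkl_quotient[OF Rp_inner[OF that] u] by simp
  have dp: "partial_deriv i u differentiable (at x)" for i using u by simp
  have TT: "T i (T i u) x = partial_deriv i (?D i) x + (\<Sum>\<alpha>\<in>Rp. k \<alpha> * \<alpha> $ i * partial_deriv i (q \<alpha> u) x)
     + (\<Sum>\<beta>\<in>Rp. k \<beta> * \<beta> $ i * ((?D i x - ?D i (?\<sigma> \<beta> x)) / (\<beta> \<bullet> x)))
     + (\<Sum>\<alpha>\<in>Rp. \<Sum>\<beta>\<in>Rp. k \<alpha> * k \<beta> * (\<alpha> $ i * \<beta> $ i) * ((q \<alpha> u x - q \<alpha> u (?\<sigma> \<beta> x)) / (\<beta> \<bullet> x)))" for i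
  proof -
    have "(T i u has_derivative (\<lambda>v. grad (?D i) x \<bullet> v + (\<Sum>\<alpha>\<in>Rp. k \<alpha> * \<alpha> $ i * (grad (q \<alpha> u) x \<bullet> v)))) (at x)"
      unfolding dunkl_op_def
      by (intro has_derivative_add has_derivative_sum has_derivative_mult_right has_derivative_grad dp dq)
    from partial_deriv_unique[OF this]
    have "partial_deriv i (T i u) x = partial_deriv i (?D i) x + (\<Sum>\<alpha>\<in>Rp. k \<alpha> * \<alpha> $ i * partial_deriv i (q \<alpha> u) x)"
      by (simp add: grad_inner_axis)
    moreover have "q \<beta> (T i u) x = (?D i x - ?D i (?\<sigma> \<beta> x)) / (\<beta> \<bullet> x)
       + (\<Sum>\<alpha>\<in>Rp. k \<alpha> * \<alpha> $ i * ((q \<alpha> u x - q \<alpha> u (?\<sigma> \<beta> x)) / (\<beta> \<bullet> x)))" if "\<beta> \<in> Rp" for \<beta>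
      using x'[OF that]
      by (simp add: dunkl_quotient_off[of \<beta>] dunkl_op_def add_divide_distrib diff_divide_distrib
          sum_divide_distrib sum_subtractf[symmetric] right_diff_distrib)
    then have "(\<Sum>\<beta>\<in>Rp. k \<beta> * \<beta> $ i * q \<beta> (T i u) x) =
       (\<Sum>\<beta>\<in>Rp. k \<beta> * \<beta> $ i * ((?D i x - ?D i (?\<sigma> \<beta> x)) / (\<beta> \<bullet> x)))
       + (\<Sum>\<beta>\<in>Rp. \<Sum>\<alpha>\<in>Rp. k \<alpha> * k \<beta> * (\<alpha> $ i * \<beta> $ i) * ((q \<alpha> u x - q \<alpha> u (?\<sigma> \<beta> x)) / (\<beta> \<bullet> x)))"
      by (simp add: distrib_left sum.distrib sum_distrib_left mult_ac cong: sum.cong)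
    ultimately show ?thesis
      by (subst sum.swap) (simp add: dunkl_op_def[of Rp k i "T i u"])
  qed
  have s1: "(\<Sum>i\<in>UNIV. \<Sum>\<alpha>\<in>Rp. k \<alpha> * \<alpha> $ i * partial_deriv i (q \<alpha> u) x) = (\<Sum>\<alpha>\<in>Rp. k \<alpha> * (grad (q \<alpha> u) x \<bullet> \<alpha>))"
    by (subst sum.swap) (simp add: inner_vec_real grad_nth sum_distrib_left mult_ac)
  have s2: "(\<Sum>i\<in>UNIV. \<Sum>\<beta>\<in>Rp. k \<beta> * \<beta> $ i * ((?D i x - ?D i (?\<sigma> \<beta> x)) / (\<beta> \<bullet> x)))
     = (\<Sum>\<beta>\<in>Rp. k \<beta> * ((grad u x \<bullet> \<beta> - grad u (?\<sigma> \<beta> x) \<bullet> \<beta>) / (\<beta> \<bullet> x)))"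
    by (subst sum.swap)
      (simp add: inner_vec_real grad_nth sum_distrib_left sum_divide_distrib sum_subtractf[symmetric] algebra_simps)
  have s3: "(\<Sum>i\<in>UNIV. \<Sum>\<alpha>\<in>Rp. \<Sum>\<beta>\<in>Rp. k \<alpha> * k \<beta> * (\<alpha> $ i * \<beta> $ i) * ((q \<alpha> u x - q \<alpha> u (?\<sigma> \<beta> x)) / (\<beta> \<bullet> x))) = 0"
  proof -
    have "(\<Sum>i\<in>UNIV. \<Sum>\<alpha>\<in>Rp. \<Sum>\<beta>\<in>Rp. k \<alpha> * k \<beta> * (\<alpha> $ i * \<beta> $ i) * ((q \<alpha> u x - q \<alpha> u (?\<sigma> \<beta> x)) / (\<beta> \<bullet> x)))
      = (\<Sum>\<alpha>\<in>Rp. \<Sum>\<beta>\<in>Rp. \<Sum>i\<in>UNIV. k \<alpha> * k \<beta> * (\<alpha> $ i * \<beta> $ i) * ((q \<alpha> u x - q \<alpha> u (?\<sigma> \<beta> x)) / (\<beta> \<bullet> x)))"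
      by (subst sum.swap) (intro sum.cong refl sum.swap)
    also have "\<dots> = (\<Sum>\<alpha>\<in>Rp. \<Sum>\<beta>\<in>Rp. k \<alpha> * k \<beta> * (\<alpha> \<bullet> \<beta>) * ((q \<alpha> u x - q \<alpha> u (?\<sigma> \<beta> x)) / (\<beta> \<bullet> x)))"
      by (simp only: sum_distrib_left[symmetric] sum_distrib_right[symmetric] inner_vec_real[symmetric])
    also have "\<dots> = 0" by (rule sum_iterated_quotients[OF x])
    finally show ?thesis .
  qed
  have br: "grad (q \<alpha> u) x \<bullet> \<alpha> + (grad u x \<bullet> \<alpha> - grad u (?\<sigma> \<alpha> x) \<bullet> \<alpha>) / (\<alpha> \<bullet> x)
      = 2 * ((grad u x \<bullet> \<alpha> - q \<alpha> u x) / (\<alpha> \<bullet> x))" if "\<alpha> \<in> Rp" for \<alpha>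
    using has_derivative_inner_times_dunkl_quotient[OF Rp_inner[OF that] u, of x \<alpha>] x'[OF that]
    by (simp add: reflection_self Rp_inner[OF that] field_simps)
  have "L u x = (\<Sum>i\<in>UNIV. partial_deriv i (?D i) x)
     + (\<Sum>\<alpha>\<in>Rp. k \<alpha> * (grad (q \<alpha> u) x \<bullet> \<alpha> + (grad u x \<bullet> \<alpha> - grad u (?\<sigma> \<alpha> x) \<bullet> \<alpha>) / (\<alpha> \<bullet> x)))"
    unfolding dunkl_laplacian_def TT sum.distrib s1 s2 s3 by (simp add: distrib_left sum.distrib)
  also have "(\<Sum>\<alpha>\<in>Rp. k \<alpha> * (grad (q \<alpha> u) x \<bullet> \<alpha> + (grad u x \<bullet> \<alpha> - grad u (?\<sigma> \<alpha> x) \<bullet> \<alpha>) / (\<alpha> \<bullet> x)))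
     = 2 * (\<Sum>\<alpha>\<in>Rp. k \<alpha> * ((grad u x \<bullet> \<alpha> - q \<alpha> u x) / (\<alpha> \<bullet> x)))"
    by (simp add: br sum_distrib_left mult_ac cong: sum.cong)
  finally show ?thesis .
qed

section \<open>The energy identity and the inequality\<close>

text \<open>The first-order part of \<open>\<Delta>\<^sub>k\<close> is a derivation, so only the second derivatives and the differences
  contribute to the correction term.\<close>

lemma dunkl_laplacian_square:
  assumes u: "C_k (Suc (Suc 0)) u" and x: "\<forall>\<alpha>\<in>R. \<alpha> \<bullet> x \<noteq> 0"
  shows "L (\<lambda>x. u x * u x) x
    = 2 * (u x * L u x) + 2 * ((norm (grad u x))\<^sup>2 + (\<Sum>\<alpha>\<in>Rp. k \<alpha> * (q \<alpha> u x)\<^sup>2))"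
proof -
  have uu: "C_k (Suc (Suc 0)) (\<lambda>x. u x * u x)" by (intro C_k_mult u)
  have d: "u differentiable (at y)" "partial_deriv i u differentiable (at y)" for i y using u by auto
  have p: "partial_deriv i (\<lambda>x. u x * u x) = (\<lambda>x. u x * partial_deriv i u x + partial_deriv i u x * u x)" for i
    using d by (auto simp: partial_deriv_mult)
  have pp: "partial_deriv i (partial_deriv i (\<lambda>x. u x * u x)) x
     = 2 * (u x * partial_deriv i (partial_deriv i u) x) + 2 * (grad u x $ i * grad u x $ i)" for i
    unfolding p by (subst partial_deriv_add)
      (use d in \<open>auto simp: partial_deriv_mult grad_nth intro!: differentiable_mult\<close>)
  have summand: "(grad (\<lambda>x. u x * u x) x \<bullet> \<alpha> - q \<alpha> (\<lambda>x. u x * u x) x) / (\<alpha> \<bullet> x)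
      = 2 * (u x * ((grad u x \<bullet> \<alpha> - q \<alpha> u x) / (\<alpha> \<bullet> x))) + (q \<alpha> u x)\<^sup>2" if "\<alpha> \<in> Rp" for \<alpha>
  proof -
    have "\<alpha> \<bullet> x \<noteq> 0" using x that Rp_subset by auto
    moreover have "grad (\<lambda>x. u x * u x) x \<bullet> \<alpha> = 2 * (u x * (grad u x \<bullet> \<alpha>))"
      by (simp only: grad_mult[OF d(1) d(1)] inner_add_left inner_scaleR_left)
    ultimately show ?thesis
      by (simp add: d dunkl_quotient_product field_simps power2_eq_square)
  qed
  show ?thesis
    unfolding dunkl_laplacian_formula[OF uu x] dunkl_laplacian_formula[OF u x] pp
    by (simp add: summand sum.distrib power2_norm_eq_inner inner_vec_real[of "grad u x" "grad u x"]
        distrib_left sum_distrib_left mult_ac cong: sum.cong)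
qed

lemma integrable_norm_grad_sq:
  assumes u: "C_k (Suc 0) u" "compactly_supported u"
  shows "integrable \<mu> (\<lambda>x. (norm (grad u x))\<^sup>2)"
proof (rule integrable_compactly_supported)
  show "continuous_on UNIV (\<lambda>x. (norm (grad u x))\<^sup>2)"
    by (intro continuous_intros C_k_grad_continuous[OF u(1)])
  show "compactly_supported (\<lambda>x. (norm (grad u x))\<^sup>2)"
    unfolding power2_norm_eq_inner inner_vec_real grad_nth
    by (intro compactly_supported_sum compactly_supported_mult_left compactly_supported_partial_deriv u)
qed

text \<open>\<open>\<Delta>\<^sub>k (u\<^sup>2)\<close> has integral \<open>0\<close>, so the energy \<open>- \<integral> u \<Delta>\<^sub>k u\<close> equals the integral of
  \<open>|\<nabla>u|\<^sup>2 + \<Sum> k\<^sub>\<alpha> q\<^sub>\<alpha>\<^sup>2\<close>, and the multiplicities are nonnegative.\<close>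

lemma integral_grad_le:
  assumes u: "C_k (Suc (Suc 0)) u" "compactly_supported u"
  shows "(\<integral>x. (norm (grad u x))\<^sup>2 \<partial>\<mu>) \<le> (\<integral>x. (norm (dunkl_gradient Rp k u x))\<^sup>2 \<partial>\<mu>)"
proof -
  have u1: "C_k (Suc 0) u" by (rule C_k_mono_Suc[OF u(1)])
  have uu: "C_k (Suc (Suc 0)) (\<lambda>x. u x * u x)" "compactly_supported (\<lambda>x. u x * u x)"
    by (intro C_k_mult u compactly_supported_mult_left)+
  have cL: "continuous_on UNIV (L (\<lambda>x. u x * u x))" "continuous_on UNIV (L u)" "continuous_on UNIV u"
    using continuous_dunkl_laplacian uu u C_k_continuous[OF u1] by auto
  have cg: "continuous_on UNIV (\<lambda>x. (norm (grad u x))\<^sup>2)"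
    by (intro continuous_intros C_k_grad_continuous[OF u1])
  have cq: "continuous_on UNIV (\<lambda>x. \<Sum>\<alpha>\<in>Rp. k \<alpha> * (q \<alpha> u x)\<^sup>2)"
    by (intro continuous_intros continuous_dunkl_quotient Rp_inner u1)
  have i1: "integrable \<mu> (\<lambda>x. u x * L u x)"
    by (intro integrable_compactly_supported continuous_intros cL compactly_supported_mult_left u)
  have i2: "integrable \<mu> (\<lambda>x. (norm (grad u x))\<^sup>2)"
    by (rule integrable_norm_grad_sq[OF u1 u(2)])
  have i3: "integrable \<mu> (\<lambda>x. \<Sum>\<alpha>\<in>Rp. k \<alpha> * (q \<alpha> u x)\<^sup>2)"
  proof (rule integrable_compactly_supported[OF cq])
    show "compactly_supported (\<lambda>x. \<Sum>\<alpha>\<in>Rp. k \<alpha> * (q \<alpha> u x)\<^sup>2)"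
      unfolding power2_eq_square
      by (intro compactly_supported_sum compactly_supported_mult_right compactly_supported_dunkl_quotient
          Rp_inner u1 u)
  qed
  have halve: "0 = 2 * a + 2 * (b + c) \<Longrightarrow> - a = b + c" for a b c :: real by simp
  have "0 = (\<Sum>i\<in>UNIV. \<integral>x. T i (T i (\<lambda>x. u x * u x)) x \<partial>\<mu>)"
    using integral_dunkl_op[OF C_k_dunkl_op[OF uu(1)] compactly_supported_dunkl_op[OF C_k_mono_Suc[OF uu(1)] uu(2)]]
    by simp
  also have "\<dots> = (\<integral>x. L (\<lambda>x. u x * u x) x \<partial>\<mu>)"
    unfolding dunkl_laplacian_def
    by (intro Bochner_Integration.integral_sum[symmetric] integrable_compactly_supported
        continuous_dunkl_op compactly_supported_dunkl_op C_k_dunkl_op uu C_k_mono_Suc[OF uu(1)])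
  also have "\<dots> = (\<integral>x. 2 * (u x * L u x) + 2 * ((norm (grad u x))\<^sup>2 + (\<Sum>\<alpha>\<in>Rp. k \<alpha> * (q \<alpha> u x)\<^sup>2)) \<partial>\<mu>)"
  proof (rule integral_cong_AE)
    show "AE x in \<mu>. L (\<lambda>x. u x * u x) x
       = 2 * (u x * L u x) + 2 * ((norm (grad u x))\<^sup>2 + (\<Sum>\<alpha>\<in>Rp. k \<alpha> * (q \<alpha> u x)\<^sup>2))"
      using AE_regular by eventually_elim (rule dunkl_laplacian_square[OF u(1)])
    have "continuous_on UNIV (\<lambda>x. 2 * (u x * L u x) + 2 * ((norm (grad u x))\<^sup>2 + (\<Sum>\<alpha>\<in>Rp. k \<alpha> * (q \<alpha> u x)\<^sup>2)))"
      by (intro continuous_on_add continuous_on_mult continuous_on_const cL cg cq)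
    then show "(\<lambda>x. 2 * (u x * L u x) + 2 * ((norm (grad u x))\<^sup>2 + (\<Sum>\<alpha>\<in>Rp. k \<alpha> * (q \<alpha> u x)\<^sup>2))) \<in> borel_measurable \<mu>"
      by (simp add: borel_measurable_continuous_onI cong: measurable_cong_sets)
    show "L (\<lambda>x. u x * u x) \<in> borel_measurable \<mu>"
      using borel_measurable_continuous_onI[OF cL(1)] by (simp cong: measurable_cong_sets)
  qed
  also have "\<dots> = 2 * (\<integral>x. u x * L u x \<partial>\<mu>) + 2 * ((\<integral>x. (norm (grad u x))\<^sup>2 \<partial>\<mu>) + (\<integral>x. (\<Sum>\<alpha>\<in>Rp. k \<alpha> * (q \<alpha> u x)\<^sup>2) \<partial>\<mu>))"
    using i1 i2 i3 by (simp del: Bochner_Integration.integral_sum)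
  finally have "- (\<integral>x. u x * L u x \<partial>\<mu>) = (\<integral>x. (norm (grad u x))\<^sup>2 \<partial>\<mu>) + (\<integral>x. (\<Sum>\<alpha>\<in>Rp. k \<alpha> * (q \<alpha> u x)\<^sup>2) \<partial>\<mu>)"
    by (rule halve)
  moreover have "- (\<integral>x. u x * L u x \<partial>\<mu>) = (\<integral>x. (norm (dunkl_gradient Rp k u x))\<^sup>2 \<partial>\<mu>)"
    unfolding integral_mult_dunkl_laplacian[OF u u1 u(2)] integral_dunkl_gradient[OF u1 u(2)]
    by (simp add: power2_eq_square)
  moreover have "(\<integral>x. (\<Sum>\<alpha>\<in>Rp. k \<alpha> * (q \<alpha> u x)\<^sup>2) \<partial>\<mu>) \<ge> 0"
    using Rp_multiplicity_nonneg by (intro Bochner_Integration.integral_nonneg sum_nonneg) auto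
  ultimately show ?thesis by linarith
qed

lemma dunkl_rellich_inequality:
  assumes u: "C_k (Suc (Suc 0)) u" "compactly_supported u"
  shows "(N - 2)\<^sup>2 / 4 * (\<integral>x. (norm (dunkl_gradient Rp k u x))\<^sup>2 \<partial>\<mu>)
    \<le> (\<integral>x. (norm x)\<^sup>2 * \<bar>L u x\<bar>\<^sup>2 \<partial>\<mu>)"
proof -
  \<comment> \<open>The value of \<open>b\<close> for which the integrated inequality is strongest.\<close>
  define b where "b = (N - 2) / 2"
  define D where "D = (\<integral>x. (norm (dunkl_gradient Rp k u x))\<^sup>2 \<partial>\<mu>)"
  have u1: "C_k (Suc 0) u" by (rule C_k_mono_Suc[OF u(1)])
  have cL: "continuous_on UNIV (L u)" and sL: "compactly_supported (L u)"
    using continuous_dunkl_laplacian compactly_supported_dunkl_laplacian u by auto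
  have i1: "integrable \<mu> (\<lambda>x. (norm x)\<^sup>2 * \<bar>L u x\<bar>\<^sup>2)"
    unfolding power2_abs power2_eq_square[of "L u _"]
    by (intro integrable_compactly_supported continuous_intros cL compactly_supported_mult_right sL)
  have i2: "integrable \<mu> (\<lambda>x. euler u x * L u x)"
    using C_k_euler[OF u1]
    by (intro integrable_compactly_supported continuous_intros cL compactly_supported_mult_right sL) auto
  have i3: "integrable \<mu> (\<lambda>x. (norm (grad u x))\<^sup>2)"
    by (rule integrable_norm_grad_sq[OF u1 u(2)])
  have "0 \<le> (norm x)\<^sup>2 * \<bar>L u x\<bar>\<^sup>2 - 2 * b * (euler u x * L u x) + b\<^sup>2 * (norm (grad u x))\<^sup>2" for x
  proof -
    have "\<bar>euler u x\<bar> \<le> norm (grad u x) * norm x"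
      unfolding euler_def by (rule Cauchy_Schwarz_ineq2)
    then have "\<bar>b\<bar> * \<bar>L u x\<bar> * \<bar>euler u x\<bar> \<le> \<bar>b\<bar> * \<bar>L u x\<bar> * (norm (grad u x) * norm x)"
      by (intro mult_left_mono) auto
    moreover have "b * (euler u x * L u x) \<le> \<bar>b\<bar> * \<bar>L u x\<bar> * \<bar>euler u x\<bar>"
      using abs_ge_self[of "b * (euler u x * L u x)"] by (simp add: abs_mult mult_ac)
    moreover have "0 \<le> (norm x * \<bar>L u x\<bar> - \<bar>b\<bar> * norm (grad u x))\<^sup>2" by simp
    then have "2 * (\<bar>b\<bar> * \<bar>L u x\<bar> * (norm (grad u x) * norm x)) \<le> (norm x)\<^sup>2 * \<bar>L u x\<bar>\<^sup>2 + \<bar>b\<bar>\<^sup>2 * (norm (grad u x))\<^sup>2"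
      by (simp only: power2_diff power_mult_distrib) (simp add: mult_ac)
    ultimately show ?thesis by (simp only: power2_abs)
  qed
  then have "0 \<le> (\<integral>x. (norm x)\<^sup>2 * \<bar>L u x\<bar>\<^sup>2 - 2 * b * (euler u x * L u x) + b\<^sup>2 * (norm (grad u x))\<^sup>2 \<partial>\<mu>)"
    by (intro Bochner_Integration.integral_nonneg)
  also have "\<dots> = (\<integral>x. (norm x)\<^sup>2 * \<bar>L u x\<bar>\<^sup>2 \<partial>\<mu>) - 2 * b * (\<integral>x. euler u x * L u x \<partial>\<mu>) + b\<^sup>2 * (\<integral>x. (norm (grad u x))\<^sup>2 \<partial>\<mu>)"
    using i1 i2 i3 by simp
  also have "(\<integral>x. euler u x * L u x \<partial>\<mu>) = b * D"
    using integral_euler_mult_dunkl_laplacian[OF u] by (simp add: b_def D_def)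
  also have "(\<integral>x. (norm x)\<^sup>2 * \<bar>L u x\<bar>\<^sup>2 \<partial>\<mu>) - 2 * b * (b * D) + b\<^sup>2 * (\<integral>x. (norm (grad u x))\<^sup>2 \<partial>\<mu>)
     \<le> (\<integral>x. (norm x)\<^sup>2 * \<bar>L u x\<bar>\<^sup>2 \<partial>\<mu>) - 2 * b * (b * D) + b\<^sup>2 * D"
    using integral_grad_le[OF u] by (simp add: D_def mult_left_mono)
  finally show ?thesis
    by (simp add: b_def D_def power2_eq_square field_simps)
qed

end

section \<open>Smooth functions of one variable\<close>

text \<open>The existential form lets the derivative be any explicitly given function.\<close>

primrec differentiable_times :: "nat \<Rightarrow> (real \<Rightarrow> real) \<Rightarrow> bool" where
  "differentiable_times 0 f \<longleftrightarrow> True"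
| "differentiable_times (Suc m) f \<longleftrightarrow>
     (\<exists>f'. (\<forall>t. (f has_real_derivative f' t) (at t)) \<and> differentiable_times m f')"

definition smooth :: "(real \<Rightarrow> real) \<Rightarrow> bool" where
  "smooth f \<longleftrightarrow> (\<forall>m. differentiable_times m f)"

lemma differentiable_times_mono: "differentiable_times (Suc m) f \<Longrightarrow> differentiable_times m f"
  by (induction m arbitrary: f) auto

lemma smoothE:
  assumes "smooth f"
  obtains f' where "\<And>t. (f has_real_derivative f' t) (at t)" "smooth f'"
proof (rule that[of "deriv f"])
  have *: "(\<forall>t. (f has_real_derivative deriv f t) (at t)) \<and> differentiable_times m (deriv f)" for m
  proof -
    obtain f' where "\<forall>t. (f has_real_derivative f' t) (at t)" "differentiable_times m f'"
      using assms unfolding smooth_def by (metis differentiable_times.simps(2))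
    moreover from this(1) have "f' = deriv f" by (metis ext DERIV_imp_deriv)
    ultimately show ?thesis by simp
  qed
  then show "(f has_real_derivative deriv f t) (at t)" for t by blast
  show "smooth (deriv f)" using * by (simp add: smooth_def)
qed

lemma smoothI:
  assumes "\<And>t. (f has_real_derivative f' t) (at t)" "smooth f'" shows "smooth f"
  unfolding smooth_def
proof
  fix m show "differentiable_times m f"
    using assms by (cases m) (auto simp: smooth_def)
qed

lemma smooth_continuous: "smooth f \<Longrightarrow> continuous_on UNIV f"
proof -
  assume "smooth f"
  then obtain f' where "\<And>t. (f has_real_derivative f' t) (at t)" by (rule smoothE) blast
  then show ?thesis by (intro continuous_at_imp_continuous_on ballI DERIV_isCont)
qed

lemma differentiable_times_const: "differentiable_times m (\<lambda>t. c)"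
proof (induction m arbitrary: c)
  case (Suc m)
  have "\<forall>t. ((\<lambda>t. c) has_real_derivative 0) (at t)" by simp
  then show ?case using Suc[of 0] by (auto intro!: exI[of _ "\<lambda>t. 0"])
qed simp

lemma differentiable_times_add:
  "differentiable_times m f \<Longrightarrow> differentiable_times m g \<Longrightarrow> differentiable_times m (\<lambda>t. f t + g t)"
proof (induction m arbitrary: f g)
  case (Suc m)
  then obtain f' g' where "\<forall>t. (f has_real_derivative f' t) (at t)" "differentiable_times m f'"
    "\<forall>t. (g has_real_derivative g' t) (at t)" "differentiable_times m g'" by auto
  then show ?case using Suc.IH[of f' g'] by (auto intro!: exI[of _ "\<lambda>t. f' t + g' t"] DERIV_add)
qed simp

lemma differentiable_times_mult:
  "differentiable_times m f \<Longrightarrow> differentiable_times m g \<Longrightarrow> differentiable_times m (\<lambda>t. f t * g t)"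
proof (induction m arbitrary: f g)
  case (Suc m)
  then obtain f' g' where "\<forall>t. (f has_real_derivative f' t) (at t)" "differentiable_times m f'"
    "\<forall>t. (g has_real_derivative g' t) (at t)" "differentiable_times m g'" by auto
  then show ?case
    using Suc.IH[of f' g] Suc.IH[of g' f] Suc.prems[THEN differentiable_times_mono]
    by (auto intro!: exI[of _ "\<lambda>t. f' t * g t + g' t * f t"] DERIV_mult differentiable_times_add)
qed simp

lemma differentiable_times_affine:
  "differentiable_times m f \<Longrightarrow> differentiable_times m (\<lambda>t. f (a + c * t))"
proof (induction m arbitrary: f)
  case (Suc m)
  then obtain f' where f': "\<forall>t. (f has_real_derivative f' t) (at t)" "differentiable_times m f'" by auto
  have "((\<lambda>t. f (a + c * t)) has_real_derivative f' (a + c * t) * c) (at t)" for t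
    by (rule DERIV_chain2[of f]) (use f'(1) in \<open>auto intro!: derivative_eq_intros\<close>)
  then show ?case
    using differentiable_times_mult[OF Suc.IH[OF f'(2)] differentiable_times_const[of m c]]
    by (auto intro!: exI[of _ "\<lambda>t. f' (a + c * t) * c"])
qed simp

lemma smooth_const: "smooth (\<lambda>t. c)"
  by (simp add: smooth_def differentiable_times_const)

lemma smooth_add: "smooth f \<Longrightarrow> smooth g \<Longrightarrow> smooth (\<lambda>t. f t + g t)"
  by (simp add: smooth_def differentiable_times_add)

lemma smooth_mult: "smooth f \<Longrightarrow> smooth g \<Longrightarrow> smooth (\<lambda>t. f t * g t)"
  by (simp add: smooth_def differentiable_times_mult)

lemma smooth_affine: "smooth f \<Longrightarrow> smooth (\<lambda>t. f (a + c * t))"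
  by (simp add: smooth_def differentiable_times_affine)

lemma poly_times_exp_minus_tendsto_0: "((\<lambda>y. poly p y * exp (- y)) \<longlongrightarrow> 0) at_top" for p :: "real poly"
proof -
  have "((\<lambda>y. \<Sum>i\<le>degree p. coeff p i * (y ^ i / exp y)) \<longlongrightarrow> (\<Sum>i\<le>degree p. coeff p i * 0)) at_top"
    by (intro tendsto_intros tendsto_power_div_exp_0)
  then show ?thesis by (simp add: poly_altdef exp_minus field_simps sum_divide_distrib)
qed

text \<open>The functions \<open>p (1/t) exp (- 1/t)\<close>, extended by \<open>0\<close>, form a class closed under differentiation;
  the constant polynomial gives the classical smooth function that is positive exactly for \<open>t > 0\<close>.\<close>

definition exp_cutoff :: "real poly \<Rightarrow> real \<Rightarrow> real" where
  "exp_cutoff p t = (if t > 0 then poly p (1 / t) * exp (- (1 / t)) else 0)"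

lemma exp_cutoff_derivative:
  "(exp_cutoff p has_real_derivative exp_cutoff (monom 1 2 * (p - pderiv p)) t) (at t)"
proof (cases "t = 0")
  case True
  have "((\<lambda>h. exp_cutoff p h / h) \<longlongrightarrow> 0) (at_left 0)"
    by (rule Lim_transform_eventually[OF tendsto_const]) (auto simp: eventually_at_filter exp_cutoff_def)
  moreover have "((\<lambda>h. exp_cutoff p h / h) \<longlongrightarrow> 0) (at_right 0)"
  proof -
    have "((\<lambda>h. poly (pCons 0 p) (inverse h) * exp (- inverse h)) \<longlongrightarrow> 0) (at_right 0)"
      by (rule filterlim_compose[OF poly_times_exp_minus_tendsto_0 filterlim_inverse_at_top_right])
    moreover have "\<forall>\<^sub>F h in at_right 0. poly (pCons 0 p) (inverse h) * exp (- inverse h) = exp_cutoff p h / h"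
      by (auto simp: eventually_at_filter exp_cutoff_def field_simps)
    ultimately show ?thesis by (rule Lim_transform_eventually)
  qed
  ultimately have "((\<lambda>h. exp_cutoff p h / h) \<longlongrightarrow> 0) (at 0)" by (rule filterlim_split_at)
  then show ?thesis using True by (simp add: DERIV_def exp_cutoff_def)
next
  case False
  show ?thesis
  proof (cases "t > 0")
    case True
    have "((\<lambda>t. poly p (1 / t) * exp (- (1 / t))) has_real_derivative
       exp_cutoff (monom 1 2 * (p - pderiv p)) t) (at t)"
      using True by (auto intro!: derivative_eq_intros DERIV_chain2[OF poly_DERIV]
        simp: exp_cutoff_def poly_monom field_simps power2_eq_square)
    then show ?thesis
      by (rule DERIV_cong_ev[THEN iffD1, rotated -1, OF _ refl _ refl])
        (use True eventually_nhds_in_open[of "{0<..}" t] in \<open>auto simp: exp_cutoff_def elim!: eventually_mono\<close>)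
  next
    case neg: False
    have "((\<lambda>t. 0) has_real_derivative exp_cutoff (monom 1 2 * (p - pderiv p)) t) (at t)"
      using neg by (simp add: exp_cutoff_def)
    then show ?thesis
      by (rule DERIV_cong_ev[THEN iffD1, rotated -1, OF _ refl _ refl])
        (use neg False eventually_nhds_in_open[of "{..<0}" t] in \<open>auto simp: exp_cutoff_def elim!: eventually_mono\<close>)
  qed
qed

lemma smooth_exp_cutoff: "smooth (exp_cutoff p)"
proof -
  have "differentiable_times m (exp_cutoff p)" for m
    by (induction m arbitrary: p) (auto intro: exp_cutoff_derivative)
  then show ?thesis by (simp add: smooth_def)
qed

lemma smooth_bump_exists:
  obtains \<psi> :: "real \<Rightarrow> real"
  where "smooth \<psi>" "\<And>s. 1 < \<bar>s\<bar> \<Longrightarrow> \<psi> s = 0" "\<And>s. \<bar>s\<bar> < 1 \<Longrightarrow> \<psi> s > 0"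
proof -
  \<comment> \<open>The factors are written as affine substitutions with slopes \<open>1\<close> and \<open>-1\<close> to match \<open>smooth_affine\<close>.\<close>
  let ?\<psi> = "\<lambda>s. exp_cutoff 1 (1 + 1 * s) * exp_cutoff 1 (1 + (- 1) * s)"
  have "smooth ?\<psi>" by (intro smooth_mult smooth_affine smooth_exp_cutoff)
  moreover have "?\<psi> s = 0" if "1 < \<bar>s\<bar>" for s using that by (auto simp: exp_cutoff_def)
  moreover have "?\<psi> s > 0" if "\<bar>s\<bar> < 1" for s using that by (auto simp: exp_cutoff_def)
  ultimately show ?thesis by (rule that)
qed

lemma derivative_zero_outside:
  fixes \<phi> :: "real \<Rightarrow> real"
  assumes "\<And>s. 1 < \<bar>s\<bar> \<Longrightarrow> \<phi> s = 0" "\<And>s. (\<phi> has_real_derivative \<phi>' s) (at s)" "1 < \<bar>s\<bar>"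
  shows "\<phi>' s = 0"
proof -
  have "open {s :: real. 1 < \<bar>s\<bar>}" by (intro open_Collect_less continuous_intros)
  then have "\<forall>\<^sub>F y in nhds s. \<phi> y = 0" using assms by (auto simp: eventually_nhds)
  then have "(\<phi> has_real_derivative 0) (at s)"
    by (subst DERIV_cong_ev[OF refl _ refl, where g = "\<lambda>y. 0"]) auto
  then show ?thesis using assms(2) DERIV_unique by blast
qed

lemma antiderivative_exists:
  fixes g :: "real \<Rightarrow> real"
  assumes "continuous_on UNIV g"
  obtains P where "\<And>s. (P has_real_derivative g s) (at s)" "P c = 0"
proof -
  have "\<exists>F. \<forall>x :: real. (- \<infinity>) < ereal x \<longrightarrow> ereal x < \<infinity> \<longrightarrow> (F has_vector_derivative g x) (at x)"
    by (rule einterval_antiderivative) (use assms in \<open>auto simp: continuous_on_eq_continuous_at\<close>)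
  then obtain F where F: "\<And>s. (F has_real_derivative g s) (at s)"
    by (auto simp: has_real_derivative_iff_has_vector_derivative)
  have "((\<lambda>s. F s - F c) has_real_derivative g s) (at s)" for s
    using DERIV_diff[OF F DERIV_const[of "F c"]] by simp
  then show ?thesis by (rule that) simp
qed

lemma constant_where_derivative_zero:
  fixes P :: "real \<Rightarrow> real"
  assumes "\<And>s. (P has_real_derivative g s) (at s)" "a \<le> b" "\<And>s. a < s \<Longrightarrow> s < b \<Longrightarrow> g s = 0"
  shows "P a = P b"
proof (cases "a = b")
  case False
  then obtain z where "a < z" "z < b" "P b - P a = (b - a) * g z"
    using MVT2[of a b P g] assms by auto
  then show ?thesis using assms(3) by simp
qed simp

section \<open>Profiles in the logarithmic variable\<close>

text \<open>With \<open>\<kappa>\<close> the quotient of the integrals of \<open>\<phi>\<^sup>2\<close> and \<open>\<psi>\<^sup>2\<close>, the function \<open>\<phi>\<^sup>2 - \<kappa> \<psi>\<^sup>2\<close> has integral \<open>0\<close>, so its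
  primitive that vanishes on the left vanishes on the right as well.\<close>

lemma balanced_primitive:
  fixes \<psi> \<phi> :: "real \<Rightarrow> real"
  assumes s: "smooth \<psi>" "smooth \<phi>"
    and z: "\<And>s. 1 < \<bar>s\<bar> \<Longrightarrow> \<psi> s = 0" "\<And>s. 1 < \<bar>s\<bar> \<Longrightarrow> \<phi> s = 0" and p: "\<psi> 0 > 0"
  obtains \<kappa> G where "\<kappa> \<ge> 0" "smooth G" "\<And>s. 1 < \<bar>s\<bar> \<Longrightarrow> G s = 0"
    "\<And>s. (G has_real_derivative (\<phi> s * \<phi> s - \<kappa> * (\<psi> s * \<psi> s))) (at s)"
proof -
  have sq: "smooth (\<lambda>s. \<psi> s * \<psi> s)" "smooth (\<lambda>s. \<phi> s * \<phi> s)" using s smooth_mult by auto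
  obtain P where P: "\<And>s. (P has_real_derivative \<psi> s * \<psi> s) (at s)" "P (- 1) = 0"
    using antiderivative_exists[OF smooth_continuous[OF sq(1)]] by metis
  obtain Q where Q: "\<And>s. (Q has_real_derivative \<phi> s * \<phi> s) (at s)" "Q (- 1) = 0"
    using antiderivative_exists[OF smooth_continuous[OF sq(2)]] by metis
  have mono: "P a \<le> P b" "Q a \<le> Q b" if "a \<le> b" for a b
  proof -
    show "P a \<le> P b" by (rule DERIV_nonneg_imp_nondecreasing[OF that]) (use P(1) zero_le_square in blast)
    show "Q a \<le> Q b" by (rule DERIV_nonneg_imp_nondecreasing[OF that]) (use Q(1) zero_le_square in blast)
  qed
  have "P 1 \<noteq> 0"
  proof
    assume "P 1 = 0"
    then have "P s = 0" if "- 1 \<le> s" "s \<le> 1" for s using mono(1)[OF that(1)] mono(1)[OF that(2)] P(2) by simp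
    then have "\<forall>\<^sub>F s in nhds 0. P s = 0"
      using eventually_nhds_in_open[of "{- 1<..<1}" "0 :: real"] by (auto elim!: eventually_mono)
    then have "(P has_real_derivative 0) (at 0)"
      by (subst DERIV_cong_ev[OF refl _ refl, where g = "\<lambda>y. 0"]) auto
    then show False using P(1)[of 0] p DERIV_unique by fastforce
  qed
  then have P1: "P 1 > 0" using mono(1)[of "- 1" 1] P(2) by simp
  have Q1: "Q 1 \<ge> 0" using mono(2)[of "- 1" 1] Q(2) by simp
  define \<kappa> where "\<kappa> = Q 1 / P 1"
  define G where "G s = Q s - \<kappa> * P s" for s
  have G: "(G has_real_derivative (\<phi> s * \<phi> s - \<kappa> * (\<psi> s * \<psi> s))) (at s)" for s
    unfolding G_def by (intro DERIV_diff DERIV_cmult P Q)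
  have "G s = 0" if "1 < \<bar>s\<bar>" for s
  proof (cases "s > 1")
    case True
    have "G 1 = G s" by (rule constant_where_derivative_zero[OF G]) (use True z in auto)
    then show ?thesis using P1 by (simp add: G_def \<kappa>_def)
  next
    case False
    have "G s = G (- 1)" by (rule constant_where_derivative_zero[OF G]) (use False that z in auto)
    then show ?thesis using P Q by (simp add: G_def)
  qed
  moreover have "smooth G"
  proof (rule smoothI[OF G])
    have "smooth (\<lambda>s. \<phi> s * \<phi> s + (- \<kappa>) * (\<psi> s * \<psi> s))" by (intro smooth_add smooth_mult smooth_const s)
    then show "smooth (\<lambda>s. \<phi> s * \<phi> s - \<kappa> * (\<psi> s * \<psi> s))" by simp
  qed
  moreover have "\<kappa> \<ge> 0" using P1 Q1 by (simp add: \<kappa>_def)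
  ultimately show ?thesis using that G by blast
qed

text \<open>The function \<open>t\<^sup>c \<phi> (\<epsilon> ln t)\<close> on the positive half-line, extended by \<open>0\<close>. For \<open>\<phi>\<close> supported in
  \<open>[-1, 1]\<close> it vanishes near \<open>0\<close>, so no smoothness is lost there, and as \<open>\<epsilon>\<close> decreases to \<open>0\<close> its
  support grows to the whole half-line.\<close>

definition log_profile :: "real \<Rightarrow> real \<Rightarrow> (real \<Rightarrow> real) \<Rightarrow> real \<Rightarrow> real" where
  "log_profile \<epsilon> c \<phi> t = (if t > 0 then exp (c * ln t) * \<phi> (\<epsilon> * ln t) else 0)"

lemma log_profile_mult: "log_profile \<epsilon> c \<phi> t * log_profile \<epsilon> d \<eta> t = log_profile \<epsilon> (c + d) (\<lambda>s. \<phi> s * \<eta> s) t"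
  by (simp add: log_profile_def distrib_right exp_add)

lemma log_profile_times: "t * log_profile \<epsilon> c \<phi> t = log_profile \<epsilon> (c + 1) \<phi> t"
  by (simp add: log_profile_def distrib_right exp_add)

lemma log_profile_add: "log_profile \<epsilon> c (\<lambda>s. \<phi> s + \<eta> s) t = log_profile \<epsilon> c \<phi> t + log_profile \<epsilon> c \<eta> t"
  by (simp add: log_profile_def distrib_left)

lemma log_profile_cmult: "log_profile \<epsilon> c (\<lambda>s. a * \<phi> s) t = a * log_profile \<epsilon> c \<phi> t"
  by (simp add: log_profile_def)

lemma log_profile_eq_0_right:
  assumes "\<epsilon> > 0" "\<And>s. 1 < \<bar>s\<bar> \<Longrightarrow> \<phi> s = 0" "exp (1 / \<epsilon>) < t"
  shows "log_profile \<epsilon> c \<phi> t = 0"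
proof -
  have t: "t > 0" using assms(3) exp_gt_zero less_trans by blast
  then have "1 / \<epsilon> < ln t" using ln_less_cancel_iff[of "exp (1 / \<epsilon>)" t] assms(3) by simp
  then have "1 < \<epsilon> * ln t" using assms(1) by (simp add: field_simps)
  then show ?thesis using assms(2) by (simp add: log_profile_def)
qed

lemma log_profile_eq_0_left:
  assumes "\<epsilon> > 0" "\<And>s. 1 < \<bar>s\<bar> \<Longrightarrow> \<phi> s = 0" "t < exp (- 1 / \<epsilon>)"
  shows "log_profile \<epsilon> c \<phi> t = 0"
proof (cases "t > 0")
  case True
  then have "ln t < - 1 / \<epsilon>" using assms(3) by (metis ln_exp ln_less_cancel_iff exp_gt_zero)
  then have "\<epsilon> * ln t < - 1" using assms(1) by (simp add: field_simps)
  then show ?thesis using assms(2) by (simp add: log_profile_def)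
qed (simp add: log_profile_def)

lemma log_profile_derivative:
  assumes \<epsilon>: "\<epsilon> > 0" and z: "\<And>s. 1 < \<bar>s\<bar> \<Longrightarrow> \<phi> s = 0"
    and d: "\<And>s. (\<phi> has_real_derivative \<phi>' s) (at s)"
  shows "(log_profile \<epsilon> c \<phi> has_real_derivative log_profile \<epsilon> (c - 1) (\<lambda>s. c * \<phi> s + \<epsilon> * \<phi>' s) t) (at t)"
proof (cases "t > 0")
  case True
  have e: "((\<lambda>t. exp (c * ln t)) has_real_derivative exp (c * ln t) * (c / t)) (at t)"
    and l: "((\<lambda>t. \<epsilon> * ln t) has_real_derivative \<epsilon> / t) (at t)"
    using True by (auto intro!: derivative_eq_intros)
  have "((\<lambda>t. exp (c * ln t) * \<phi> (\<epsilon> * ln t)) has_real_derivative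
     exp (c * ln t) * (c / t) * \<phi> (\<epsilon> * ln t) + \<phi>' (\<epsilon> * ln t) * (\<epsilon> / t) * exp (c * ln t)) (at t)"
    by (rule DERIV_mult[OF e DERIV_chain2[OF d l]])
  moreover have "exp (c * ln t) * (c / t) * \<phi> (\<epsilon> * ln t) + \<phi>' (\<epsilon> * ln t) * (\<epsilon> / t) * exp (c * ln t)
    = log_profile \<epsilon> (c - 1) (\<lambda>s. c * \<phi> s + \<epsilon> * \<phi>' s) t"
    using True by (simp add: log_profile_def left_diff_distrib exp_diff field_simps)
  ultimately have "((\<lambda>t. exp (c * ln t) * \<phi> (\<epsilon> * ln t)) has_real_derivative
    log_profile \<epsilon> (c - 1) (\<lambda>s. c * \<phi> s + \<epsilon> * \<phi>' s) t) (at t)" by simp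
  then show ?thesis
    by (rule DERIV_cong_ev[THEN iffD1, rotated -1, OF _ refl _ refl])
      (use True eventually_nhds_in_open[of "{0<..}" t] in \<open>auto simp: log_profile_def elim!: eventually_mono\<close>)
next
  case False
  have "t < exp (- 1 / \<epsilon>)" using False by (meson exp_gt_zero less_le_trans not_le order_le_less_trans)
  then have "\<forall>\<^sub>F y in nhds t. log_profile \<epsilon> c \<phi> y = 0"
    using eventually_nhds_in_open[of "{..<exp (- 1 / \<epsilon>)}" t] log_profile_eq_0_left[OF \<epsilon> z]
    by (auto elim!: eventually_mono)
  then show ?thesis
    by (subst DERIV_cong_ev[OF refl _ refl, where g = "\<lambda>y. 0"]) (use False in \<open>auto simp: log_profile_def\<close>)
qed

lemma smooth_log_profile:
  assumes \<epsilon>: "\<epsilon> > 0" and "smooth \<phi>" "\<And>s. 1 < \<bar>s\<bar> \<Longrightarrow> \<phi> s = 0"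
  shows "smooth (log_profile \<epsilon> c \<phi>)"
proof -
  have "differentiable_times m (log_profile \<epsilon> c \<phi>)" for m
    using assms(2,3)
  proof (induction m arbitrary: c \<phi>)
    case (Suc m)
    obtain \<phi>' where \<phi>': "\<And>t. (\<phi> has_real_derivative \<phi>' t) (at t)" "smooth \<phi>'"
      using Suc.prems(1) by (rule smoothE) blast
    have "differentiable_times m (log_profile \<epsilon> (c - 1) (\<lambda>s. c * \<phi> s + \<epsilon> * \<phi>' s))"
    proof (rule Suc.IH)
      show "smooth (\<lambda>s. c * \<phi> s + \<epsilon> * \<phi>' s)"
        by (intro smooth_add smooth_mult smooth_const \<phi>' Suc.prems)
      show "c * \<phi> s + \<epsilon> * \<phi>' s = 0" if "1 < \<bar>s\<bar>" for s
        using Suc.prems(2)[OF that] derivative_zero_outside[OF Suc.prems(2) \<phi>'(1) that] by simp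
    qed
    then show ?case
      using log_profile_derivative[OF \<epsilon> Suc.prems(2) \<phi>'(1)] by auto
  qed simp
  then show ?thesis by (simp add: smooth_def)
qed

section \<open>Radial functions\<close>

lemma has_derivative_radial:
  fixes x :: "real ^ 'n"
  assumes "\<And>t. (F has_real_derivative f t) (at t)"
  shows "((\<lambda>x. F (x \<bullet> x)) has_derivative (\<lambda>v. (2 * f (x \<bullet> x)) *\<^sub>R x \<bullet> v)) (at x)"
proof -
  have "((\<lambda>x :: real ^ 'n. x \<bullet> x) has_derivative (\<lambda>v. 2 * (x \<bullet> v))) (at x)"
    by (auto intro!: derivative_eq_intros simp: inner_commute)
  moreover have "(F has_derivative (\<lambda>h. f (x \<bullet> x) * h)) (at (x \<bullet> x))"
    using assms by (simp add: has_field_derivative_def)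
  ultimately have "((\<lambda>x. F (x \<bullet> x)) has_derivative (\<lambda>v. f (x \<bullet> x) * (2 * (x \<bullet> v)))) (at x)"
    by (rule has_derivative_compose)
  then show ?thesis by (simp add: mult_ac)
qed

lemma grad_radial:
  assumes "\<And>t. (F has_real_derivative f t) (at t)"
  shows "grad (\<lambda>x. F (x \<bullet> x)) x = (2 * f (x \<bullet> x)) *\<^sub>R x"
  by (rule grad_unique[OF has_derivative_radial[OF assms]])

lemma partial_deriv_radial:
  assumes "\<And>t. (F has_real_derivative f t) (at t)"
  shows "partial_deriv i (\<lambda>x. F (x \<bullet> x)) = (\<lambda>x. 2 * (x $ i * f (x \<bullet> x)))"
  by (simp add: fun_eq_iff grad_nth[symmetric] grad_radial[OF assms])

lemma C_k_radial: "smooth F \<Longrightarrow> C_k m (\<lambda>x :: real ^ 'n. F (x \<bullet> x))"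
proof (induction m arbitrary: F)
  case 0
  then show ?case
    by (auto intro!: continuous_intros continuous_on_compose2[OF smooth_continuous[OF 0]])
next
  case (Suc m)
  obtain f where f: "\<And>t. (F has_real_derivative f t) (at t)" "smooth f"
    using Suc.prems by (rule smoothE) blast
  have "(\<lambda>x :: real ^ 'n. F (x \<bullet> x)) differentiable (at x)" for x
    using has_derivative_radial[OF f(1)] by (auto simp: differentiable_def)
  moreover have "C_k m (partial_deriv i (\<lambda>x :: real ^ 'n. F (x \<bullet> x)))" for i
    unfolding partial_deriv_radial[OF f(1)] by (intro C_k_mult C_k_const C_k_nth Suc.IH f)
  ultimately show ?case by simp
qed

lemma compactly_supported_radial:
  assumes "\<And>t. b < t \<Longrightarrow> F t = 0" shows "compactly_supported (\<lambda>x :: real ^ 'n. F (x \<bullet> x))"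
  unfolding compactly_supported_def
proof (intro exI allI impI)
  fix x :: "real ^ 'n" assume x: "max 1 b < norm x"
  then have "norm x * 1 \<le> norm x * norm x" by (intro mult_left_mono) auto
  with x have "b < x \<bullet> x" by (simp add: dot_square_norm power2_eq_square)
  then show "F (x \<bullet> x) = 0" by (rule assms)
qed

lemma dunkl_quotient_radial:
  assumes "\<alpha> \<bullet> \<alpha> = 2" "\<And>t. (F has_real_derivative f t) (at t)"
  shows "dunkl_quotient \<alpha> (\<lambda>x. F (x \<bullet> x)) x = 0"
proof (cases "\<alpha> \<bullet> x = 0")
  case True
  have "(\<lambda>x. F (x \<bullet> x)) differentiable (at x)"
    using has_derivative_radial[OF assms(2)] by (auto simp: differentiable_def)
  from frechet_derivative_eq_grad[OF this] show ?thesis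
    using True by (simp add: dunkl_quotient_def grad_radial[OF assms(2)] inner_commute)
next
  case False
  then show ?thesis using assms(1) by (simp add: dunkl_quotient_off inner_reflection_reflection)
qed

context dunkl
begin

lemma dunkl_op_radial:
  assumes "\<And>t. (F has_real_derivative f t) (at t)"
  shows "T i (\<lambda>x. F (x \<bullet> x)) x = 2 * (x $ i * f (x \<bullet> x))"
  using dunkl_quotient_radial[OF Rp_inner assms]
  by (simp add: dunkl_op_def partial_deriv_radial[OF assms])

lemma dunkl_gradient_radial:
  assumes "\<And>t. (F has_real_derivative f t) (at t)"
  shows "(norm (dunkl_gradient Rp k (\<lambda>x. F (x \<bullet> x)) x))\<^sup>2 = 4 * ((x \<bullet> x) * (f (x \<bullet> x) * f (x \<bullet> x)))"
  unfolding norm_dunkl_gradient_sq dunkl_op_radial[OF assms]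
  by (simp add: power2_eq_square inner_vec_real[of x x] sum_distrib_left sum_distrib_right mult_ac)

text \<open>Radial functions are invariant under reflections, so only the derivative terms of \<open>\<Delta>\<^sub>k\<close> survive, and
  \<open>\<Delta>\<^sub>k\<close> acts on them like a Laplacian in dimension \<open>N\<close>.\<close>

lemma dunkl_laplacian_radial:
  assumes F: "\<And>t. (F has_real_derivative f t) (at t)" and f: "\<And>t. (f has_real_derivative f' t) (at t)"
    and s: "smooth F" and x: "\<forall>\<alpha>\<in>R. \<alpha> \<bullet> x \<noteq> 0"
  shows "L (\<lambda>x. F (x \<bullet> x)) x = 4 * ((x \<bullet> x) * f' (x \<bullet> x)) + 2 * N * f (x \<bullet> x)"
proof -
  have "partial_deriv i (partial_deriv i (\<lambda>x. F (x \<bullet> x))) x = 2 * f (x \<bullet> x) + 4 * ((x $ i * x $ i) * f' (x \<bullet> x))" for i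
  proof -
    have "((\<lambda>x. 2 * (x $ i * f (x \<bullet> x))) has_derivative
       (\<lambda>v. 2 * (x $ i * ((2 * f' (x \<bullet> x)) *\<^sub>R x \<bullet> v) + v $ i * f (x \<bullet> x)))) (at x)"
      by (intro has_derivative_mult_right has_derivative_mult has_derivative_radial f
        bounded_linear_imp_has_derivative[OF bounded_linear_vec_nth])
    from partial_deriv_unique[OF this, of i] show ?thesis
      unfolding partial_deriv_radial[OF F] by (simp add: inner_axis)
  qed
  then have "(\<Sum>i\<in>UNIV. partial_deriv i (partial_deriv i (\<lambda>x. F (x \<bullet> x))) x)
      = real CARD('n) * (2 * f (x \<bullet> x)) + 4 * ((x \<bullet> x) * f' (x \<bullet> x))"
    by (simp add: sum.distrib sum_distrib_left[symmetric] sum_distrib_right[symmetric] inner_vec_real[of x x])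
  moreover have "(\<Sum>\<alpha>\<in>Rp. k \<alpha> * ((grad (\<lambda>x. F (x \<bullet> x)) x \<bullet> \<alpha> - q \<alpha> (\<lambda>x. F (x \<bullet> x)) x) / (\<alpha> \<bullet> x)))
      = (\<Sum>\<alpha>\<in>Rp. k \<alpha>) * (2 * f (x \<bullet> x))"
    unfolding sum_distrib_right
  proof (rule sum.cong[OF refl])
    fix \<alpha> assume \<alpha>: "\<alpha> \<in> Rp"
    then have "\<alpha> \<bullet> x \<noteq> 0" using x Rp_subset by auto
    then show "k \<alpha> * ((grad (\<lambda>x. F (x \<bullet> x)) x \<bullet> \<alpha> - q \<alpha> (\<lambda>x. F (x \<bullet> x)) x) / (\<alpha> \<bullet> x))
        = k \<alpha> * (2 * f (x \<bullet> x))"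
      unfolding dunkl_quotient_radial[OF Rp_inner[OF \<alpha>] F] grad_radial[OF F] inner_scaleR_left inner_commute[of x \<alpha>]
      by simp
  qed
  ultimately show ?thesis
    unfolding dunkl_laplacian_formula[OF C_k_radial[OF s] x]
    by (simp add: homogeneous_dim_def algebra_simps)
qed

section \<open>Sharpness of the constant\<close>

lemma integrable_log_profile:
  assumes "\<epsilon> > 0" "smooth \<phi>" "\<And>s. 1 < \<bar>s\<bar> \<Longrightarrow> \<phi> s = 0"
  shows "integrable \<mu> (\<lambda>x. log_profile \<epsilon> c \<phi> (x \<bullet> x))"
proof (rule integrable_compactly_supported)
  show "continuous_on UNIV (\<lambda>x :: real ^ 'n. log_profile \<epsilon> c \<phi> (x \<bullet> x))"
    by (rule C_k_continuous[OF C_k_radial[OF smooth_log_profile[OF assms]]])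
  show "compactly_supported (\<lambda>x :: real ^ 'n. log_profile \<epsilon> c \<phi> (x \<bullet> x))"
    by (rule compactly_supported_radial[OF log_profile_eq_0_right[OF assms(1,3)]])
qed

text \<open>In the logarithmic variable the scale-invariant measure \<open>|x|\<^sup>-\<^sup>N d\<mu>\<close> is translation invariant, so
  derivatives have integral \<open>0\<close>. Formally this is \<open>integral_euler\<close> for the function \<open>|x|\<^sup>-\<^sup>N G (\<epsilon> ln |x|\<^sup>2)\<close>.\<close>

lemma integral_log_profile_derivative:
  assumes \<epsilon>: "\<epsilon> > 0" and G: "smooth G" "\<And>s. 1 < \<bar>s\<bar> \<Longrightarrow> G s = 0"
    and g: "\<And>s. (G has_real_derivative g s) (at s)"
  shows "(\<integral>x. log_profile \<epsilon> (- N / 2) g (x \<bullet> x) \<partial>\<mu>) = 0"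
proof -
  let ?h = "\<lambda>x :: real ^ 'n. log_profile \<epsilon> (- N / 2) G (x \<bullet> x)"
  have sg: "smooth g"
  proof -
    obtain g' where "\<And>s. (G has_real_derivative g' s) (at s)" "smooth g'" using G(1) by (rule smoothE) blast
    moreover have "g' = g" using calculation(1) g DERIV_unique by blast
    ultimately show ?thesis by simp
  qed
  have zg: "g s = 0" if "1 < \<bar>s\<bar>" for s by (rule derivative_zero_outside[OF G(2) g that])
  have ih: "integrable \<mu> ?h" by (rule integrable_log_profile[OF \<epsilon> G])
  have ig: "integrable \<mu> (\<lambda>x. log_profile \<epsilon> (- N / 2) g (x \<bullet> x))" by (rule integrable_log_profile[OF \<epsilon> sg zg])
  have e: "euler ?h x = - N * ?h x + 2 * \<epsilon> * log_profile \<epsilon> (- N / 2) g (x \<bullet> x)" for x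
  proof -
    let ?t = "x \<bullet> x"
    have "grad ?h x = (2 * log_profile \<epsilon> (- N / 2 - 1) (\<lambda>s. - N / 2 * G s + \<epsilon> * g s) ?t) *\<^sub>R x"
      by (rule grad_radial[OF log_profile_derivative[OF \<epsilon> G(2) g]])
    then have "euler ?h x = 2 * (?t * log_profile \<epsilon> (- N / 2 - 1) (\<lambda>s. - N / 2 * G s + \<epsilon> * g s) ?t)"
      by (simp add: euler_def)
    also have "\<dots> = 2 * (- N / 2 * ?h x + \<epsilon> * log_profile \<epsilon> (- N / 2) g ?t)"
      unfolding log_profile_times unfolding log_profile_add log_profile_cmult by simp
    finally show ?thesis by (simp add: algebra_simps)
  qed
  have "(\<integral>x. euler ?h x \<partial>\<mu>) = - N * (\<integral>x. ?h x \<partial>\<mu>)"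
    by (rule integral_euler[OF C_k_radial[OF smooth_log_profile[OF \<epsilon> G]]
        compactly_supported_radial[OF log_profile_eq_0_right[OF \<epsilon> G(2)]]])
  moreover have "(\<integral>x. euler ?h x \<partial>\<mu>)
      = - N * (\<integral>x. ?h x \<partial>\<mu>) + 2 * \<epsilon> * (\<integral>x. log_profile \<epsilon> (- N / 2) g (x \<bullet> x) \<partial>\<mu>)"
    unfolding e using ih ig by simp
  ultimately show ?thesis using \<epsilon> by simp
qed

lemma weight_pos: "\<forall>\<alpha>\<in>R. \<alpha> \<bullet> x \<noteq> 0 \<Longrightarrow> w x > 0"
  unfolding dunkl_weight_def using Rp_subset by (intro prod_pos) auto

lemma integral_log_profile_pos:
  assumes \<epsilon>: "\<epsilon> > 0" and \<phi>: "smooth \<phi>" "\<And>s. 1 < \<bar>s\<bar> \<Longrightarrow> \<phi> s = 0"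
    and nonneg: "\<And>s. \<phi> s \<ge> 0" and pos: "\<And>s. \<bar>s\<bar> < 1 \<Longrightarrow> \<phi> s > 0"
  shows "(\<integral>x. log_profile \<epsilon> c \<phi> (x \<bullet> x) \<partial>\<mu>) > 0"
proof -
  let ?f = "\<lambda>x :: real ^ 'n. log_profile \<epsilon> c \<phi> (x \<bullet> x)"
  have int: "integrable \<mu> ?f" by (rule integrable_log_profile[OF \<epsilon> \<phi>])
  have nn: "?f x \<ge> 0" for x using nonneg by (simp add: log_profile_def)
  have cf: "continuous_on UNIV ?f"
    by (rule C_k_continuous[OF C_k_radial[OF smooth_log_profile[OF \<epsilon> \<phi>]]])
  have "(\<integral>x. ?f x \<partial>\<mu>) \<noteq> 0"
  proof
    assume "(\<integral>x. ?f x \<partial>\<mu>) = 0"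
    then have "AE x in \<mu>. ?f x = 0"
      using integral_nonneg_eq_0_iff_AE[OF int] nn by simp
    then have "AE x in lborel. 0 < w x \<longrightarrow> ?f x = 0"
      unfolding dunkl_measure_def by (subst (asm) AE_density) auto
    with AE_lborel_regular have ae: "AE x in lborel. ?f x = 0"
      by eventually_elim (simp add: weight_pos)
    let ?U = "{x :: real ^ 'n. ?f x > 0}"
    have op: "open ?U" using cf by (intro open_Collect_less continuous_intros)
    have "negligible ?U"
    proof -
      have "AE x in lborel. x \<notin> ?U" using ae by eventually_elim simp
      then have "?U \<in> null_sets lborel"
        using op by (simp add: AE_iff_null_sets)
      then show ?thesis by (simp add: negligible_iff_null_sets null_sets_completionI)
    qed
    moreover obtain i :: 'n where True by simp
    have "axis i 1 \<in> ?U" using pos[of 0] by (simp add: log_profile_def inner_axis_axis)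
    ultimately show False using open_not_negligible[OF op] by blast
  qed
  moreover have "(\<integral>x. ?f x \<partial>\<mu>) \<ge> 0" using nn by (intro Bochner_Integration.integral_nonneg)
  ultimately show ?thesis by simp
qed

text \<open>Take \<open>u = F (|x|\<^sup>2)\<close> with \<open>F' t = t\<^sup>-\<^sup>p \<psi> (\<epsilon> ln t)\<close> for a bump function \<open>\<psi>\<close>. In terms of the invariant measure
  \<open>|x|\<^sup>-\<^sup>N d\<mu>\<close> the energy is \<open>4 \<integral> \<psi>\<^sup>2\<close> and the left-hand side of the inequality is
  \<open>\<integral> ((N - 2) \<psi> + 4 \<epsilon> \<psi>')\<^sup>2\<close>. The mixed term is a derivative and integrates to \<open>0\<close>; by the choice of \<open>\<kappa>\<close>
  so does \<open>\<psi>'\<^sup>2 - \<kappa> \<psi>\<^sup>2\<close>.\<close>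

lemma near_extremals:
  obtains \<kappa> where "\<kappa> \<ge> 0" "\<And>\<epsilon>. \<epsilon> > 0 \<Longrightarrow> \<exists>u. test_function u \<and>
    (\<integral>x. (norm (dunkl_gradient Rp k u x))\<^sup>2 \<partial>\<mu>) > 0 \<and>
    (\<integral>x. (norm x)\<^sup>2 * \<bar>L u x\<bar>\<^sup>2 \<partial>\<mu>)
      = ((N - 2)\<^sup>2 / 4 + 4 * \<epsilon>\<^sup>2 * \<kappa>) * (\<integral>x. (norm (dunkl_gradient Rp k u x))\<^sup>2 \<partial>\<mu>)"
proof -
  obtain \<psi> :: "real \<Rightarrow> real" where \<psi>: "smooth \<psi>" "\<And>s. 1 < \<bar>s\<bar> \<Longrightarrow> \<psi> s = 0" "\<And>s. \<bar>s\<bar> < 1 \<Longrightarrow> \<psi> s > 0"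
    by (rule smooth_bump_exists) blast
  obtain \<phi> where \<phi>: "\<And>s. (\<psi> has_real_derivative \<phi> s) (at s)" "smooth \<phi>" using \<psi>(1) by (rule smoothE) blast
  have z\<phi>: "\<phi> s = 0" if "1 < \<bar>s\<bar>" for s by (rule derivative_zero_outside[OF \<psi>(2) \<phi>(1) that])
  obtain \<kappa> G where G: "\<kappa> \<ge> 0" "smooth G" "\<And>s. 1 < \<bar>s\<bar> \<Longrightarrow> G s = 0"
    "\<And>s. (G has_real_derivative (\<phi> s * \<phi> s - \<kappa> * (\<psi> s * \<psi> s))) (at s)"
    by (rule balanced_primitive[OF \<psi>(1) \<phi>(2) \<psi>(2) z\<phi>]) (use \<psi>(3)[of 0] in auto)
  have "\<exists>u. test_function u \<and> (\<integral>x. (norm (dunkl_gradient Rp k u x))\<^sup>2 \<partial>\<mu>) > 0 \<and>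
    (\<integral>x. (norm x)\<^sup>2 * \<bar>L u x\<bar>\<^sup>2 \<partial>\<mu>)
      = ((N - 2)\<^sup>2 / 4 + 4 * \<epsilon>\<^sup>2 * \<kappa>) * (\<integral>x. (norm (dunkl_gradient Rp k u x))\<^sup>2 \<partial>\<mu>)"
    if \<epsilon>: "\<epsilon> > 0" for \<epsilon> :: real
  proof -
    \<comment> \<open>This exponent makes \<open>|x|\<^sup>2 F'(|x|\<^sup>2)\<^sup>2\<close> homogeneous of degree \<open>-N\<close>, up to the cutoff.\<close>
    define p where "p = (N + 2) / 4"
    let ?lp = "\<lambda>\<eta> (x :: real ^ 'n). log_profile \<epsilon> (- N / 2) \<eta> (x \<bullet> x)"
    let ?f = "log_profile \<epsilon> (- p) \<psi>"
    let ?f' = "log_profile \<epsilon> (- p - 1) (\<lambda>s. - p * \<psi> s + \<epsilon> * \<phi> s)"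
    define A where "A = (\<integral>x. ?lp (\<lambda>s. \<psi> s * \<psi> s) x \<partial>\<mu>)"
    have f': "(?f has_real_derivative ?f' t) (at t)" for t
      by (rule log_profile_derivative[OF \<epsilon> \<psi>(2) \<phi>(1)])
    have sf: "smooth ?f" by (rule smooth_log_profile[OF \<epsilon> \<psi>(1,2)])
    obtain F where F: "\<And>t. (F has_real_derivative ?f t) (at t)" "F (exp (1 / \<epsilon>)) = 0"
      using antiderivative_exists[OF smooth_continuous[OF sf]] by metis
    have sF: "smooth F" by (rule smoothI[OF F(1) sf])
    have zF: "F t = 0" if "exp (1 / \<epsilon>) < t" for t
    proof -
      have "F (exp (1 / \<epsilon>)) = F t"
        by (rule constant_where_derivative_zero[OF F(1)])
          (use that log_profile_eq_0_right[OF \<epsilon> \<psi>(2)] in auto)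
      then show ?thesis using F(2) by simp
    qed
    define u where "u = (\<lambda>x :: real ^ 'n. F (x \<bullet> x))"
    have tu: "test_function u"
      unfolding test_function_def u_def
      by (intro conjI allI C_k_radial sF compact_closure_support compactly_supported_radial) (rule zF)
    have gr: "(norm (dunkl_gradient Rp k u x))\<^sup>2 = 4 * ?lp (\<lambda>s. \<psi> s * \<psi> s) x" for x
      unfolding u_def dunkl_gradient_radial[OF F(1)] log_profile_mult log_profile_times
      by (simp add: p_def field_simps)
    have lap: "(norm x)\<^sup>2 * \<bar>L u x\<bar>\<^sup>2 = (N - 2)\<^sup>2 * ?lp (\<lambda>s. \<psi> s * \<psi> s) x
        + 8 * \<epsilon> * (N - 2) * ?lp (\<lambda>s. \<psi> s * \<phi> s) x + 16 * \<epsilon>\<^sup>2 * ?lp (\<lambda>s. \<phi> s * \<phi> s) x"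
      if x: "\<forall>\<alpha>\<in>R. \<alpha> \<bullet> x \<noteq> 0" for x
    proof -
      let ?t = "x \<bullet> x"
      have "L u x = 4 * (?t * ?f' ?t) + 2 * N * ?f ?t"
        unfolding u_def by (rule dunkl_laplacian_radial[OF F(1) f' sF x])
      also have "?t * ?f' ?t = - p * ?f ?t + \<epsilon> * log_profile \<epsilon> (- p) \<phi> ?t"
        unfolding log_profile_times unfolding log_profile_add log_profile_cmult by simp
      finally have Lu: "L u x = (N - 2) * ?f ?t + 4 * \<epsilon> * log_profile \<epsilon> (- p) \<phi> ?t"
        by (simp add: p_def field_simps)
      have m: "?t * (log_profile \<epsilon> (- p) \<eta>1 ?t * log_profile \<epsilon> (- p) \<eta>2 ?t) = ?lp (\<lambda>s. \<eta>1 s * \<eta>2 s) x" for \<eta>1 \<eta>2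
        unfolding log_profile_mult log_profile_times by (simp add: p_def field_simps)
      have "(norm x)\<^sup>2 * \<bar>L u x\<bar>\<^sup>2 = (N - 2)\<^sup>2 * (?t * (?f ?t * ?f ?t))
        + 8 * \<epsilon> * (N - 2) * (?t * (?f ?t * log_profile \<epsilon> (- p) \<phi> ?t))
        + 16 * \<epsilon>\<^sup>2 * (?t * (log_profile \<epsilon> (- p) \<phi> ?t * log_profile \<epsilon> (- p) \<phi> ?t))"
        unfolding Lu power2_abs power2_norm_eq_inner by (simp add: power2_eq_square algebra_simps)
      then show ?thesis unfolding m .
    qed
    have i1: "integrable \<mu> (?lp (\<lambda>s. \<psi> s * \<psi> s))" "integrable \<mu> (?lp (\<lambda>s. \<psi> s * \<phi> s))"
       "integrable \<mu> (?lp (\<lambda>s. \<phi> s * \<phi> s))"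
      by (intro integrable_log_profile \<epsilon> smooth_mult \<psi>(1) \<phi>(2); simp add: \<psi>(2) z\<phi>)+
    have A: "A > 0"
      unfolding A_def
      by (rule integral_log_profile_pos[OF \<epsilon> smooth_mult[OF \<psi>(1) \<psi>(1)]]) (use \<psi>(2,3) in force)+
    have I2: "(\<integral>x. ?lp (\<lambda>s. \<psi> s * \<phi> s) x \<partial>\<mu>) = 0"
    proof -
      have "((\<lambda>s. 1 / 2 * (\<psi> s * \<psi> s)) has_real_derivative \<psi> s * \<phi> s) (at s)" for s
        using DERIV_cmult[OF DERIV_mult[OF \<phi>(1) \<phi>(1)], of "1 / 2" s] by (simp add: mult_ac)
      then show ?thesis
        by (rule integral_log_profile_derivative[OF \<epsilon> smooth_mult[OF smooth_const smooth_mult[OF \<psi>(1) \<psi>(1)]], rotated])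
          (simp add: \<psi>(2))
    qed
    have I3: "(\<integral>x. ?lp (\<lambda>s. \<phi> s * \<phi> s) x \<partial>\<mu>) = \<kappa> * A"
    proof -
      have "0 = (\<integral>x. ?lp (\<lambda>s. \<phi> s * \<phi> s - \<kappa> * (\<psi> s * \<psi> s)) x \<partial>\<mu>)"
        by (rule integral_log_profile_derivative[OF \<epsilon> G(2,3,4), symmetric])
      also have "\<dots> = (\<integral>x. ?lp (\<lambda>s. \<phi> s * \<phi> s) x - \<kappa> * ?lp (\<lambda>s. \<psi> s * \<psi> s) x \<partial>\<mu>)"
        by (rule Bochner_Integration.integral_cong[OF refl]) (simp add: log_profile_def algebra_simps)
      also have "\<dots> = (\<integral>x. ?lp (\<lambda>s. \<phi> s * \<phi> s) x \<partial>\<mu>) - \<kappa> * A"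
        unfolding A_def using i1 by simp
      finally show ?thesis by simp
    qed
    have G1: "(\<integral>x. (norm (dunkl_gradient Rp k u x))\<^sup>2 \<partial>\<mu>) = 4 * A"
      unfolding gr A_def by simp
    have "C_k (Suc (Suc 0)) u" unfolding u_def by (rule C_k_radial[OF sF])
    then have cL: "continuous_on UNIV (\<lambda>x. (norm x)\<^sup>2 * \<bar>L u x\<bar>\<^sup>2)"
      by (intro continuous_intros continuous_dunkl_laplacian)
    have "(\<integral>x. (norm x)\<^sup>2 * \<bar>L u x\<bar>\<^sup>2 \<partial>\<mu>) = (\<integral>x. (N - 2)\<^sup>2 * ?lp (\<lambda>s. \<psi> s * \<psi> s) x
        + 8 * \<epsilon> * (N - 2) * ?lp (\<lambda>s. \<psi> s * \<phi> s) x + 16 * \<epsilon>\<^sup>2 * ?lp (\<lambda>s. \<phi> s * \<phi> s) x \<partial>\<mu>)"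
    proof (rule integral_cong_AE)
      show "AE x in \<mu>. (norm x)\<^sup>2 * \<bar>L u x\<bar>\<^sup>2 = (N - 2)\<^sup>2 * ?lp (\<lambda>s. \<psi> s * \<psi> s) x
        + 8 * \<epsilon> * (N - 2) * ?lp (\<lambda>s. \<psi> s * \<phi> s) x + 16 * \<epsilon>\<^sup>2 * ?lp (\<lambda>s. \<phi> s * \<phi> s) x"
        using AE_regular by eventually_elim (rule lap)
      show "(\<lambda>x. (norm x)\<^sup>2 * \<bar>L u x\<bar>\<^sup>2) \<in> borel_measurable \<mu>"
        using borel_measurable_continuous_onI[OF cL] by (simp cong: measurable_cong_sets)
    qed (use i1 in \<open>auto intro!: borel_measurable_add borel_measurable_times borel_measurable_integrable\<close>)
    also have "\<dots> = (N - 2)\<^sup>2 * A + 16 * \<epsilon>\<^sup>2 * (\<kappa> * A)"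
      using i1 I2 I3 by (simp add: A_def)
    also have "\<dots> = ((N - 2)\<^sup>2 / 4 + 4 * \<epsilon>\<^sup>2 * \<kappa>) * (\<integral>x. (norm (dunkl_gradient Rp k u x))\<^sup>2 \<partial>\<mu>)"
      unfolding G1 by (simp add: algebra_simps)
    finally show ?thesis using tu G1 A by auto
  qed
  with G(1) show ?thesis by (rule that)
qed

lemma dunkl_rellich_sharp:
  assumes C: "\<And>u. test_function u \<Longrightarrow>
    C * (\<integral>x. (norm (dunkl_gradient Rp k u x))\<^sup>2 \<partial>\<mu>) \<le> (\<integral>x. (norm x)\<^sup>2 * \<bar>L u x\<bar>\<^sup>2 \<partial>\<mu>)"
  shows "C \<le> (N - 2)\<^sup>2 / 4"
proof -
  obtain \<kappa> where \<kappa>: "\<kappa> \<ge> 0" "\<And>\<epsilon>. \<epsilon> > 0 \<Longrightarrow> \<exists>u. test_function u \<and>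
    (\<integral>x. (norm (dunkl_gradient Rp k u x))\<^sup>2 \<partial>\<mu>) > 0 \<and>
    (\<integral>x. (norm x)\<^sup>2 * \<bar>L u x\<bar>\<^sup>2 \<partial>\<mu>)
      = ((N - 2)\<^sup>2 / 4 + 4 * \<epsilon>\<^sup>2 * \<kappa>) * (\<integral>x. (norm (dunkl_gradient Rp k u x))\<^sup>2 \<partial>\<mu>)"
    by (rule near_extremals) blast
  have le: "C \<le> (N - 2)\<^sup>2 / 4 + 4 * \<epsilon>\<^sup>2 * \<kappa>" if "\<epsilon> > 0" for \<epsilon>
  proof -
    obtain u where u: "test_function u" "(\<integral>x. (norm (dunkl_gradient Rp k u x))\<^sup>2 \<partial>\<mu>) > 0"
      "(\<integral>x. (norm x)\<^sup>2 * \<bar>L u x\<bar>\<^sup>2 \<partial>\<mu>)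
        = ((N - 2)\<^sup>2 / 4 + 4 * \<epsilon>\<^sup>2 * \<kappa>) * (\<integral>x. (norm (dunkl_gradient Rp k u x))\<^sup>2 \<partial>\<mu>)"
      using \<kappa>(2)[OF \<open>\<epsilon> > 0\<close>] by blast
    show ?thesis using C[OF u(1)] u(2) unfolding u(3) by (rule mult_right_le_imp_le)
  qed
  have "((\<lambda>\<epsilon>. (N - 2)\<^sup>2 / 4 + 4 * \<epsilon>\<^sup>2 * \<kappa>) \<longlongrightarrow> (N - 2)\<^sup>2 / 4 + 4 * 0\<^sup>2 * \<kappa>) (at_right 0)"
    by (intro tendsto_intros)
  moreover have "\<forall>\<^sub>F \<epsilon> in at_right 0. C \<le> (N - 2)\<^sup>2 / 4 + 4 * \<epsilon>\<^sup>2 * \<kappa>"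
    using le by (simp add: eventually_at_filter)
  ultimately show ?thesis using tendsto_lowerbound[where F = "at_right (0 :: real)"] by fastforce
qed

end

theorem theorem4p1:
  fixes R Rp :: "(real ^ 'n) set" and k :: "real ^ 'n \<Rightarrow> real"
  assumes "normalized_root_system R"
    and "positive_subsystem R Rp"
    and "multiplicity_function R k"
    and "homogeneous_dim Rp k \<noteq> 2"
  shows "(\<forall>u. test_function u \<longrightarrow>
            (\<integral>x. (norm x)\<^sup>2 * \<bar>dunkl_laplacian Rp k u x\<bar>\<^sup>2 \<partial>dunkl_measure Rp k)
              \<ge> (homogeneous_dim Rp k - 2)\<^sup>2 / 4 *
                 (\<integral>x. (norm (dunkl_gradient Rp k u x))\<^sup>2 \<partial>dunkl_measure Rp k)) \<and>
         (\<forall>C. (\<forall>u. test_function u \<longrightarrow>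
                 (\<integral>x. (norm x)\<^sup>2 * \<bar>dunkl_laplacian Rp k u x\<bar>\<^sup>2 \<partial>dunkl_measure Rp k)
                   \<ge> C * (\<integral>x. (norm (dunkl_gradient Rp k u x))\<^sup>2 \<partial>dunkl_measure Rp k))
              \<longrightarrow> C \<le> (homogeneous_dim Rp k - 2)\<^sup>2 / 4)"
proof -
  interpret dunkl R Rp k using assms(1-3) by unfold_locales
  have "(homogeneous_dim Rp k - 2)\<^sup>2 / 4 * (\<integral>x. (norm (dunkl_gradient Rp k u x))\<^sup>2 \<partial>dunkl_measure Rp k)
      \<le> (\<integral>x. (norm x)\<^sup>2 * \<bar>dunkl_laplacian Rp k u x\<bar>\<^sup>2 \<partial>dunkl_measure Rp k)"
    if "test_function u" for u
    using that test_function_compactly_supported[OF that]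
    by (intro dunkl_rellich_inequality) (simp_all only: test_function_def)
  then show ?thesis using dunkl_rellich_sharp by blast
qed

end
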